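(* Let $X=\mathbb T^{\bowtie}$ be the fully split circle, let $\alpha\in\mathbb T$ be irrational, let $G=\langle R,J\rangle$ with $R=P_{1,\alpha}$ and $J=P_{-1,0}$, let $x_0=0^+$, and for $\delta\in\{+,-\}$ let $\mu_\delta$ be the Haar decompression of the Ellis group $K_\delta=\{P^\delta_{\varepsilon,a}:\varepsilon\in\{\pm1\},a\in\mathbb T\}$ of $E(X,G)$. Then for every $\delta\in\{+,-\}$ and every $F\in C(E(X,G),\mathbb C)$, $$\int_{E(X,G)}F\,d\mu_\delta=\frac12\sum_{\varepsilon\in\{\pm1\}}\int_{\mathbb T}F(P^\delta_{\varepsilon,a})\,da .$$ The two decompressions coincide, $\mu_+=\mu_-=:\mu_E$, and $\mu_E$ is $G$-invariant. The ambit $(X,x_0,G)$ is uniquely ergodic. Its unique invariant probability measure $\nu_X$ satisfies $$\int_X\varphi\,d\nu_X=\frac12\int_{\mathbb T}\bigl(\varphi(a^+)+\varphi(a^-)\bigr)\,da\qquad(\varphi\in C(X,\mathbb C)),$$ and $(\operatorname{ev}_{x_0})_*\mu_+=(\operatorname{ev}_{x_0})_*\mu_-=\nu_X$.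
   Context: $\mathbb T=\mathbb R/\mathbb Z$ with its usual circular order, and $da$ is normalized Haar measure on $\mathbb T$. The fully split circle $\mathbb T^{\bowtie}$ is obtained by replacing each $t\in\mathbb T$ by two adjacent points $t^-<t^+$, with the cyclic-order topology (generated by open cyclic intervals); it is compact Hausdorff with a clopen basis given by the arcs $[a^+,b^-]$, $a\ne b$, where $[a^+,b^-]$ consists of $a^+$, $b^-$ and all $t^{\pm}$ with $t$ strictly between $a$ and $b$ in the positive direction. For a sign $\rho\in\{+,-\}$ put $\rho^1:=\rho$ and let $\rho^{-1}$ be the opposite sign. For $\varepsilon\in\{\pm1\}$, $a\in\mathbb T$, $\delta\in\{+,-\}$ define maps $X\to X$ by $$P_{\varepsilon,a}(t^\rho)=(\varepsilon t+a)^{\rho^\varepsilon},\qquad P^\delta_{\varepsilon,a}(t^\rho)=(\varepsilon t+a)^\delta .$$ The (discrete) group $G=\langle R,J\rangle=\{P_{\varepsilon,d}:\varepsilon\in\{\pm1\},d\in\langle\alpha\rangle\}$ acts on $X$ by homeomorphisms, $(X,x_0,G)$ is an ambit (the orbit of $x_0$ is dense) and the flow $(X,G)$ is tame (every element of $E(X,G)$ is a fragmented self-map of $X$: for every nonempty $A\subseteq X$ and every entourage $V$ of the unique compatible uniformity, there is a nonempty relatively open $U\subseteq A$ whose image has all pairs of points in $V$). $E(X,G)$ is the closure of $G$ in $X^X$ with the product topology; it is a semigroup under composition and a $G$-flow under left composition. For $x\in X$, $\operatorname{ev}_x(p)=p(x)$. One has $E(X,G)=G\,\dot\cup\,M_+\,\dot\cup\,M_-$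 with $M_\delta=\{P^\delta_{\varepsilon,a}:\varepsilon\in\{\pm1\},a\in\mathbb T\}$; $M=M_+\cup M_-$ is its unique minimal left ideal, $u_\delta=P^\delta_{1,0}$ is an idempotent of $M$, and the corresponding Ellis group is $K_\delta=u_\delta M=M_\delta$. In general, for an Ellis group $K=u\mathcal M$ ($\mathcal M$ a minimal left ideal of the enveloping semigroup $E$, $u\in\mathcal M$ idempotent), for $p\in E$, $A\subseteq E$ let $p\circ A$ be the set of $q\in E$ for which there are nets $(g_i)$ in $G$ and $(a_i)$ in $A$ with $g_i\to p$ and $g_ia_i\to q$; the $\tau$-topology on $K$ is the topology with closure operator $\operatorname{cl}_\tau(A)=K\cap(u\circ A)$. For tame flows $(K,\tau)$ is a compact Hausdorff topological group with normalized Haar measure $\mathfrak h_K$, restrictions to $K$ of continuous functions on $E$ are $\mathfrak h_K$-measurable (for the completion), and the Haar decompression of $K$ is the unique regular Borel probability measure $\mu_K$ on $E$ with $\int_E F\,d\mu_K=\int_K F(k)\,d\mathfrak h_K(k)$ for all $F\in C(E,\mathbb C)$. All probability measures are regular Borel; a flow is uniquely ergodic if it has exactly one $G$-invariant regular Borel probability measure. *)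

theory Defs
  imports "HOL-Probability.Probability_Measure" "HOL-Algebra.Bij" "HOL-Algebra.Generated_Groups"
begin

section \<open>Regular Borel probability measures and Haar measure\<close>

definition borel_of :: "'a topology \<Rightarrow> 'a measure" where
  "borel_of T = sigma (topspace T) {U. openin T U}"

definition regular_borel_prob :: "'a topology \<Rightarrow> 'a measure \<Rightarrow> bool" where
  "regular_borel_prob T \<mu> \<longleftrightarrow>
     prob_space \<mu> \<and> sets \<mu> = sets (borel_of T) \<and>
     (\<forall>B\<in>sets \<mu>.
        emeasure \<mu> B = (SUP C\<in>{C. closedin T C \<and> compactin T C \<and> C \<subseteq> B}. emeasure \<mu> C) \<and>
        emeasure \<mu> B = (INF U\<in>{U. openin T U \<and> B \<subseteq> U}. emeasure \<mu> U))"

definition invariant_measure :: "('a \<Rightarrow> 'a) set \<Rightarrow> 'a measure \<Rightarrow> bool" where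
  "invariant_measure S \<mu> \<longleftrightarrow> (\<forall>f\<in>S. f \<in> measurable \<mu> \<mu> \<and> distr \<mu> \<mu> f = \<mu>)"

text \<open>The group operation \<open>m\<close> is only used on \<open>topspace T\<close>, so that \<open>T\<close> may live on a proper
  subset of its type.\<close>

definition haar_measure :: "'a topology \<Rightarrow> ('a \<Rightarrow> 'a \<Rightarrow> 'a) \<Rightarrow> 'a measure" where
  "haar_measure T m =
     (THE \<mu>. regular_borel_prob T \<mu> \<and> invariant_measure (m ` topspace T) \<mu>)"


section \<open>Flows, enveloping semigroups, Ellis groups\<close>

text \<open>A flow is given by a set \<open>G\<close> of self-maps of a space, the space being the universe of
  a type \<open>'x\<close>. The library topology on \<open>'x \<Rightarrow> 'x\<close> is the product topology.\<close>

definition enveloping_semigroup :: "('x::topological_space \<Rightarrow> 'x) set \<Rightarrow> ('x \<Rightarrow> 'x) set" where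
  "enveloping_semigroup G = closure G"

definition left_ideal :: "('x \<Rightarrow> 'x) set \<Rightarrow> ('x \<Rightarrow> 'x) set \<Rightarrow> bool" where
  "left_ideal E I \<longleftrightarrow> I \<noteq> {} \<and> I \<subseteq> E \<and> (\<forall>p\<in>E. \<forall>q\<in>I. p \<circ> q \<in> I)"

definition minimal_left_ideal :: "('x \<Rightarrow> 'x) set \<Rightarrow> ('x \<Rightarrow> 'x) set \<Rightarrow> bool" where
  "minimal_left_ideal E I \<longleftrightarrow> left_ideal E I \<and> (\<forall>I'. left_ideal E I' \<and> I' \<subseteq> I \<longrightarrow> I' = I)"

definition is_ellis_group ::
  "('x::topological_space \<Rightarrow> 'x) set \<Rightarrow> ('x \<Rightarrow> 'x) set \<Rightarrow> ('x \<Rightarrow> 'x) \<Rightarrow> ('x \<Rightarrow> 'x) set \<Rightarrow> bool" where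
  "is_ellis_group G M u K \<longleftrightarrow>
     minimal_left_ideal (enveloping_semigroup G) M \<and> u \<in> M \<and> u \<circ> u = u \<and> K = (\<lambda>p. u \<circ> p) ` M"

text \<open>A pair of nets \<open>(g\<^sub>i)\<close>, \<open>(a\<^sub>i)\<close> over a common index set is rendered by a proper filter on
  pairs, namely the image of the tail filter of the index set; conversely, a proper filter
  containing \<open>G \<times> A\<close> is the image of the tail filter of some net in \<open>G \<times> A\<close>.\<close>

definition circle_op ::
  "('x::topological_space \<Rightarrow> 'x) set \<Rightarrow> ('x \<Rightarrow> 'x) \<Rightarrow> ('x \<Rightarrow> 'x) set \<Rightarrow> ('x \<Rightarrow> 'x) set" where
  "circle_op G p A =
     {q \<in> enveloping_semigroup G.
        \<exists>\<F>. \<F> \<noteq> bot \<and> eventually (\<lambda>(g, a). g \<in> G \<and> a \<in> A) \<F> \<and>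
            ((\<lambda>(g, a). g) \<longlongrightarrow> p) \<F> \<and> ((\<lambda>(g, a). g \<circ> a) \<longlongrightarrow> q) \<F>}"

definition tau_topology ::
  "('x::topological_space \<Rightarrow> 'x) set \<Rightarrow> ('x \<Rightarrow> 'x) \<Rightarrow> ('x \<Rightarrow> 'x) set \<Rightarrow> ('x \<Rightarrow> 'x) topology" where
  "tau_topology G u K =
     (THE T. topspace T = K \<and>
             (\<forall>A. A \<subseteq> K \<longrightarrow> Abstract_Topology.closure_of T A = K \<inter> circle_op G u A))"

definition ellis_haar ::
  "('x::topological_space \<Rightarrow> 'x) set \<Rightarrow> ('x \<Rightarrow> 'x) \<Rightarrow> ('x \<Rightarrow> 'x) set \<Rightarrow> ('x \<Rightarrow> 'x) measure" where
  "ellis_haar G u K = haar_measure (tau_topology G u K) (\<circ>)"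

definition haar_decompression ::
  "('x::topological_space \<Rightarrow> 'x) set \<Rightarrow> ('x \<Rightarrow> 'x) \<Rightarrow> ('x \<Rightarrow> 'x) set \<Rightarrow> ('x \<Rightarrow> 'x) measure" where
  "haar_decompression G u K =
     (THE \<mu>. regular_borel_prob (top_of_set (enveloping_semigroup G)) \<mu> \<and>
             (\<forall>F :: ('x \<Rightarrow> 'x) \<Rightarrow> complex. continuous_on (enveloping_semigroup G) F \<longrightarrow>
                integrable (completion (ellis_haar G u K)) F \<and>
                (\<integral>p. F p \<partial>\<mu>) = (\<integral>k. F k \<partial>completion (ellis_haar G u K))))"

definition invariant_prob :: "('x::topological_space \<Rightarrow> 'x) set \<Rightarrow> 'x measure \<Rightarrow> bool" where
  "invariant_prob G \<nu> \<longleftrightarrow> regular_borel_prob euclidean \<nu> \<and> invariant_measure G \<nu>"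

definition uniquely_ergodic :: "('x::topological_space \<Rightarrow> 'x) set \<Rightarrow> bool" where
  "uniquely_ergodic G \<longleftrightarrow> (\<exists>!\<nu>. invariant_prob G \<nu>)"


section \<open>The circle\<close>

quotient_type circle = real / "\<lambda>x y :: real. x - y \<in> \<int>"
proof (rule equivpI)
  show "reflp (\<lambda>x y :: real. x - y \<in> \<int>)"
    by (simp add: reflp_def)
  show "symp (\<lambda>x y :: real. x - y \<in> \<int>)"
    by (metis (mono_tags, lifting) Ints_minus minus_diff_eq sympI)
  show "transp (\<lambda>x y :: real. x - y \<in> \<int>)"
  proof (rule transpI)
    fix x y z :: real
    assume "x - y \<in> \<int>" "y - z \<in> \<int>"
    then have "(x - y) + (y - z) \<in> \<int>" by (rule Ints_add)
    then show "x - z \<in> \<int>" by simp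
  qed
qed

instantiation circle :: ab_group_add
begin

lift_definition zero_circle :: circle is 0 .

lift_definition plus_circle :: "circle \<Rightarrow> circle \<Rightarrow> circle" is "(+)"
  by (metis (no_types, lifting) Ints_add add_diff_add)

lift_definition uminus_circle :: "circle \<Rightarrow> circle" is uminus
  by (metis Ints_minus minus_diff_minus)

lift_definition minus_circle :: "circle \<Rightarrow> circle \<Rightarrow> circle" is "(-)"
proof -
  fix a b c d :: real
  assume "a - b \<in> \<int>" "c - d \<in> \<int>"
  then have "(a - b) - (c - d) \<in> \<int>" by (rule Ints_diff)
  then show "(a - c) - (b - d) \<in> \<int>" by (simp add: algebra_simps)
qed

instance
  by standard (transfer, simp)+

end

lift_definition int_mult :: "int \<Rightarrow> circle \<Rightarrow> circle" is "\<lambda>n x. of_int n * x"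
  by (metis Ints_mult Ints_of_int right_diff_distrib)

lift_definition irrational :: "circle \<Rightarrow> bool" is "\<lambda>x. x \<notin> \<rat>"
proof -
  fix x y :: real
  assume "x - y \<in> \<int>"
  then have *: "x - y \<in> \<rat>" using Ints_subset_Rats by blast
  have "x \<in> \<rat>" if "y \<in> \<rat>" using Rats_add[OF * that] by simp
  moreover have "y \<in> \<rat>" if "x \<in> \<rat>" using Rats_diff[OF that *] by simp
  ultimately show "(x \<notin> \<rat>) = (y \<notin> \<rat>)" by blast
qed

lift_definition representative :: "circle \<Rightarrow> real" is frac
proof -
  fix x y :: real
  assume "x - y \<in> \<int>"
  then obtain n where "x = y + of_int n"
    by (metis Ints_cases add_diff_cancel_left' diff_add_cancel add.commute)
  then show "frac x = frac y" by (simp add: frac_def)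
qed

instantiation circle :: topological_space
begin

definition open_circle :: "circle set \<Rightarrow> bool" where
  "open_circle U \<longleftrightarrow> open (abs_circle -` U)"

instance
proof
  show "open (UNIV :: circle set)"
    by (simp add: open_circle_def)
  show "open (S \<inter> T)" if "open S" "open T" for S T :: "circle set"
    using that by (simp add: open_circle_def open_Int)
  show "open (\<Union>K)" if "\<forall>S\<in>K. open S" for K :: "circle set set"
    using that by (auto simp: open_circle_def vimage_Union)
qed

end

definition circle_haar :: "circle measure" where
  "circle_haar = haar_measure euclidean (+)"


section \<open>The fully split circle\<close>

datatype sign = Plus | Minus

fun opposite :: "sign \<Rightarrow> sign" where
  "opposite Plus = Minus"
| "opposite Minus = Plus"

datatype split_circle = Split circle sign

text \<open>The circular order is the one induced by the linear order that arises by cutting the split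
  circle open just before \<open>0\<^sup>-\<close>: points are compared by their representatives in \<open>[0,1)\<close>, and
  \<open>t\<^sup>-\<close> comes immediately before \<open>t\<^sup>+\<close>.\<close>

fun cut_less :: "split_circle \<Rightarrow> split_circle \<Rightarrow> bool" where
  "cut_less (Split s \<rho>) (Split t \<sigma>) \<longleftrightarrow>
     representative s < representative t \<or> (s = t \<and> \<rho> = Minus \<and> \<sigma> = Plus)"

definition cyclic :: "split_circle \<Rightarrow> split_circle \<Rightarrow> split_circle \<Rightarrow> bool" where
  "cyclic x y z \<longleftrightarrow>
     (cut_less x y \<and> cut_less y z) \<or> (cut_less y z \<and> cut_less z x) \<or> (cut_less z x \<and> cut_less x y)"

definition cyclic_interval :: "split_circle \<Rightarrow> split_circle \<Rightarrow> split_circle set" where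
  "cyclic_interval x z = {y. cyclic x y z}"

instantiation split_circle :: topological_space
begin

definition open_split_circle :: "split_circle set \<Rightarrow> bool" where
  "open_split_circle = generate_topology {cyclic_interval x z | x z. x \<noteq> z}"

instance
  by standard (auto simp: open_split_circle_def
    intro: generate_topology.UNIV generate_topology.Int generate_topology.UN)

end

text \<open>Here and below the exponent \<open>\<epsilon>\<close> is meant to be \<open>1\<close> or \<open>-1\<close>.\<close>

definition sign_power :: "sign \<Rightarrow> int \<Rightarrow> sign" where
  "sign_power \<rho> \<epsilon> = (if \<epsilon> = 1 then \<rho> else opposite \<rho>)"

fun P_map :: "int \<Rightarrow> circle \<Rightarrow> split_circle \<Rightarrow> split_circle" where
  "P_map \<epsilon> a (Split t \<rho>) = Split (int_mult \<epsilon> t + a) (sign_power \<rho> \<epsilon>)"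

fun P_side :: "sign \<Rightarrow> int \<Rightarrow> circle \<Rightarrow> split_circle \<Rightarrow> split_circle" where
  "P_side \<delta> \<epsilon> a (Split t \<rho>) = Split (int_mult \<epsilon> t + a) \<delta>"

definition K_side :: "sign \<Rightarrow> (split_circle \<Rightarrow> split_circle) set" where
  "K_side \<delta> = {P_side \<delta> \<epsilon> a | \<epsilon> a. \<epsilon> \<in> {1, -1}}"

end

theory Submission
  imports Defs "HOL-Analysis.Kronecker_Approximation_Theorem" "HOL-Analysis.Analysis"
begin

text \<open>
  The space is handled through one-sided limits on the circle: the two points over \<open>a\<close> are the limits
  from the right and from the left of the points of \<^emph>\<open>both\<close> signs. The maps \<open>P_side \<delta> \<epsilon> a\<close> behave in the
  same way inside the enveloping semigroup, and so do limits of the maps \<open>P_map \<epsilon> d\<close>. Comparing signs shows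
  that a limit of group elements is either a group element or some \<open>P_side \<delta> \<epsilon> a\<close>
  (\<open>closure_one_orientation\<close>), which gives the enveloping semigroup and its minimal left ideal.

  The central point is that a Borel set, of the split circle or of the enveloping semigroup, contains the
  limits of both sides over \<open>a\<close> or neither, for all but countably many \<open>a\<close> (\<open>two_sided_borel\<close>). For open
  sets this holds because the exceptional points are isolated from one side. Therefore measures that give no
  mass to countable sets of fibres see only the base circle: pushing Haar measure forward along
  \<open>a \<mapsto> P_side \<delta> \<epsilon> a\<close> yields the same Borel measure for both \<open>\<delta>\<close>, and this measure is regular because compact
  sets of the base lift to closed sets once the countable set of translations in the group is avoided
  (\<open>regular_\<mu>_E\<close>).

  The \<open>\<tau>\<close>-topology on an Ellis group is that of two circles: convergence of \<open>P_side \<delta> \<epsilon> a\<^sub>i\<close> in the semigroup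
  is one-sided, but the additional factor \<open>g\<^sub>i\<close> in the definition of \<open>\<circ>\<close> shifts \<open>a\<^sub>i\<close> to the correct side
  (\<open>tau_topology_eq\<close>). So the Ellis group is the isometry group of the circle, its Haar measure is the
  average of the two arc lengths, and the pushforward above is its decompression; it is determined by the
  integrals of continuous functions because clopen sets form a base.

  Finally, an invariant measure on the split circle projects to a measure on the circle that is invariant
  under a dense group of rotations. This must be arc length (\<open>dense_invariant_eq_arc_length\<close>), and since arc
  length has no atoms, the measure is determined by its projection. Existence comes from evaluating the
  decompression at the base point.
\<close>

section \<open>The circle as a Hausdorff topological group\<close>

lemma abs_circle_eq_iff: "abs_circle x = abs_circle y \<longleftrightarrow> x - y \<in> \<int>"
  by (simp add: circle.abs_eq_iff)

lemma abs_circle_cases: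
  obtains r where "a = abs_circle r"
  using circle.abs_induct[of "\<lambda>a. \<exists>r. a = abs_circle r" a] by blast

lemma abs_circle_representative [simp]: "abs_circle (representative a) = a"
proof -
  obtain r where "a = abs_circle r" by (rule abs_circle_cases)
  then show ?thesis
    by (simp add: representative.abs_eq abs_circle_eq_iff frac_def)
qed

lemma representative_bounds: "0 \<le> representative a" "representative a < 1"
  by (transfer, simp add: frac_lt_1)+

lemma representative_abs_circle: "0 \<le> r \<Longrightarrow> r < 1 \<Longrightarrow> representative (abs_circle r) = r"
  by (simp add: representative.abs_eq frac_eq)

lemma abs_circle_add: "abs_circle (r + s) = abs_circle r + abs_circle s"
  by (simp add: plus_circle.abs_eq)

lemma abs_circle_diff: "abs_circle (r - s) = abs_circle r - abs_circle s"
  by (simp add: minus_circle.abs_eq)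

lemma abs_circle_uminus: "abs_circle (- r) = - abs_circle r"
  by (simp add: uminus_circle.abs_eq)

lemma abs_circle_zero: "abs_circle 0 = 0"
  by (simp add: zero_circle.abs_eq)

lemma int_mult_one [simp]: "int_mult 1 a = a"
  by transfer simp

lemma int_mult_minus_one [simp]: "int_mult (-1) a = - a"
  by transfer simp

lemma continuous_on_abs_circle: "continuous_on UNIV abs_circle"
  by (simp add: continuous_on_open_vimage open_circle_def)

lemma vimage_abs_circle_image: "abs_circle -` (abs_circle ` S) = (\<Union>n::int. (\<lambda>x. x + of_int n) ` S)"
proof (intro Set.set_eqI iffI)
  fix x assume "x \<in> abs_circle -` (abs_circle ` S)"
  then obtain y where y: "y \<in> S" "x - y \<in> \<int>"
    by (auto simp: abs_circle_eq_iff)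
  then obtain n where "x = y + of_int n"
    by (metis Ints_cases add.commute diff_add_cancel)
  with y show "x \<in> (\<Union>n::int. (\<lambda>x. x + of_int n) ` S)" by auto
qed (auto simp: abs_circle_eq_iff image_iff intro!: bexI)

lemma open_abs_circle_image:
  assumes "open S" shows "open (abs_circle ` S)"
proof -
  have "open ((\<lambda>x. x + of_int n) ` S)" for n :: int
    using open_translation[OF assms, of "of_int n"] by (simp add: add.commute)
  then show ?thesis
    unfolding open_circle_def vimage_abs_circle_image by blast
qed

lemma nhds_abs_circle: "nhds (abs_circle r) = filtermap abs_circle (nhds r)"
  using continuous_on_abs_circle open_abs_circle_image
  by (intro filtermap_nhds_open_map [symmetric])
     (auto simp: continuous_on_eq_continuous_within)

instance circle :: topological_group_add
proof
  fix a b :: circle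
  show "((\<lambda>x. fst x + snd x) \<longlongrightarrow> a + b) (nhds a \<times>\<^sub>F nhds b)"
  proof -
    obtain r s where ab: "a = abs_circle r" "b = abs_circle s"
      by (metis abs_circle_cases)
    have "((\<lambda>x::real\<times>real. abs_circle (fst x + snd x)) \<longlongrightarrow> abs_circle (r + s)) (nhds r \<times>\<^sub>F nhds s)"
      using continuous_on_abs_circle tendsto_add_Pair[of r s]
      by (auto simp: continuous_on_eq_continuous_within intro: isCont_tendsto_compose)
    then show ?thesis
      by (simp add: ab nhds_abs_circle prod_filtermap1 prod_filtermap2 filterlim_filtermap
          abs_circle_add case_prod_unfold)
  qed
  show "(uminus \<longlongrightarrow> - a) (nhds a)"
  proof -
    obtain r where a: "a = abs_circle r" by (rule abs_circle_cases)
    have "((\<lambda>x. abs_circle (- x)) \<longlongrightarrow> abs_circle (- r)) (nhds r)"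
      using continuous_on_abs_circle
      by (auto simp: continuous_on_eq_continuous_within
          intro!: isCont_tendsto_compose[of _ abs_circle] tendsto_minus tendsto_ident_at filterlim_ident)
    then show ?thesis
      by (simp add: a nhds_abs_circle filterlim_filtermap abs_circle_uminus)
  qed
qed

instance circle :: t2_space
proof
  fix a b :: circle
  assume "a \<noteq> b"
  define c where "c = representative (a - b)"
  have ab: "a - b = abs_circle c" by (simp add: c_def)
  then have "c \<noteq> 0" using \<open>a \<noteq> b\<close> abs_circle_zero by auto
  then have c: "0 < c" "c < 1"
    using representative_bounds[of "a - b"] by (auto simp: c_def)
  \<comment> \<open>half the distance from \<open>c\<close> to the integers, so that points within \<open>e\<close> of \<open>c\<close> and of \<open>0\<close> never differ by
    an integer\<close>
  define e where "e = min c (1 - c) / 2"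
  have e: "0 < e" "2 * e \<le> c" "2 * e \<le> 1 - c" using c by (auto simp: e_def)
  define U where "U = (\<lambda>x. x - b) -` (abs_circle ` {c-e<..<c+e})"
  define V where "V = (\<lambda>x. x - b) -` (abs_circle ` {-e<..<e})"
  have cont: "continuous_on UNIV (\<lambda>x::circle. x - b)"
    unfolding diff_conv_add_uminus by (intro continuous_intros)
  have "open U" "open V"
    unfolding U_def V_def
    by (intro open_vimage cont open_abs_circle_image open_greaterThanLessThan)+
  moreover have "a \<in> U" "b \<in> V"
    using e by (auto simp: U_def V_def ab abs_circle_zero[symmetric])
  moreover have "U \<inter> V = {}"
  proof (rule ccontr)
    assume "U \<inter> V \<noteq> {}"
    then obtain z where "z - b \<in> abs_circle ` {c-e<..<c+e}" "z - b \<in> abs_circle ` {-e<..<e}"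
      by (auto simp: U_def V_def)
    then obtain x y where xy: "x \<in> {c-e<..<c+e}" "y \<in> {-e<..<e}" "abs_circle x = abs_circle y"
      by (metis imageE)
    then obtain n :: int where "x - y = of_int n"
      by (auto simp: abs_circle_eq_iff elim: Ints_cases)
    moreover have "0 < x - y" "x - y < 1" using xy(1,2) e by auto
    ultimately have "0 < n" "n < 1" by auto
    then show False by simp
  qed
  ultimately show "\<exists>U V. open U \<and> open V \<and> a \<in> U \<and> b \<in> V \<and> U \<inter> V = {}" by blast
qed

section \<open>Borel structure and Haar measure of the circle\<close>

lemma measurable_abs_circle [measurable]: "abs_circle \<in> borel_measurable borel"
  by (rule borel_measurable_continuous_onI[OF continuous_on_abs_circle])

lemma measurable_representative [measurable]: "representative \<in> borel_measurable borel"
proof (rule borel_measurableI_less)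
  fix y :: real
  consider "y \<le> 0" | "0 < y" "y \<le> 1" | "1 < y" by linarith
  then show "{x \<in> space borel. representative x < y} \<in> sets borel"
  proof cases
    case 1
    then have "{x \<in> space borel. representative x < y} = {}"
      using representative_bounds(1) by (auto simp: not_less intro: order_trans)
    then show ?thesis by simp
  next
    case 2
    have "{x \<in> space borel. representative x < y} = {0} \<union> abs_circle ` {0<..<y}"
    proof (intro Set.set_eqI iffI)
      fix x assume "x \<in> {x \<in> space borel. representative x < y}"
      then show "x \<in> {0} \<union> abs_circle ` {0<..<y}"
        using representative_bounds(1)[of x] abs_circle_representative[of x]
        by (cases "representative x = 0")
           (auto simp: abs_circle_zero simp del: abs_circle_representative
              intro!: rev_image_eqI[of "representative x"])
    next
      fix x assume "x \<in> {0} \<union> abs_circle ` {0<..<y}"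
      then show "x \<in> {x \<in> space borel. representative x < y}"
        using 2 by (auto simp: representative_abs_circle abs_circle_zero[symmetric])
    qed
    moreover have "open (abs_circle ` {0<..<y})" by (intro open_abs_circle_image) auto
    ultimately show ?thesis by auto
  next
    case 3
    then have "{x \<in> space borel. representative x < y} = UNIV"
      using representative_bounds(2) by (auto intro: less_trans)
    then show ?thesis by simp
  qed
qed

lemma measurable_circle_add [measurable]:
  assumes [measurable]: "f \<in> borel_measurable M" "g \<in> borel_measurable M"
  shows "(\<lambda>x. f x + g x :: circle) \<in> borel_measurable M"
proof -
  have "(\<lambda>x. abs_circle (representative (f x) + representative (g x))) \<in> borel_measurable M"
    by measurable
  then show ?thesis by (simp add: abs_circle_add)
qed

lemma measurable_circle_uminus [measurable]:
  assumes [measurable]: "f \<in> borel_measurable M"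
  shows "(\<lambda>x. - f x :: circle) \<in> borel_measurable M"
proof -
  have "(\<lambda>x. abs_circle (- representative (f x))) \<in> borel_measurable M"
    by measurable
  then show ?thesis by (simp add: abs_circle_uminus)
qed

text \<open>The Borel structure of the circle is that of its fundamental domain, via \<open>representative\<close>.\<close>

lemma borel_circleI:
  assumes "abs_circle -` A \<in> sets borel" shows "A \<in> sets borel"
proof -
  have "representative -` (abs_circle -` A) \<inter> space borel \<in> sets borel"
    by (rule measurable_sets[OF measurable_representative assms])
  then show ?thesis by (simp add: vimage_def)
qed

definition unit_lebesgue :: "real measure" where
  "unit_lebesgue = uniform_measure lborel {0..<1}"

text \<open>This is Haar measure (\<open>circle_haar_eq\<close>), in a form in which translations can be computed.\<close>

definition arc_length :: "circle measure" where
  "arc_length = distr unit_lebesgue borel abs_circle"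

lemma sets_unit_lebesgue [simp, measurable_cong]: "sets unit_lebesgue = sets borel"
  by (simp add: unit_lebesgue_def)

lemma space_unit_lebesgue [simp]: "space unit_lebesgue = UNIV"
  by (simp add: unit_lebesgue_def)

lemma sets_arc_length [simp, measurable_cong]: "sets arc_length = sets borel"
  by (simp add: arc_length_def)

lemma space_arc_length [simp]: "space arc_length = UNIV"
  by (simp add: arc_length_def)

interpretation unit_lebesgue: prob_space unit_lebesgue
  unfolding unit_lebesgue_def by (rule prob_space_uniform_measure) simp_all

interpretation arc_length: prob_space arc_length
  unfolding arc_length_def by (rule unit_lebesgue.prob_space_distr) simp

lemma emeasure_arc_length:
  assumes "B \<in> sets borel"
  shows "emeasure arc_length B = emeasure lborel (abs_circle -` B \<inter> {0..<1})"
proof -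
  have *: "abs_circle -` B \<in> sets borel"
    using measurable_sets[OF measurable_abs_circle assms] by simp
  show ?thesis
    using assms * by (simp add: arc_length_def emeasure_distr unit_lebesgue_def emeasure_uniform_measure Int_commute divide_ennreal_def)
qed

lemma emeasure_lborel_translate:
  assumes "A \<in> sets borel"
  shows "emeasure lborel ((\<lambda>x. x + c) -` A) = emeasure lborel (A :: real set)"
proof -
  have "emeasure lborel A = emeasure (distr lborel borel ((+) c)) A"
    by (simp add: lborel_distr_plus)
  also have "\<dots> = emeasure lborel ((+) c -` A)"
    using assms by (subst emeasure_distr) auto
  also have "(+) c = (\<lambda>x. x + c)" by auto
  finally show ?thesis by simp
qed

text \<open>A periodic set has the same length in every half-open unit interval: the part beyond \<open>1\<close> is
  moved back by a full turn.\<close>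

lemma distr_arc_length_translate: "distr arc_length borel ((+) b) = arc_length"
proof (rule measure_eqI)
  fix B assume "B \<in> sets (distr arc_length borel ((+) b))"
  then have B: "B \<in> sets borel" by simp
  define c where "c = representative b"
  have c: "0 \<le> c" "c < 1" using representative_bounds by (auto simp: c_def)
  define A where "A = abs_circle -` B"
  have A [measurable]: "A \<in> sets borel"
    using measurable_sets[OF measurable_abs_circle B] by (simp add: A_def)
  have per: "(\<lambda>x. x + 1) -` A = A"
    by (auto simp: A_def abs_circle_add)
       (metis Ints_1 abs_circle_add abs_circle_eq_iff add_diff_cancel_left')+
  have Bb: "(+) b -` B \<in> sets borel"
    using measurable_sets[of "(+) b" borel borel B] B by simp
  have "emeasure (distr arc_length borel ((+) b)) B = emeasure arc_length ((+) b -` B)"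
    using B by (simp add: emeasure_distr)
  also have "\<dots> = emeasure lborel (abs_circle -` ((+) b -` B) \<inter> {0..<1})"
    by (rule emeasure_arc_length[OF Bb])
  also have "abs_circle -` ((+) b -` B) \<inter> {0..<1} = (\<lambda>x. x + c) -` (A \<inter> {c..<1+c})"
    by (auto simp: A_def c_def abs_circle_add add.commute)
  also have "emeasure lborel \<dots> = emeasure lborel (A \<inter> {c..<1+c})"
    by (rule emeasure_lborel_translate) simp
  also have "A \<inter> {c..<1+c} = (A \<inter> {c..<1}) \<union> (A \<inter> {1..<1+c})"
    using c by auto
  also have "emeasure lborel \<dots> = emeasure lborel (A \<inter> {c..<1}) + emeasure lborel (A \<inter> {1..<1+c})"
    by (rule plus_emeasure[symmetric]) auto
  also have "emeasure lborel (A \<inter> {1..<1+c}) = emeasure lborel ((\<lambda>x. x + 1) -` (A \<inter> {1..<1+c}))"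
    by (rule emeasure_lborel_translate[symmetric]) simp
  also have "(\<lambda>x. x + 1) -` (A \<inter> {1..<1+c}) = A \<inter> {0..<c}"
    unfolding vimage_Int per by auto
  also have "emeasure lborel (A \<inter> {c..<1}) + emeasure lborel (A \<inter> {0..<c})
      = emeasure lborel ((A \<inter> {c..<1}) \<union> (A \<inter> {0..<c}))"
    by (rule plus_emeasure) auto
  also have "(A \<inter> {c..<1}) \<union> (A \<inter> {0..<c}) = A \<inter> {0..<1}"
    using c by auto
  also have "emeasure lborel \<dots> = emeasure arc_length B"
    using emeasure_arc_length[OF B] by (simp add: A_def)
  finally show "emeasure (distr arc_length borel ((+) b)) B = emeasure arc_length B" .
qed simp

lemma emeasure_arc_length_countable:
  assumes "countable D" shows "emeasure arc_length D = 0"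
proof -
  have D: "D \<in> sets borel" using assms by (auto intro: sets.countable)
  have "countable (abs_circle -` D \<inter> {0..<1})"
  proof (rule countable_subset)
    show "abs_circle -` D \<inter> {0..<1} \<subseteq> representative ` D"
      using representative_abs_circle by (force simp: image_iff)
  qed (use assms in auto)
  then show ?thesis
    by (simp add: emeasure_arc_length[OF D] emeasure_lborel_countable)
qed

section \<open>Regular Borel probability measures\<close>

lemma space_borel_of [simp]: "space (borel_of T) = topspace T"
  by (simp add: borel_of_def space_measure_of_conv)

lemma sets_borel_of: "sets (borel_of T) = sigma_sets (topspace T) {U. openin T U}"
  unfolding borel_of_def by (rule sets_measure_of) (auto dest: openin_subset)

lemma borel_of_euclidean: "borel_of euclidean = borel"
  by (simp add: borel_of_def borel_def)

lemma openin_borel_of: "openin T U \<Longrightarrow> U \<in> sets (borel_of T)"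
  by (simp add: sets_borel_of sigma_sets.Basic)

lemma closedin_borel_of: "closedin T C \<Longrightarrow> C \<in> sets (borel_of T)"
  using sets.Diff[OF sets.top[of "borel_of T"] openin_borel_of[of T "topspace T - C"]]
  by (auto simp: closedin_def double_diff)

lemma measurable_borel_ofI:
  assumes "f \<in> space M \<rightarrow> topspace T"
    and "\<And>U. openin T U \<Longrightarrow> f -` U \<inter> space M \<in> sets M"
  shows "f \<in> measurable M (borel_of T)"
  unfolding borel_of_def using assms by (intro measurable_sigma_sets[OF sets_measure_of])
    (auto dest: openin_subset)

lemma continuous_map_measurable:
  assumes "continuous_map T T' f"
  shows "f \<in> measurable (borel_of T) (borel_of T')"
proof (rule measurable_borel_ofI)
  fix U assume "openin T' U"
  then have "openin T {x \<in> topspace T. f x \<in> U}"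
    using assms by (simp add: continuous_map)
  moreover have "f -` U \<inter> space (borel_of T) = {x \<in> topspace T. f x \<in> U}" by auto
  ultimately show "f -` U \<inter> space (borel_of T) \<in> sets (borel_of T)"
    by (simp add: openin_borel_of)
qed (use assms in \<open>auto simp: continuous_map\<close>)

lemma regular_borel_probD:
  assumes "regular_borel_prob T \<mu>"
  shows "prob_space \<mu>" "sets \<mu> = sets (borel_of T)" "space \<mu> = topspace T"
  using assms sets_eq_imp_space_eq[of \<mu> "borel_of T"] by (auto simp: regular_borel_prob_def)

text \<open>For a finite measure outer regularity is inner regularity of the complement.\<close>

lemma regular_borel_probI:
  assumes "prob_space \<mu>" and sets: "sets \<mu> = sets (borel_of T)"
    and inner: "\<And>B e. B \<in> sets \<mu> \<Longrightarrow> 0 < e \<Longrightarrow>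
      \<exists>C. closedin T C \<and> compactin T C \<and> C \<subseteq> B \<and> measure \<mu> B \<le> measure \<mu> C + e"
  shows "regular_borel_prob T \<mu>"
  unfolding regular_borel_prob_def
proof (intro conjI ballI)
  interpret prob_space \<mu> by fact
  have space: "space \<mu> = topspace T" using sets_eq_imp_space_eq[OF sets] by simp
  fix B assume B: "B \<in> sets \<mu>"
  show "emeasure \<mu> B = (SUP C\<in>{C. closedin T C \<and> compactin T C \<and> C \<subseteq> B}. emeasure \<mu> C)"
  proof (rule antisym)
    show "emeasure \<mu> B \<le> (SUP C\<in>{C. closedin T C \<and> compactin T C \<and> C \<subseteq> B}. emeasure \<mu> C)"
    proof (rule ennreal_le_epsilon)
      fix e :: real assume "0 < e"
      then obtain C where C: "closedin T C" "compactin T C" "C \<subseteq> B" "measure \<mu> B \<le> measure \<mu> C + e"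
        using inner[OF B] by blast
      have "emeasure \<mu> B \<le> emeasure \<mu> C + ennreal e"
        using C(4) \<open>0 < e\<close> by (simp add: emeasure_eq_measure flip: ennreal_plus)
      also have "emeasure \<mu> C \<le> (SUP C\<in>{C. closedin T C \<and> compactin T C \<and> C \<subseteq> B}. emeasure \<mu> C)"
        using C by (intro SUP_upper) auto
      finally show "emeasure \<mu> B \<le> (SUP C\<in>{C. closedin T C \<and> compactin T C \<and> C \<subseteq> B}. emeasure \<mu> C) + ennreal e"
        by (simp add: add_right_mono)
    qed
  qed (use B in \<open>auto intro!: SUP_least emeasure_mono\<close>)
  show "emeasure \<mu> B = (INF U\<in>{U. openin T U \<and> B \<subseteq> U}. emeasure \<mu> U)"
  proof (rule antisym)
    show "(INF U\<in>{U. openin T U \<and> B \<subseteq> U}. emeasure \<mu> U) \<le> emeasure \<mu> B"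
    proof (rule ennreal_le_epsilon)
      fix e :: real assume "0 < e"
      have Bc: "space \<mu> - B \<in> sets \<mu>" using B by auto
      then obtain C where C: "closedin T C" "C \<subseteq> space \<mu> - B" "measure \<mu> (space \<mu> - B) \<le> measure \<mu> C + e"
        using inner[OF Bc \<open>0 < e\<close>] by blast
      define U where "U = topspace T - C"
      have U: "openin T U" "B \<subseteq> U"
        using C sets.sets_into_space[OF B] by (auto simp: U_def space closedin_def)
      have "C \<in> sets \<mu>" using C(1) by (simp add: sets closedin_borel_of)
      then have "measure \<mu> U = 1 - measure \<mu> C"
        unfolding U_def space[symmetric] by (rule prob_compl)
      also have "\<dots> \<le> measure \<mu> B + e"
        using C(3) prob_compl[OF B] by simp
      finally have "emeasure \<mu> U \<le> emeasure \<mu> B + ennreal e"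
        using \<open>0 < e\<close> by (simp add: emeasure_eq_measure flip: ennreal_plus)
      then show "(INF U\<in>{U. openin T U \<and> B \<subseteq> U}. emeasure \<mu> U) \<le> emeasure \<mu> B + ennreal e"
        using U by (intro INF_lower2[of U]) auto
    qed
  qed (auto intro!: INF_greatest emeasure_mono simp: sets openin_borel_of)
qed (use assms in auto)

lemma regular_borel_prob_inner:
  assumes reg: "regular_borel_prob T \<mu>" and B: "B \<in> sets \<mu>" and "0 < e"
  obtains C where "closedin T C" "compactin T C" "C \<subseteq> B" "measure \<mu> B \<le> measure \<mu> C + e"
proof -
  interpret prob_space \<mu> by (rule regular_borel_probD(1)[OF reg])
  have sup: "emeasure \<mu> B = (SUP C\<in>{C. closedin T C \<and> compactin T C \<and> C \<subseteq> B}. emeasure \<mu> C)"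
    using reg B by (simp add: regular_borel_prob_def)
  show thesis
  proof (cases "measure \<mu> B \<le> e")
    case True
    then show ?thesis using that[of "{}"] by auto
  next
    case False
    then have "ennreal (measure \<mu> B - e) < emeasure \<mu> B"
      using \<open>0 < e\<close> by (simp add: emeasure_eq_measure ennreal_less_iff)
    then obtain C where "closedin T C" "compactin T C" "C \<subseteq> B" "ennreal (measure \<mu> B - e) < emeasure \<mu> C"
      unfolding sup less_SUP_iff by auto
    then show ?thesis
      using False by (intro that[of C]) (auto simp: emeasure_eq_measure ennreal_less_iff)
  qed
qed

text \<open>Inner regularity is inherited because images of compact sets are compact, and closed in a Hausdorff
  space.\<close>

lemma regular_borel_prob_distr:
  assumes reg: "regular_borel_prob T \<mu>" and f: "continuous_map T T' f" and T': "Hausdorff_space T'"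
  shows "regular_borel_prob T' (distr \<mu> (borel_of T') f)"
proof (rule regular_borel_probI)
  interpret prob_space \<mu> by (rule regular_borel_probD(1)[OF reg])
  note sets = regular_borel_probD(2)[OF reg] and space = regular_borel_probD(3)[OF reg]
  have meas: "f \<in> measurable \<mu> (borel_of T')"
    using continuous_map_measurable[OF f] by (simp add: measurable_cong_sets[OF sets refl])
  show "prob_space (distr \<mu> (borel_of T') f)" by (rule prob_space_distr[OF meas])
  fix B e assume "B \<in> sets (distr \<mu> (borel_of T') f)" and e: "0 < (e::real)"
  then have B: "B \<in> sets (borel_of T')" by simp
  obtain C where C: "closedin T C" "compactin T C" "C \<subseteq> f -` B \<inter> space \<mu>"
      "measure \<mu> (f -` B \<inter> space \<mu>) \<le> measure \<mu> C + e"
    using regular_borel_prob_inner[OF reg measurable_sets[OF meas B] e] .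
  have comp: "compactin T' (f ` C)" using image_compactin[OF C(2) f] .
  then have cl: "closedin T' (f ` C)" using T' compactin_imp_closedin by blast
  have "measure \<mu> C \<le> measure \<mu> (f -` (f ` C) \<inter> space \<mu>)"
    using C(3) by (intro finite_measure_mono measurable_sets[OF meas] closedin_borel_of cl) auto
  then show "\<exists>C. closedin T' C \<and> compactin T' C \<and> C \<subseteq> B \<and>
      measure (distr \<mu> (borel_of T') f) B \<le> measure (distr \<mu> (borel_of T') f) C + e"
    using C(3,4) comp cl B meas
    by (intro exI[of _ "f ` C"]) (auto simp: measure_distr closedin_borel_of)
qed simp

text \<open>A compact set inside an open set can be separated from the complement by a clopen set, so the
  values on clopen sets squeeze those on all Borel sets.\<close>

lemma regular_borel_prob_eqI:
  assumes \<mu>: "regular_borel_prob T \<mu>" and \<nu>: "regular_borel_prob T \<nu>"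
    and base: "\<And>U x. openin T U \<Longrightarrow> x \<in> U \<Longrightarrow> \<exists>V. openin T V \<and> closedin T V \<and> x \<in> V \<and> V \<subseteq> U"
    and agree: "\<And>V. openin T V \<Longrightarrow> closedin T V \<Longrightarrow> emeasure \<mu> V = emeasure \<nu> V"
  shows "\<mu> = \<nu>"
proof -
  have sep: "\<exists>V. openin T V \<and> closedin T V \<and> C \<subseteq> V \<and> V \<subseteq> U"
    if C: "compactin T C" and U: "openin T U" and CU: "C \<subseteq> U" for C U
  proof -
    define \<V> where "\<V> = {V. openin T V \<and> closedin T V \<and> V \<subseteq> U}"
    have "C \<subseteq> \<Union>\<V>"
    proof
      fix x assume "x \<in> C"
      with CU have "x \<in> U" by (rule subsetD)
      from base[OF U this] obtain V where "V \<in> \<V>" "x \<in> V"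
        unfolding \<V>_def by blast
      then show "x \<in> \<Union>\<V>" by (rule UnionI)
    qed
    then have "\<exists>\<F>. finite \<F> \<and> \<F> \<subseteq> \<V> \<and> C \<subseteq> \<Union>\<F>"
      by (intro compactinD[OF C]) (simp_all add: \<V>_def)
    then obtain \<F> where "finite \<F>" "\<F> \<subseteq> \<V>" "C \<subseteq> \<Union>\<F>" by blast
    have sub: "openin T V \<and> closedin T V \<and> V \<subseteq> U" if "V \<in> \<F>" for V
      using subsetD[OF \<open>\<F> \<subseteq> \<V>\<close> that] by (simp add: \<V>_def)
    have "openin T (\<Union>\<F>)" "closedin T (\<Union>\<F>)"
      using sub \<open>finite \<F>\<close> by (simp_all add: openin_Union closedin_Union)
    moreover have "\<Union>\<F> \<subseteq> U" using sub by (simp add: Union_least)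
    ultimately show ?thesis using \<open>C \<subseteq> \<Union>\<F>\<close> by blast
  qed
  have le: "emeasure M B \<le> emeasure N B"
    if M: "regular_borel_prob T M" and N: "regular_borel_prob T N" and B: "B \<in> sets (borel_of T)"
      and agree: "\<And>V. openin T V \<Longrightarrow> closedin T V \<Longrightarrow> emeasure M V = emeasure N V" for M N B
  proof -
    note sets = regular_borel_probD(2)[OF M] regular_borel_probD(2)[OF N]
    have "emeasure M C \<le> emeasure N U"
      if C: "compactin T C" "C \<subseteq> B" and U: "openin T U" "B \<subseteq> U" for C U
    proof -
      have "C \<subseteq> U" using C(2) U(2) by (rule subset_trans)
      then obtain V where V: "openin T V" "closedin T V" "C \<subseteq> V" "V \<subseteq> U"
        using sep[OF C(1) U(1)] by blast
      have "emeasure M C \<le> emeasure M V" using V by (intro emeasure_mono) (simp_all add: sets openin_borel_of)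
      also have "\<dots> = emeasure N V" using V by (simp add: agree)
      also have "\<dots> \<le> emeasure N U" using V U(1) by (intro emeasure_mono) (simp_all add: sets openin_borel_of)
      finally show ?thesis .
    qed
    moreover have "emeasure M B = (SUP C\<in>{C. closedin T C \<and> compactin T C \<and> C \<subseteq> B}. emeasure M C)"
      using M B sets(1) unfolding regular_borel_prob_def by metis
    moreover have "emeasure N B = (INF U\<in>{U. openin T U \<and> B \<subseteq> U}. emeasure N U)"
      using N B sets(2) unfolding regular_borel_prob_def by metis
    ultimately show ?thesis by (simp add: SUP_le_iff le_INF_iff)
  qed
  show ?thesis
  proof (rule measure_eqI)
    show "sets \<mu> = sets \<nu>" using regular_borel_probD(2) \<mu> \<nu> by metis
    fix B assume "B \<in> sets \<mu>"
    then have "B \<in> sets (borel_of T)" using regular_borel_probD(2)[OF \<mu>] by simp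
    then show "emeasure \<mu> B = emeasure \<nu> B"
      using le[OF \<mu> \<nu> _ agree] le[OF \<nu> \<mu> _ agree[symmetric]] by (simp add: antisym)
  qed
qed

lemma Hausdorff_space_euclidean_t2: "Hausdorff_space (euclidean :: 'a::t2_space topology)"
  using hausdorff by (simp add: Hausdorff_space_def disjnt_def) blast

section \<open>Uniqueness of invariant measures\<close>

text \<open>Fubini: averaging the left-invariant \<open>N\<close> over \<open>M\<close> gives \<open>N\<close>, averaging the right-invariant
  \<open>M\<close> over \<open>N\<close> gives \<open>M\<close>, and both are the value of the same double integral.\<close>

lemma invariant_measures_coincide:
  assumes "prob_space M" "prob_space N" and sets: "sets N = sets M"
    and mult: "(\<lambda>(x, y). m x y) \<in> measurable (M \<Otimes>\<^sub>M M) M"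
    and left: "\<And>x. x \<in> space M \<Longrightarrow> distr N N (m x) = N"
    and right: "\<And>y. y \<in> space M \<Longrightarrow> distr M M (\<lambda>x. m x y) = M"
  shows "N = M"
proof (rule measure_eqI[OF sets])
  interpret M: prob_space M by fact
  interpret N: prob_space N by fact
  interpret pair_sigma_finite M N ..
  note space = sets_eq_imp_space_eq[OF sets]
  fix B assume "B \<in> sets N"
  then have [measurable]: "B \<in> sets M" by (simp add: sets)
  note [measurable_cong] = sets and [measurable] = mult
  have ind: "(\<lambda>(x, y). indicator B (m x y) :: ennreal) \<in> borel_measurable (M \<Otimes>\<^sub>M N)"
  proof -
    have "(\<lambda>z. indicator B ((\<lambda>(x, y). m x y) z) :: ennreal) \<in> borel_measurable (M \<Otimes>\<^sub>M N)"
      by measurable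
    then show ?thesis by (simp add: case_prod_unfold)
  qed
  have mx: "m x \<in> measurable M M" if "x \<in> space M" for x
    using measurable_Pair2[OF mult that] by simp
  have my: "(\<lambda>x. m x y) \<in> measurable M M" if "y \<in> space M" for y
    using measurable_Pair1[OF mult that] by simp
  have "emeasure N B = (\<integral>\<^sup>+ x. emeasure N B \<partial>M)" by (simp add: M.emeasure_space_1)
  also have "\<dots> = (\<integral>\<^sup>+ x. (\<integral>\<^sup>+ y. indicator B (m x y) \<partial>N) \<partial>M)"
  proof (rule nn_integral_cong)
    fix x assume x: "x \<in> space M"
    have mN: "m x \<in> measurable N N" using mx[OF x] by (subst measurable_cong_sets[OF sets sets])
    have "emeasure N B = (\<integral>\<^sup>+ y. indicator B y \<partial>distr N N (m x))"
      using left[OF x] by (simp add: sets)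
    also have "\<dots> = (\<integral>\<^sup>+ y. indicator B (m x y) \<partial>N)"
      by (rule nn_integral_distr[OF mN]) (simp add: sets)
    finally show "emeasure N B = (\<integral>\<^sup>+ y. indicator B (m x y) \<partial>N)" .
  qed
  also have "\<dots> = (\<integral>\<^sup>+ y. (\<integral>\<^sup>+ x. indicator B (m x y) \<partial>M) \<partial>N)"
    using Fubini[OF ind] by simp
  also have "\<dots> = (\<integral>\<^sup>+ y. emeasure M B \<partial>N)"
  proof (rule nn_integral_cong)
    fix y assume "y \<in> space N"
    then have y: "y \<in> space M" by (simp add: space)
    have "emeasure M B = (\<integral>\<^sup>+ x. indicator B x \<partial>distr M M (\<lambda>x. m x y))"
      using right[OF y] by simp
    also have "\<dots> = (\<integral>\<^sup>+ x. indicator B (m x y) \<partial>M)"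
      by (rule nn_integral_distr[OF my[OF y]]) simp
    finally show "(\<integral>\<^sup>+ x. indicator B (m x y) \<partial>M) = emeasure M B" by simp
  qed
  also have "\<dots> = emeasure M B" by (simp add: N.emeasure_space_1)
  finally show "emeasure N B = emeasure M B" .
qed

lemma translation_invariant_eq_arc_length:
  assumes "prob_space N" "sets N = sets borel" and left: "\<And>b. distr N N ((+) b) = N"
  shows "N = arc_length"
proof (rule invariant_measures_coincide)
  have "(\<lambda>z::circle \<times> circle. fst z + snd z) \<in> borel_measurable (borel \<Otimes>\<^sub>M borel)"
    by measurable
  then show "(\<lambda>(x, y). x + y) \<in> arc_length \<Otimes>\<^sub>M arc_length \<rightarrow>\<^sub>M arc_length"
    by (simp add: case_prod_unfold cong: measurable_cong_sets)
  show "distr arc_length arc_length (\<lambda>x. x + y) = arc_length" for y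
  proof -
    have "(\<lambda>x. x + y) = (+) y" by (auto simp: add.commute)
    then show ?thesis
      using distr_arc_length_translate[of y] distr_cong[OF refl sets_arc_length refl, of arc_length]
      by simp
  qed
qed (use assms in \<open>auto intro: arc_length.prob_space_axioms\<close>)

lemma distr_arc_length_uminus: "distr arc_length borel uminus = arc_length"
proof (rule translation_invariant_eq_arc_length)
  fix b
  have "distr (distr arc_length borel uminus) borel ((+) b) = distr arc_length borel ((+) b \<circ> uminus)"
    by (intro distr_distr) measurable
  also have "(+) b \<circ> uminus = uminus \<circ> (+) (- b)" by auto
  also have "distr arc_length borel \<dots> = distr (distr arc_length borel ((+) (- b))) borel uminus"
    by (intro distr_distr[symmetric]) measurable
  finally show "distr (distr arc_length borel uminus) (distr arc_length borel uminus) ((+) b)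
      = distr arc_length borel uminus"
    by (simp add: distr_arc_length_translate distr_cong[OF refl sets_distr refl])
qed (auto intro: arc_length.prob_space_distr)

lemma regular_arc_length: "regular_borel_prob euclidean arc_length"
proof -
  have "regular_borel_prob euclidean unit_lebesgue"
    unfolding regular_borel_prob_def borel_of_euclidean
  proof (intro conjI ballI)
    fix B assume "B \<in> sets unit_lebesgue"
    then have B: "B \<in> sets borel" by simp
    have fin: "emeasure unit_lebesgue (space unit_lebesgue) \<noteq> \<infinity>"
      by (simp add: unit_lebesgue.emeasure_space_1 del: space_unit_lebesgue)
    have "{C. closedin euclidean C \<and> compactin euclidean C \<and> C \<subseteq> B} = {K. K \<subseteq> B \<and> compact K}"
      by (auto intro: compact_imp_closed)
    then show "emeasure unit_lebesgue B =
        (SUP C\<in>{C. closedin euclidean C \<and> compactin euclidean C \<and> C \<subseteq> B}. emeasure unit_lebesgue C)"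
      using inner_regular[OF sets_unit_lebesgue fin B] by simp
    show "emeasure unit_lebesgue B = (INF U\<in>{U. openin euclidean U \<and> B \<subseteq> U}. emeasure unit_lebesgue U)"
      using outer_regular[OF sets_unit_lebesgue fin B] by (simp add: conj_commute)
  qed (auto intro: unit_lebesgue.prob_space_axioms)
  from regular_borel_prob_distr[OF this, of euclidean abs_circle] show ?thesis
    using continuous_on_abs_circle by (simp add: borel_of_euclidean arc_length_def Hausdorff_space_euclidean_t2)
qed

theorem circle_haar_eq: "circle_haar = arc_length"
  unfolding circle_haar_def haar_measure_def
proof (rule the_equality)
  show "regular_borel_prob euclidean arc_length \<and> invariant_measure ((+) ` topspace euclidean) arc_length"
    using regular_arc_length distr_arc_length_translate
    by (auto simp: invariant_measure_def distr_cong[OF refl sets_arc_length refl])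
  fix \<mu> assume "regular_borel_prob euclidean \<mu> \<and> invariant_measure ((+) ` topspace euclidean) (\<mu> :: circle measure)"
  then show "\<mu> = arc_length"
    by (intro translation_invariant_eq_arc_length)
      (auto simp: regular_borel_prob_def invariant_measure_def borel_of_euclidean)
qed

text \<open>\<open>b \<mapsto> N (U - b)\<close> is lower semicontinuous for open \<open>U\<close>, by Fatou's lemma; being constant on a
  dense set, it is therefore largest there, and then constant by symmetry.\<close>

lemma dense_invariant_eq_arc_length:
  assumes "prob_space N" and sets: "sets N = sets borel"
    and dense: "\<And>r e. 0 < e \<Longrightarrow> \<exists>s. \<bar>s - r\<bar> < e \<and> abs_circle s \<in> D"
    and inv: "\<And>d. d \<in> D \<Longrightarrow> distr N N ((+) d) = N"
  shows "N = arc_length"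
proof (rule translation_invariant_eq_arc_length)
  interpret prob_space N by fact
  have space: "space N = UNIV" using sets_eq_imp_space_eq[OF sets] by simp
  have meas: "(+) b \<in> measurable N N" for b :: circle
    by (subst measurable_cong_sets[OF sets sets]) simp
  have le: "emeasure N ((+) b -` U) \<le> emeasure N U" if U: "open U" for b U
  proof -
    obtain r where b: "b = abs_circle r" by (rule abs_circle_cases)
    have "\<forall>n. \<exists>s. \<bar>s - r\<bar> < 1 / real (Suc n) \<and> abs_circle s \<in> D"
      using dense by simp
    then obtain s where s: "\<And>n. \<bar>s n - r\<bar> < 1 / real (Suc n)" "\<And>n. abs_circle (s n) \<in> D"
      by metis
    have "s \<longlonglongrightarrow> r"
    proof (rule LIM_zero_cancel, rule Lim_null_comparison)
      show "\<forall>\<^sub>F n in sequentially. norm (s n - r) \<le> inverse (real (Suc n))"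
        using s(1) by (intro always_eventually allI) (simp add: inverse_eq_divide less_imp_le)
    qed (rule LIMSEQ_inverse_real_of_nat)
    have lim: "(\<lambda>n. abs_circle (s n) + x) \<longlonglongrightarrow> b + x" for x
      using continuous_on_abs_circle \<open>s \<longlonglongrightarrow> r\<close> unfolding b
      by (intro tendsto_intros isCont_tendsto_compose[of _ abs_circle]) (auto simp: continuous_on_eq_continuous_within)
    have "emeasure N ((+) b -` U) = (\<integral>\<^sup>+ x. indicator ((+) b -` U) x \<partial>N)"
      using measurable_sets[OF meas, of U b] U by (simp add: sets space)
    also have "\<dots> \<le> (\<integral>\<^sup>+ x. liminf (\<lambda>n. indicator U (abs_circle (s n) + x)) \<partial>N)"
    proof (rule nn_integral_mono)
      fix x
      show "indicator ((+) b -` U) x \<le> liminf (\<lambda>n. indicator U (abs_circle (s n) + x) :: ennreal)"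
      proof (cases "b + x \<in> U")
        case True
        then have "\<forall>\<^sub>F n in sequentially. abs_circle (s n) + x \<in> U"
          by (rule topological_tendstoD[OF lim U])
        then have "\<forall>\<^sub>F n in sequentially. 1 \<le> (indicator U (abs_circle (s n) + x) :: ennreal)"
          by eventually_elim simp
        then have "1 \<le> liminf (\<lambda>n. indicator U (abs_circle (s n) + x) :: ennreal)"
          by (rule Liminf_bounded)
        then show ?thesis using True by simp
      qed simp
    qed
    also have "\<dots> \<le> liminf (\<lambda>n. \<integral>\<^sup>+ x. indicator U (abs_circle (s n) + x) \<partial>N)"
    proof (rule nn_integral_liminf)
      fix n
      have "(\<lambda>x. indicator U (abs_circle (s n) + x) :: ennreal) \<in> borel_measurable borel"
        using U by (intro measurable_compose[OF _ borel_measurable_indicator[of U borel]]) auto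
      then show "(\<lambda>x. indicator U (abs_circle (s n) + x) :: ennreal) \<in> borel_measurable N"
        by (subst measurable_cong_sets[OF sets refl])
    qed
    also have "(\<lambda>n. \<integral>\<^sup>+ x. indicator U (abs_circle (s n) + x) \<partial>N) = (\<lambda>n. emeasure N U)"
    proof
      fix n
      have "(\<integral>\<^sup>+ x. indicator U (abs_circle (s n) + x) \<partial>N) = (\<integral>\<^sup>+ x. indicator U x \<partial>distr N N ((+) (abs_circle (s n))))"
        using U by (intro nn_integral_distr[symmetric] meas borel_measurable_indicator) (simp add: sets)
      also have "\<dots> = emeasure N U" using inv[OF s(2)[of n]] U by (simp add: sets)
      finally show "(\<integral>\<^sup>+ x. indicator U (abs_circle (s n) + x) \<partial>N) = emeasure N U" .
    qed
    finally show ?thesis by (simp add: Liminf_const)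
  qed
  have eq: "emeasure N ((+) b -` U) = emeasure N U" if U: "open U" for b U
  proof (rule antisym[OF le[OF U]])
    have "open ((+) b -` U)" using U by (intro open_vimage continuous_intros)
    from le[OF this, of "- b"] show "emeasure N U \<le> emeasure N ((+) b -` U)"
      by (simp add: vimage_def)
  qed
  show "distr N N ((+) b) = N" for b
  proof (rule measure_eqI_generator_eq[where E = "{U. open U}" and \<Omega> = UNIV and A = "\<lambda>_. UNIV"])
    fix U :: "circle set" assume "U \<in> {U. open U}"
    then show "emeasure (distr N N ((+) b)) U = emeasure N U"
      using eq[of U b] by (simp add: emeasure_distr[OF meas] sets space)
  next
    show "emeasure (distr N N ((+) b)) UNIV \<noteq> \<infinity>" for i :: nat
      using prob_space.emeasure_space_1[OF prob_space_distr[OF meas, of b]] by (simp add: space)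
  qed (auto intro!: Int_stableI simp: sets sets_measure_of borel_def)
qed fact+

section \<open>The topology of the split circle\<close>

text \<open>The filter of punctured right or left neighbourhoods.\<close>

definition side :: "sign \<Rightarrow> circle \<Rightarrow> circle filter" where
  "side \<delta> a = filtermap (\<lambda>u. a + abs_circle u) (case \<delta> of Plus \<Rightarrow> at_right 0 | Minus \<Rightarrow> at_left 0)"

lemma eventually_side_Plus:
  "eventually P (side Plus a) \<longleftrightarrow> (\<exists>h>0. \<forall>u. 0 < u \<and> u < h \<longrightarrow> P (a + abs_circle u))"
  by (auto simp: side_def eventually_filtermap eventually_at_right_field)

lemma eventually_side_Minus:
  "eventually P (side Minus a) \<longleftrightarrow> (\<exists>h>0. \<forall>u. 0 < u \<and> u < h \<longrightarrow> P (a - abs_circle u))"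
proof -
  have "eventually P (side Minus a) \<longleftrightarrow> (\<exists>b<0. \<forall>y>b. y < 0 \<longrightarrow> P (a + abs_circle y))"
    by (auto simp: side_def eventually_filtermap eventually_at_left_field)
  also have "\<dots> \<longleftrightarrow> (\<exists>h>0. \<forall>u. 0 < u \<and> u < h \<longrightarrow> P (a - abs_circle u))"
  proof
    assume "\<exists>b<0. \<forall>y>b. y < 0 \<longrightarrow> P (a + abs_circle y)"
    then obtain b where b: "b < 0" "\<And>y. b < y \<Longrightarrow> y < 0 \<Longrightarrow> P (a + abs_circle y)" by auto
    have "P (a - abs_circle u)" if "0 < u" "u < - b" for u
      using b(2)[of "- u"] that by (simp add: abs_circle_uminus)
    then show "\<exists>h>0. \<forall>u. 0 < u \<and> u < h \<longrightarrow> P (a - abs_circle u)"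
      using b(1) by (intro exI[of _ "- b"]) auto
  next
    assume "\<exists>h>0. \<forall>u. 0 < u \<and> u < h \<longrightarrow> P (a - abs_circle u)"
    then obtain h where h: "h > 0" "\<And>u. 0 < u \<Longrightarrow> u < h \<Longrightarrow> P (a - abs_circle u)" by auto
    have "P (a + abs_circle y)" if "- h < y" "y < 0" for y
      using h(2)[of "- y"] that by (simp add: abs_circle_uminus)
    then show "\<exists>b<0. \<forall>y>b. y < 0 \<longrightarrow> P (a + abs_circle y)"
      using h(1) by (intro exI[of _ "- h"]) auto
  qed
  finally show ?thesis .
qed

lemma side_abs_circle:
  "side Plus (abs_circle r) = filtermap abs_circle (at_right r)"
  "side Minus (abs_circle r) = filtermap abs_circle (at_left r)"
  using at_right_to_0[of r] at_left_to_0[of r]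
  by (simp_all add: side_def filtermap_filtermap abs_circle_add add.commute)

lemma side_le_nhds: "side \<delta> a \<le> nhds a"
proof -
  have "((\<lambda>u. a + abs_circle u) \<longlongrightarrow> a + abs_circle 0) (nhds 0)"
    using continuous_on_abs_circle
    by (intro tendsto_intros) (auto simp: continuous_on_eq_continuous_at isCont_def tendsto_at_iff_tendsto_nhds)
  then have "filterlim (\<lambda>u. a + abs_circle u) (nhds a) (case \<delta> of Plus \<Rightarrow> at_right 0 | Minus \<Rightarrow> at_left 0)"
    by (auto simp: abs_circle_zero split: sign.split
        intro: filterlim_mono[OF _ order_refl] simp: at_within_def)
  then show ?thesis by (simp add: side_def filterlim_def)
qed

lemma filterlim_side_add: "filterlim (\<lambda>t. b + t) (side \<delta> (b + a)) (side \<delta> a)"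
  by (auto simp: filterlim_def side_def filtermap_filtermap add.assoc)

lemma filterlim_side_uminus: "filterlim uminus (side (opposite \<delta>) (- a)) (side \<delta> a)"
  unfolding filterlim_iff
  by (cases \<delta>) (auto simp: eventually_side_Plus eventually_side_Minus)

lemma representative_inj: "representative a = representative b \<longleftrightarrow> a = b"
  by (metis abs_circle_representative)

lemma representative_add:
  "0 \<le> representative a + u \<Longrightarrow> representative a + u < 1 \<Longrightarrow> representative (a + abs_circle u) = representative a + u"
  by (metis abs_circle_add abs_circle_representative representative_abs_circle)

lemma representative_add_wrap:
  assumes "1 \<le> representative a + u" "representative a + u < 2"
  shows "representative (a + abs_circle u) = representative a + u - 1"
proof -
  have "abs_circle (u - 1) = abs_circle u" by (simp add: abs_circle_eq_iff)
  then show ?thesis using representative_add[of a "u - 1"] assms by simp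
qed

text \<open>On its side \<open>\<delta>\<close> the point \<open>a\<^sup>\<delta>\<close> has no adjacent point, so a cyclic interval around it extends some
  way to that side. The left side of \<open>0\<close> is a case of its own, since there the cut is crossed.\<close>

lemma eventually_cyclic:
  assumes "cyclic x (Split a \<delta>) z"
  shows "eventually (\<lambda>t. cyclic x (Split t \<rho>) z) (side \<delta> a)"
proof -
  obtain s \<sigma> where x: "x = Split s \<sigma>" by (cases x)
  obtain s' \<sigma>' where z: "z = Split s' \<sigma>'" by (cases z)
  note b = representative_bounds[of a] representative_bounds[of s] representative_bounds[of s']
  let ?P = "\<lambda>t. cyclic x (Split t \<rho>) z"
  consider "\<delta> = Plus" | "\<delta> = Minus" "0 < representative a" | "\<delta> = Minus" "representative a = 0"
    using b(1) by (cases \<delta>) (auto simp: le_less)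
  then show ?thesis
  proof cases
    case 1
    define h where "h = (if representative a < representative s' then representative s' else 1) - representative a"
    have "h > 0" using b by (auto simp: h_def)
    moreover have "?P (a + abs_circle u)" if "0 < u" "u < h" for u
    proof -
      have "representative (a + abs_circle u) = representative a + u"
        using that b by (intro representative_add) (auto simp: h_def split: if_splits)
      then show ?thesis using assms that b 1 unfolding x z h_def
        by (auto simp: cyclic_def split: if_splits)
    qed
    ultimately show ?thesis unfolding 1 eventually_side_Plus by blast
  next
    case 2
    define h where "h = representative a - (if representative s < representative a then representative s else 0)"
    have "h > 0" using 2 by (auto simp: h_def)
    moreover have "?P (a - abs_circle u)" if "0 < u" "u < h" for u
    proof -
      have "representative (a + abs_circle (- u)) = representative a - u"
        using that b by (subst representative_add) (auto simp: h_def split: if_splits)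
      then have "representative (a - abs_circle u) = representative a - u"
        by (simp add: abs_circle_uminus)
      then show ?thesis using assms that b 2 unfolding x z h_def
        by (auto simp: cyclic_def split: if_splits)
    qed
    ultimately show ?thesis unfolding 2(1) eventually_side_Minus by blast
  next
    case 3
    define h where "h = 1 - representative s"
    have "h > 0" using b by (auto simp: h_def)
    moreover have "?P (a - abs_circle u)" if "0 < u" "u < h" for u
    proof -
      have "abs_circle (1 - u) = abs_circle (- u)" by (simp add: abs_circle_eq_iff)
      then have "representative (a + abs_circle (- u)) = 1 - u"
        using representative_add[of a "1 - u"] that b 3 by (auto simp: h_def)
      then have "representative (a - abs_circle u) = 1 - u"
        by (simp add: abs_circle_uminus)
      then show ?thesis using assms that b 3 unfolding x z h_def
        by (auto simp: cyclic_def)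
    qed
    ultimately show ?thesis unfolding 3(1) eventually_side_Minus by blast
  qed
qed

lemma tendsto_Split: "((\<lambda>t. Split t \<rho>) \<longlongrightarrow> Split a \<delta>) (side \<delta> a)"
proof (rule topological_tendstoI)
  fix U assume "open U" "Split a \<delta> \<in> U"
  from \<open>open U\<close> have "generate_topology {cyclic_interval x z | x z. x \<noteq> z} U"
    by (simp add: open_split_circle_def)
  then show "eventually (\<lambda>t. Split t \<rho> \<in> U) (side \<delta> a)" using \<open>Split a \<delta> \<in> U\<close>
  proof induction
    case (Int U V)
    then show ?case by (auto intro: eventually_conj)
  next
    case (UN K)
    then obtain U where "U \<in> K" "eventually (\<lambda>t. Split t \<rho> \<in> U) (side \<delta> a)" by blast
    then show ?case by (auto elim: eventually_mono)
  next
    case (Basis U)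
    then show ?case using eventually_cyclic by (auto simp: cyclic_interval_def)
  qed simp
qed

text \<open>The arc from \<open>a\<^sup>+\<close> to \<open>b\<^sup>-\<close>.\<close>

definition split_arc :: "circle \<Rightarrow> circle \<Rightarrow> split_circle set" where
  "split_arc a b = cyclic_interval (Split a Minus) (Split b Plus)"

lemma open_arc: "open (split_arc a b)"
  unfolding open_split_circle_def split_arc_def by (rule generate_topology.Basis) auto

lemma Compl_arc:
  assumes "a \<noteq> b" shows "- split_arc a b = split_arc b a"
proof -
  have "x \<in> split_arc a b \<longleftrightarrow> x \<notin> split_arc b a" for x
  proof (cases x)
    case (Split t \<sigma>)
    have "representative a \<noteq> representative b" using assms by (simp add: representative_inj)
    then show ?thesis
      unfolding Split split_arc_def cyclic_interval_def cyclic_def mem_Collect_eq cut_less.simps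
        representative_inj[symmetric]
      by (cases \<sigma>) auto
  qed
  then show ?thesis by blast
qed

lemma closed_arc: "a \<noteq> b \<Longrightarrow> closed (split_arc a b)"
  by (simp add: closed_def Compl_arc open_arc)

lemma arc_endpoints: "a \<noteq> b \<Longrightarrow> Split a Plus \<in> split_arc a b" "a \<noteq> b \<Longrightarrow> Split b Minus \<in> split_arc a b"
  by (auto simp: split_arc_def cyclic_interval_def cyclic_def simp flip: representative_inj)

lemma arc_cases:
  assumes "x \<in> split_arc a (a + abs_circle h)" and h: "0 < h" "h < 1"
  shows "x = Split a Plus \<or> x = Split (a + abs_circle h) Minus \<or>
    (\<exists>u \<sigma>. 0 < u \<and> u < h \<and> x = Split (a + abs_circle u) \<sigma>)"
proof -
  obtain t \<sigma> where x: "x = Split t \<sigma>" by (cases x)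
  define u where "u = representative (t - a)"
  have t: "t = a + abs_circle u" by (simp add: u_def)
  have u: "0 \<le> u" "u < 1" by (simp_all add: u_def representative_bounds)
  define A where "A = representative a"
  have A: "0 \<le> A" "A < 1" by (simp_all add: A_def representative_bounds)
  have rt: "representative t = (if A + u < 1 then A + u else A + u - 1)"
    unfolding t A_def using u A representative_add[of a u] representative_add_wrap[of a u]
    by (auto simp: A_def)
  have rb: "representative (a + abs_circle h) = (if A + h < 1 then A + h else A + h - 1)"
    unfolding A_def using h A representative_add[of a h] representative_add_wrap[of a h]
    by (auto simp: A_def)
  have "(u = 0 \<and> \<sigma> = Plus) \<or> (u = h \<and> \<sigma> = Minus) \<or> (0 < u \<and> u < h)"
    using assms(1) u A h
    unfolding x split_arc_def cyclic_interval_def cyclic_def mem_Collect_eq cut_less.simps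
        representative_inj[symmetric] rt rb A_def[symmetric]
    by (cases \<sigma>) (auto split: if_splits)
  then show ?thesis
    unfolding x t by (auto simp: abs_circle_zero)
qed

text \<open>The point \<open>a\<^sup>+\<close> is the left end of short arcs \<open>[a\<^sup>+, b\<^sup>-]\<close>, whose other points are near \<open>a\<close> on the right,
  apart from \<open>b\<^sup>-\<close>, which is too; \<open>a\<^sup>-\<close> is the right end of short arcs. So one-sided conditions suffice.\<close>

lemma arc_neighbourhood:
  assumes ev: "\<And>a \<delta> \<rho>. Split a \<delta> \<in> U \<Longrightarrow> eventually (\<lambda>t. Split t \<rho> \<in> U) (side \<delta> a)" and "x \<in> U"
  shows "\<exists>a b. a \<noteq> b \<and> x \<in> split_arc a b \<and> split_arc a b \<subseteq> U"
proof (cases x)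
  case (Split a \<delta>)
  have "eventually (\<lambda>t. Split t Plus \<in> U \<and> Split t Minus \<in> U) (side \<delta> a)"
    using ev \<open>x \<in> U\<close> Split by (auto intro: eventually_conj)
  then have ev': "eventually (\<lambda>t. \<forall>\<rho>. Split t \<rho> \<in> U) (side \<delta> a)"
    by (elim eventually_mono) (metis sign.exhaust)
  have neq: "a \<noteq> a + abs_circle h" if "0 < h" "h < 1" for a h
  proof
    assume "a = a + abs_circle h"
    then have "abs_circle h = abs_circle 0" by (simp add: abs_circle_zero)
    then show False using representative_abs_circle[of h] representative_abs_circle[of 0] that by simp
  qed
  show ?thesis
  proof (cases \<delta>)
    case Plus
    then have "eventually (\<lambda>t. \<forall>\<rho>. Split t \<rho> \<in> U) (side Plus a)" using ev' by simp
    then obtain h where h: "h > 0" "\<forall>u. 0 < u \<and> u < h \<longrightarrow> (\<forall>\<rho>. Split (a + abs_circle u) \<rho> \<in> U)"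
      unfolding eventually_side_Plus by blast
    define k where "k = min h 1 / 2"
    have k: "0 < k" "k < 1" "k < h" using h(1) by (auto simp: k_def)
    have "split_arc a (a + abs_circle k) \<subseteq> U"
    proof
      fix y assume "y \<in> split_arc a (a + abs_circle k)"
      from arc_cases[OF this k(1,2)] show "y \<in> U"
        using \<open>x \<in> U\<close> h(2) k by (auto simp: Split Plus)
    qed
    then show ?thesis using arc_endpoints(1)[OF neq[OF k(1,2)]] neq[OF k(1,2)] unfolding Split Plus by blast
  next
    case Minus
    then have "eventually (\<lambda>t. \<forall>\<rho>. Split t \<rho> \<in> U) (side Minus a)" using ev' by simp
    then obtain h where h: "h > 0" "\<forall>u. 0 < u \<and> u < h \<longrightarrow> (\<forall>\<rho>. Split (a - abs_circle u) \<rho> \<in> U)"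
      unfolding eventually_side_Minus by blast
    define k where "k = min h 1 / 2"
    have k: "0 < k" "k < 1" "k < h" using h(1) by (auto simp: k_def)
    define c where "c = a - abs_circle k"
    have a: "a = c + abs_circle k" by (simp add: c_def)
    have "split_arc c (c + abs_circle k) \<subseteq> U"
    proof
      fix y assume "y \<in> split_arc c (c + abs_circle k)"
      from arc_cases[OF this k(1,2)]
      consider "y = Split c Plus" | "y = Split (c + abs_circle k) Minus"
        | u \<sigma> where "0 < u" "u < k" "y = Split (c + abs_circle u) \<sigma>" by blast
      then show "y \<in> U"
      proof cases
        case 1
        then show ?thesis using h(2) k by (simp add: c_def)
      next
        case 2
        then show ?thesis using \<open>x \<in> U\<close> by (simp add: Split Minus a)
      next
        case (3 u \<sigma>)
        then show ?thesis using h(2)[rule_format, of "k - u" \<sigma>] k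
            by (simp add: c_def abs_circle_diff algebra_simps)
      qed
    qed
    then show ?thesis using arc_endpoints(2)[OF neq[OF k(1,2)]] neq[OF k(1,2)] unfolding Split Minus a by blast
  qed
  qed

text \<open>This replaces cyclic intervals by filters on the circle; continuity of \<open>pt\<close> and of the maps
  \<open>P_map\<close> and compactness are derived from it.\<close>

lemma open_split_circle_iff:
  "open U \<longleftrightarrow> (\<forall>a \<delta> \<rho>. Split a \<delta> \<in> U \<longrightarrow> eventually (\<lambda>t. Split t \<rho> \<in> U) (side \<delta> a))"
proof
  assume U: "open U"
  show "\<forall>a \<delta> \<rho>. Split a \<delta> \<in> U \<longrightarrow> eventually (\<lambda>t. Split t \<rho> \<in> U) (side \<delta> a)"
    by (intro allI impI topological_tendstoD[OF tendsto_Split U])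
next
  assume ev: "\<forall>a \<delta> \<rho>. Split a \<delta> \<in> U \<longrightarrow> eventually (\<lambda>t. Split t \<rho> \<in> U) (side \<delta> a)"
  show "open U"
  proof (subst open_subopen, rule ballI)
    fix x assume "x \<in> U"
    obtain a b where "x \<in> split_arc a b" "split_arc a b \<subseteq> U"
      using arc_neighbourhood[OF ev[rule_format] \<open>x \<in> U\<close>] by auto
    then show "\<exists>T. open T \<and> x \<in> T \<and> T \<subseteq> U" using open_arc by auto
  qed
qed

lemma clopen_base_split_circle:
  assumes "open U" "x \<in> U"
  shows "\<exists>V. open V \<and> closed V \<and> x \<in> V \<and> V \<subseteq> (U :: split_circle set)"
proof -
  obtain a b where "a \<noteq> b" "x \<in> split_arc a b" "split_arc a b \<subseteq> U"
    using arc_neighbourhood[of U x] assms open_split_circle_iff[of U] by auto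
  then show ?thesis
    by (intro exI[of _ "split_arc a b"]) (simp add: open_arc closed_arc)
qed

fun pt :: "split_circle \<Rightarrow> circle" where
  "pt (Split t \<sigma>) = t"

lemma continuous_on_pt: "continuous_on UNIV pt"
  unfolding continuous_on_open_vimage[OF open_UNIV]
proof (intro allI impI)
  fix O' :: "circle set" assume "open O'"
  then show "open (pt -` O' \<inter> UNIV)"
    unfolding open_split_circle_iff
    using filter_leD[OF side_le_nhds] by (auto intro: eventually_nhds_in_open)
qed

instance split_circle :: t2_space
proof
  fix x y :: split_circle assume "x \<noteq> y"
  show "\<exists>U V. open U \<and> open V \<and> x \<in> U \<and> y \<in> V \<and> U \<inter> V = {}"
  proof (cases "pt x = pt y")
    case False
    from hausdorff[OF False] obtain U V where "open U" "open V" "pt x \<in> U" "pt y \<in> V" "U \<inter> V = {}"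
      by auto
    then show ?thesis
      by (intro exI[of _ "pt -` U"] exI[of _ "pt -` V"] conjI open_vimage[OF _ continuous_on_pt]) auto
  next
    case True
    then obtain a \<sigma> \<tau> where xy: "x = Split a \<sigma>" "y = Split a \<tau>" "\<sigma> \<noteq> \<tau>"
      using \<open>x \<noteq> y\<close> by (cases x; cases y) auto
    define b where "b = a + abs_circle (1/2)"
    have "a \<noteq> b"
    proof
      assume "a = b"
      then have "abs_circle (1/2) = abs_circle 0" by (simp add: b_def abs_circle_zero)
      then show False using representative_abs_circle[of "1/2"] representative_abs_circle[of 0] by simp
    qed
    then have "split_arc a b \<inter> split_arc b a = {}" "Split a Plus \<in> split_arc a b" "Split a Minus \<in> split_arc b a"
      using Compl_arc[of a b] arc_endpoints[of a b] arc_endpoints[of b a] by auto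
    moreover define W where "W \<rho> = (if \<rho> = Plus then split_arc a b else split_arc b a)" for \<rho>
    ultimately have "open (W \<rho>)" "Split a \<rho> \<in> W \<rho>" for \<rho>
      using open_arc by (cases \<rho>; simp add: W_def)+
    moreover have "W \<sigma> \<inter> W \<tau> = {}"
      using \<open>split_arc a b \<inter> split_arc b a = {}\<close> xy(3)
      by (cases \<sigma>; cases \<tau>) (simp_all add: W_def Int_commute)
    ultimately show ?thesis unfolding xy(1,2) by (intro exI[of _ "W \<sigma>"] exI[of _ "W \<tau>"]) simp
  qed
qed

text \<open>The two members of a cover that contain \<open>r\<^sup>+\<close> and \<open>r\<^sup>-\<close> together contain both points over every \<open>s\<close> near \<open>r\<close>,
  so compactness reduces to that of the unit interval.\<close>

lemma compact_split_circle: "compact (UNIV :: split_circle set)"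
  unfolding compact_eq_Heine_Borel
proof (intro allI impI)
  fix \<C> :: "split_circle set set" assume "(\<forall>U\<in>\<C>. open U) \<and> UNIV \<subseteq> \<Union>\<C>"
  then have op: "\<And>U. U \<in> \<C> \<Longrightarrow> open U" and cov: "\<Union>\<C> = UNIV" by auto
  have "\<exists>I \<F>. open I \<and> r \<in> I \<and> finite \<F> \<and> \<F> \<subseteq> \<C> \<and> (\<forall>s\<in>I. \<forall>\<rho>. Split (abs_circle s) \<rho> \<in> \<Union>\<F>)" for r
  proof -
    have "\<exists>V. V \<in> \<C> \<and> Split (abs_circle r) \<delta> \<in> V" for \<delta>
      using UNIV_I[of "Split (abs_circle r) \<delta>"] by (auto simp flip: cov)
    then obtain U where U: "\<And>\<delta>. U \<delta> \<in> \<C>" "\<And>\<delta>. Split (abs_circle r) \<delta> \<in> U \<delta>"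
      by metis
    have ev: "eventually (\<lambda>t. Split t \<rho> \<in> U \<delta>) (side \<delta> (abs_circle r))" for \<delta> \<rho>
      using op[OF U(1)[of \<delta>]] U(2)[of \<delta>] by (simp add: open_split_circle_iff)
    define W where "W = U Plus \<union> U Minus"
    have "eventually (\<lambda>s. Split (abs_circle s) \<rho> \<in> W) (nhds r)" for \<rho>
    proof -
      have "eventually (\<lambda>s. Split (abs_circle s) \<rho> \<in> W) (at_right r)"
        using ev[of \<rho> Plus] by (auto simp: W_def side_abs_circle eventually_filtermap elim: eventually_mono)
      moreover have "eventually (\<lambda>s. Split (abs_circle s) \<rho> \<in> W) (at_left r)"
        using ev[of \<rho> Minus] by (auto simp: W_def side_abs_circle eventually_filtermap elim: eventually_mono)
      ultimately have "eventually (\<lambda>s. Split (abs_circle s) \<rho> \<in> W) (at r)"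
        by (simp add: eventually_at_split)
      moreover have "Split (abs_circle r) \<rho> \<in> W" using U(2)[of \<rho>] by (cases \<rho>) (auto simp: W_def)
      ultimately show ?thesis by (simp add: eventually_nhds_conv_at)
    qed
    from eventually_conj[OF this[of Plus] this[of Minus]]
    obtain I where I: "open I" "r \<in> I"
        "\<forall>s\<in>I. Split (abs_circle s) Plus \<in> W \<and> Split (abs_circle s) Minus \<in> W"
      unfolding eventually_nhds by auto
    have "Split (abs_circle s) \<rho> \<in> W" if "s \<in> I" for s \<rho>
      using I(3) that by (cases \<rho>) auto
    moreover have "\<Union>{U Plus, U Minus} = W" by (simp add: W_def)
    ultimately show ?thesis
      using U(1) I(1,2) by (intro exI[of _ I] exI[of _ "{U Plus, U Minus}"]) simp
  qed
  then obtain I \<F> where I: "\<And>r. open (I r)" "\<And>r. r \<in> I r" "\<And>r. finite (\<F> r)" "\<And>r. \<F> r \<subseteq> \<C>"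
      "\<And>r s \<rho>. s \<in> I r \<Longrightarrow> Split (abs_circle s) \<rho> \<in> \<Union>(\<F> r)"
    by metis
  have "{0..1} \<subseteq> (\<Union>r\<in>{0..1}. I r)" using I(2) by auto
  then obtain D where "D \<subseteq> {0..1}" and D: "finite D" "{0..1} \<subseteq> (\<Union>r\<in>D. I r)"
    by (rule compactE_image[OF compact_Icc I(1)])
  have "x \<in> \<Union>(\<Union>r\<in>D. \<F> r)" for x
  proof (cases x)
    case (Split t \<rho>)
    have "representative t \<in> {0..1}" using representative_bounds[of t] by simp
    then obtain r where "r \<in> D" "representative t \<in> I r" using D(2) by blast
    then show ?thesis using I(5)[of "representative t" r \<rho>] Split by auto
  qed
  moreover have "(\<Union>r\<in>D. \<F> r) \<subseteq> \<C>" using I(4) by (rule UN_least)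
  moreover have "finite (\<Union>r\<in>D. \<F> r)" using D(1) I(3) by (rule finite_UN_I)
  ultimately show "\<exists>\<D>\<subseteq>\<C>. finite \<D> \<and> UNIV \<subseteq> \<Union>\<D>"
    by (intro exI[of _ "\<Union>r\<in>D. \<F> r"]) auto
qed

section \<open>Two-sided parametrisations\<close>

text \<open>The gaps to the right of two different points are disjoint, so they contain different rationals.\<close>

lemma countable_right_isolated:
  fixes S :: "real set"
  assumes "\<And>r. r \<in> S \<Longrightarrow> \<exists>h>0. {r<..<r + h} \<inter> S = {}"
  shows "countable S"
proof -
  have "\<exists>q::rat. r < of_rat q \<and> {r<..of_rat q} \<inter> S = {}" if r: "r \<in> S" for r
  proof -
    obtain h where h: "h > 0" "{r<..<r + h} \<inter> S = {}" using assms[OF r] by auto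
    obtain q :: rat where "r < of_rat q" "of_rat q < r + h"
      using of_rat_dense[of r "r + h"] h(1) by auto
    moreover from this have "{r<..of_rat q} \<subseteq> {r<..<r + h}" by auto
    ultimately show ?thesis using h(2) by (intro exI[of _ q]) blast
  qed
  then obtain q :: "real \<Rightarrow> rat" where q: "\<And>r. r \<in> S \<Longrightarrow> r < of_rat (q r)"
      "\<And>r. r \<in> S \<Longrightarrow> {r<..of_rat (q r)} \<inter> S = {}"
    by metis
  have less: "q r < q r'" if "r \<in> S" "r' \<in> S" "r < r'" for r r'
  proof -
    have "r' \<notin> {r<..of_rat (q r)}" using q(2)[OF that(1)] that(2) by auto
    then have "(of_rat (q r) :: real) < of_rat (q r')" using q(1)[OF that(2)] that(3) by auto
    then show ?thesis by (simp add: of_rat_less)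
  qed
  have "inj_on q S"
  proof (rule inj_onI)
    fix r r' assume "r \<in> S" "r' \<in> S" "q r = q r'"
    then show "r = r'" using less[of r r'] less[of r' r] by (cases r r' rule: linorder_cases) auto
  qed
  then show ?thesis by (rule countableI')
qed

lemma countable_left_isolated:
  fixes S :: "real set"
  assumes "\<And>r. r \<in> S \<Longrightarrow> \<exists>h>0. {r - h<..<r} \<inter> S = {}"
  shows "countable S"
proof -
  have "countable (uminus ` S)"
  proof (rule countable_right_isolated)
    fix r assume "r \<in> uminus ` S"
    then obtain s where s: "s \<in> S" "r = - s" by auto
    obtain h where h: "h > 0" "{s - h<..<s} \<inter> S = {}" using assms[OF s(1)] by auto
    have "{r<..<r + h} \<inter> uminus ` S = {}"
    proof (rule ccontr)
      assume "{r<..<r + h} \<inter> uminus ` S \<noteq> {}"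
      then obtain x where "x \<in> {r<..<r + h}" "x \<in> uminus ` S" by blast
      then obtain t where "t \<in> S" "- t \<in> {r<..<r + h}" by blast
      then have "t \<in> {s - h<..<s} \<inter> S" using s(2) by auto
      with h(2) show False by simp
    qed
    with h(1) show "\<exists>h>0. {r<..<r + h} \<inter> uminus ` S = {}" by auto
  qed
  then show ?thesis by (rule countable_image_inj_on) (auto simp: inj_on_def)
qed

text \<open>The points \<open>Q Plus a\<close> and \<open>Q Minus a\<close> relate to their neighbours as \<open>a\<^sup>+\<close> and \<open>a\<^sup>-\<close> do in the split circle:
  \<open>Q \<delta> a\<close> is the limit from the side \<open>\<delta>\<close> of the points of either sign.\<close>

definition two_sided :: "'a topology \<Rightarrow> (sign \<Rightarrow> circle \<Rightarrow> 'a) \<Rightarrow> bool" where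
  "two_sided T Q \<longleftrightarrow> (\<forall>\<delta> \<rho> a. limitin T (Q \<rho>) (Q \<delta> a) (side \<delta> a))"

lemma two_sided_topspace: "two_sided T Q \<Longrightarrow> Q \<rho> a \<in> topspace T"
  by (auto simp: two_sided_def limitin_def)

lemma two_sided_eventually:
  "two_sided T Q \<Longrightarrow> openin T U \<Longrightarrow> Q \<delta> a \<in> U \<Longrightarrow> eventually (\<lambda>t. Q \<rho> t \<in> U) (side \<delta> a)"
  by (auto simp: two_sided_def limitin_def)

text \<open>Let \<open>W\<close> be the interior of the set of angles over which both points lie in \<open>U\<close>. If \<open>Q \<delta> a\<close> is in \<open>U\<close>, then an
  interval on the side \<open>\<delta>\<close> of \<open>a\<close> is contained in \<open>W\<close>; so the angles outside \<open>W\<close> at which this occurs are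
  isolated from that side, and there are only countably many.\<close>

lemma two_sided_open:
  assumes Q: "two_sided T Q" and U: "openin T U"
  shows "Q \<rho> -` U \<in> sets borel" "countable {a. (Q Plus a \<in> U) \<noteq> (Q Minus a \<in> U)}"
proof -
  define W where "W = interior {r. \<forall>\<rho>. Q \<rho> (abs_circle r) \<in> U}"
  have W: "Q \<rho> (abs_circle r) \<in> U" if "r \<in> W" for \<rho> r
    using subsetD[OF interior_subset that[unfolded W_def]] by simp
  have WI: "r \<in> W" if "open I" "r \<in> I" "\<And>s \<rho>. s \<in> I \<Longrightarrow> Q \<rho> (abs_circle s) \<in> U" for I r
    unfolding W_def using that by (intro interiorI[of I]) auto
  define S where "S \<delta> = {r. Q \<delta> (abs_circle r) \<in> U} - W" for \<delta>
  have both: "eventually (\<lambda>t. \<forall>\<rho>. Q \<rho> t \<in> U) (side \<delta> (abs_circle r))" if "r \<in> S \<delta>" for r \<delta>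
  proof -
    have "eventually (\<lambda>t. Q Plus t \<in> U \<and> Q Minus t \<in> U) (side \<delta> (abs_circle r))"
      using that by (intro eventually_conj two_sided_eventually[OF Q U]) (simp_all add: S_def)
    then show ?thesis by eventually_elim (metis sign.exhaust)
  qed
  have "countable (S Plus)"
  proof (rule countable_right_isolated)
    fix r assume "r \<in> S Plus"
    from both[OF this] obtain b where b: "b > r" "\<forall>s>r. s < b \<longrightarrow> (\<forall>\<rho>. Q \<rho> (abs_circle s) \<in> U)"
      unfolding side_abs_circle eventually_filtermap eventually_at_right_field by auto
    have "s \<in> W" if "s \<in> {r<..<b}" for s
      using that b(2) by (intro WI[of "{r<..<b}"]) auto
    then show "\<exists>h>0. {r<..<r + h} \<inter> S Plus = {}"
      using b(1) by (intro exI[of _ "b - r"]) (auto simp: S_def)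
  qed
  moreover have "countable (S Minus)"
  proof (rule countable_left_isolated)
    fix r assume "r \<in> S Minus"
    from both[OF this] obtain b where b: "b < r" "\<forall>s>b. s < r \<longrightarrow> (\<forall>\<rho>. Q \<rho> (abs_circle s) \<in> U)"
      unfolding side_abs_circle eventually_filtermap eventually_at_left_field by auto
    have "s \<in> W" if "s \<in> {b<..<r}" for s
      using that b(2) by (intro WI[of "{b<..<r}"]) auto
    then show "\<exists>h>0. {r - h<..<r} \<inter> S Minus = {}"
      using b(1) by (intro exI[of _ "r - b"]) (auto simp: S_def)
  qed
  ultimately have S: "countable (S \<delta>)" for \<delta> by (cases \<delta>) auto
  have eq: "abs_circle -` (Q \<rho> -` U) = W \<union> S \<rho>" using W by (auto simp: S_def)
  have "W \<union> S \<rho> \<in> sets borel"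
    using sets.countable[OF _ S[of \<rho>], of borel] by (simp add: W_def borel_open sets.Un)
  then show "Q \<rho> -` U \<in> sets borel" by (intro borel_circleI) (simp add: eq)
  have "{a. (Q Plus a \<in> U) \<noteq> (Q Minus a \<in> U)} \<subseteq> abs_circle ` (S Plus \<union> S Minus)"
  proof
    fix a assume a: "a \<in> {a. (Q Plus a \<in> U) \<noteq> (Q Minus a \<in> U)}"
    obtain r where r: "a = abs_circle r" by (rule abs_circle_cases)
    have "r \<notin> W"
    proof
      assume "r \<in> W"
      from W[OF this, of Plus] W[OF this, of Minus] show False using a by (simp add: r)
    qed
    then have "r \<in> S Plus \<union> S Minus" using a by (cases "Q Plus (abs_circle r) \<in> U") (simp_all add: S_def r)
    then show "a \<in> abs_circle ` (S Plus \<union> S Minus)" unfolding r by (rule imageI)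
  qed
  moreover have "countable (abs_circle ` (S Plus \<union> S Minus))" using S by simp
  ultimately show "countable {a. (Q Plus a \<in> U) \<noteq> (Q Minus a \<in> U)}" by (rule countable_subset)
qed

lemma two_sided_borel:
  assumes Q: "two_sided T Q" and B: "B \<in> sets (borel_of T)"
  shows "(\<forall>\<rho>. Q \<rho> -` B \<in> sets borel) \<and> countable {a. (Q Plus a \<in> B) \<noteq> (Q Minus a \<in> B)}"
  using B unfolding sets_borel_of
proof (induction rule: sigma_sets.induct)
  case (Basic U)
  then show ?case using two_sided_open[OF Q] by simp
next
  case Empty
  show ?case by simp
next
  case (Compl B)
  have "Q \<rho> -` (topspace T - B) = - (Q \<rho> -` B)" for \<rho>
    using two_sided_topspace[OF Q] by auto
  moreover have "{a. (Q Plus a \<in> topspace T - B) \<noteq> (Q Minus a \<in> topspace T - B)}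
      = {a. (Q Plus a \<in> B) \<noteq> (Q Minus a \<in> B)}"
    using two_sided_topspace[OF Q] by auto
  ultimately show ?case using Compl.IH by (auto simp: borel_comp)
next
  case (Union B)
  define D where "D n = {a. (Q Plus a \<in> B n) \<noteq> (Q Minus a \<in> B n)}" for n
  have "{a. (Q Plus a \<in> \<Union>(range B)) \<noteq> (Q Minus a \<in> \<Union>(range B))} \<subseteq> \<Union>(range D)"
  proof
    fix a assume a: "a \<in> {a. (Q Plus a \<in> \<Union>(range B)) \<noteq> (Q Minus a \<in> \<Union>(range B))}"
    show "a \<in> \<Union>(range D)"
    proof (rule ccontr)
      assume "a \<notin> \<Union>(range D)"
      then have "(Q Plus a \<in> B n) = (Q Minus a \<in> B n)" for n by (simp add: D_def)
      then show False using a by simp blast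
    qed
  qed
  moreover have "countable (\<Union>(range D))"
    using Union.IH by (intro countable_UN) (simp_all add: D_def)
  ultimately have "countable {a. (Q Plus a \<in> \<Union>(range B)) \<noteq> (Q Minus a \<in> \<Union>(range B))}"
    by (rule countable_subset)
  moreover have "Q \<rho> -` \<Union>(range B) \<in> sets borel" for \<rho>
  proof -
    have "Q \<rho> -` \<Union>(range B) = (\<Union>n. Q \<rho> -` B n)" by auto
    also have "\<dots> \<in> sets borel" using Union.IH by (intro sets.countable_UN) auto
    finally show ?thesis .
  qed
  ultimately show ?case by simp
qed

lemma two_sided_measurable:
  assumes "two_sided T Q" shows "Q \<rho> \<in> measurable borel (borel_of T)"
  using two_sided_borel[OF assms] two_sided_topspace[OF assms]
  by (intro measurableI) auto

lemma two_sided_emeasure: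
  assumes Q: "two_sided T Q" and B: "B \<in> sets (borel_of T)"
  shows "emeasure arc_length (Q \<rho> -` B) = emeasure arc_length (Q \<sigma> -` B)"
proof -
  define D where "D = {a. (Q Plus a \<in> B) \<noteq> (Q Minus a \<in> B)}"
  have "countable D" and m: "\<And>\<rho>. Q \<rho> -` B \<in> sets borel"
    using two_sided_borel[OF Q B] by (simp_all add: D_def)
  then have D: "D \<in> null_sets arc_length"
    by (intro null_setsI emeasure_arc_length_countable) (simp_all add: sets.countable)
  have eq: "Q \<rho> -` B - D = Q \<sigma> -` B - D"
    by (cases \<rho>; cases \<sigma>) (auto simp: D_def)
  have "emeasure arc_length (Q \<rho> -` B) = emeasure arc_length (Q \<rho> -` B - D)"
    using D m by (simp add: emeasure_Diff_null_set)
  also have "\<dots> = emeasure arc_length (Q \<sigma> -` B)"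
    using D m unfolding eq by (simp add: emeasure_Diff_null_set)
  finally show ?thesis .
qed

section \<open>The maps of the split circle\<close>

lemma tendsto_fun_iff:
  "(f \<longlongrightarrow> l) F \<longleftrightarrow> (\<forall>x. ((\<lambda>i. f i x) \<longlongrightarrow> l x) F)"
  using limitin_componentwise[of "\<lambda>_. euclidean" UNIV f l F]
  by (simp add: euclidean_product_topology)

lemma sign_power_simps [simp]: "sign_power \<rho> 1 = \<rho>" "sign_power \<rho> (-1) = opposite \<rho>"
  by (simp_all add: sign_power_def)

lemma opposite_opposite [simp]: "opposite (opposite \<rho>) = \<rho>"
  by (cases \<rho>) auto

lemma int_mult_zero [simp]: "int_mult \<epsilon> 0 = 0"
  by transfer simp

lemma P_map_comp:
  assumes "\<epsilon> \<in> {1, -1}" "\<epsilon>' \<in> {1, -1}"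
  shows "P_map \<epsilon> a \<circ> P_map \<epsilon>' b = P_map (\<epsilon> * \<epsilon>') (int_mult \<epsilon> b + a)"
proof
  fix x show "(P_map \<epsilon> a \<circ> P_map \<epsilon>' b) x = P_map (\<epsilon> * \<epsilon>') (int_mult \<epsilon> b + a) x"
    using assms by (cases x) auto
qed

lemma P_map_P_side:
  assumes "\<epsilon> \<in> {1, -1}" "\<epsilon>' \<in> {1, -1}"
  shows "P_map \<epsilon> a \<circ> P_side \<delta> \<epsilon>' b = P_side (sign_power \<delta> \<epsilon>) (\<epsilon> * \<epsilon>') (int_mult \<epsilon> b + a)"
proof
  fix x show "(P_map \<epsilon> a \<circ> P_side \<delta> \<epsilon>' b) x = P_side (sign_power \<delta> \<epsilon>) (\<epsilon> * \<epsilon>') (int_mult \<epsilon> b + a) x"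
    using assms by (cases x) auto
qed

lemma P_side_comp:
  assumes "\<epsilon> \<in> {1, -1}" "\<epsilon>' \<in> {1, -1}"
  shows "P_side \<delta> \<epsilon> a \<circ> P_side \<delta>' \<epsilon>' b = P_side \<delta> (\<epsilon> * \<epsilon>') (int_mult \<epsilon> b + a)"
proof
  fix x show "(P_side \<delta> \<epsilon> a \<circ> P_side \<delta>' \<epsilon>' b) x = P_side \<delta> (\<epsilon> * \<epsilon>') (int_mult \<epsilon> b + a) x"
    using assms by (cases x) auto
qed

lemma P_map_id: "P_map 1 0 = id"
proof
  fix x show "P_map 1 0 x = id x" by (cases x) auto
qed

text \<open>Not a fixed point of the reflection, hence a test point for the orientation of an isometry.\<close>

definition quarter :: circle where "quarter = abs_circle (1 / 4)"

lemma int_mult_quarter_inj: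
  assumes "\<epsilon> \<in> {1, -1}" "\<epsilon>' \<in> {1, -1}" "int_mult \<epsilon> quarter = int_mult \<epsilon>' quarter"
  shows "\<epsilon> = \<epsilon>'"
proof (rule ccontr)
  assume "\<epsilon> \<noteq> \<epsilon>'"
  then have "quarter = - quarter" using assms by auto
  then have "abs_circle (1 / 4) = abs_circle (- (1 / 4))"
    by (simp add: quarter_def abs_circle_uminus)
  then obtain n :: int where "1 / 4 - (- (1 / 4)) = (of_int n :: real)"
    unfolding abs_circle_eq_iff by (auto elim: Ints_cases)
  then have "of_int (2 * n) = (1 :: real)" by simp
  then have "2 * n = 1" by (simp only: of_int_eq_1_iff)
  then show False by presburger
qed

lemma P_side_inject:
  assumes "\<epsilon> \<in> {1, -1}" "\<epsilon>' \<in> {1, -1}"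
  shows "P_side \<delta> \<epsilon> a = P_side \<delta>' \<epsilon>' b \<longleftrightarrow> \<delta> = \<delta>' \<and> \<epsilon> = \<epsilon>' \<and> a = b"
proof
  assume eq: "P_side \<delta> \<epsilon> a = P_side \<delta>' \<epsilon>' b"
  have "\<delta> = \<delta>'" "a = b" using fun_cong[OF eq, of "Split 0 Plus"] by auto
  moreover have "int_mult \<epsilon> quarter = int_mult \<epsilon>' quarter"
    using fun_cong[OF eq, of "Split quarter Plus"] \<open>a = b\<close> by simp
  ultimately show "\<delta> = \<delta>' \<and> \<epsilon> = \<epsilon>' \<and> a = b" using int_mult_quarter_inj[OF assms] by simp
qed simp

lemma tendsto_Split_add: "((\<lambda>t. Split (b + t) \<rho>) \<longlongrightarrow> Split (b + a) \<delta>) (side \<delta> a)"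
  by (rule filterlim_compose[OF tendsto_Split filterlim_side_add])

lemma tendsto_P_side: "(P_side \<rho> \<epsilon> \<longlongrightarrow> P_side \<delta> \<epsilon> a) (side \<delta> a)"
  unfolding tendsto_fun_iff
proof
  fix x show "((\<lambda>t. P_side \<rho> \<epsilon> t x) \<longlongrightarrow> P_side \<delta> \<epsilon> a x) (side \<delta> a)"
    using tendsto_Split_add by (cases x) simp
qed

lemma tendsto_P_map: "(P_map \<epsilon> \<longlongrightarrow> P_side \<delta> \<epsilon> a) (side \<delta> a)"
  unfolding tendsto_fun_iff
proof
  fix x show "((\<lambda>t. P_map \<epsilon> t x) \<longlongrightarrow> P_side \<delta> \<epsilon> a x) (side \<delta> a)"
    using tendsto_Split_add by (cases x) simp
qed

lemma two_sided_P_side: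
  assumes "\<And>\<rho> a. P_side \<rho> \<epsilon> a \<in> E"
  shows "two_sided (top_of_set E) (\<lambda>\<rho>. P_side \<rho> \<epsilon>)"
  unfolding two_sided_def
proof (intro allI)
  fix \<delta> \<rho> a
  show "limitin (top_of_set E) (P_side \<rho> \<epsilon>) (P_side \<delta> \<epsilon> a) (side \<delta> a)"
    using tendsto_P_side[of \<rho> \<epsilon> \<delta> a] assms by (simp add: limitin_subtopology)
qed

lemma two_sided_Split: "two_sided euclidean (\<lambda>\<rho> a. Split a \<rho>)"
  by (simp add: two_sided_def tendsto_Split)

lemma continuous_on_P_map:
  assumes "\<epsilon> \<in> {1, -1}" shows "continuous_on UNIV (P_map \<epsilon> a)"
  unfolding continuous_on_open_vimage[OF open_UNIV]
proof (intro allI impI)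
  fix U :: "split_circle set" assume U: "open U"
  have "eventually (\<lambda>t. Split t \<rho> \<in> P_map \<epsilon> a -` U) (side \<delta> b)"
    if "Split b \<delta> \<in> P_map \<epsilon> a -` U" for b \<delta> \<rho>
  proof -
    have "filterlim (\<lambda>t. int_mult \<epsilon> t + a) (side (sign_power \<delta> \<epsilon>) (int_mult \<epsilon> b + a)) (side \<delta> b)"
      using assms filterlim_side_add[of a \<delta> b]
        filterlim_compose[OF filterlim_side_add[of a "opposite \<delta>" "- b"] filterlim_side_uminus[of \<delta> b]]
      by (auto simp: add.commute)
    then have "((\<lambda>t. P_map \<epsilon> a (Split t \<rho>)) \<longlongrightarrow> P_map \<epsilon> a (Split b \<delta>)) (side \<delta> b)"
      by (auto intro: filterlim_compose[OF tendsto_Split])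
    from topological_tendstoD[OF this U] show ?thesis using that by simp
  qed
  then have "open (P_map \<epsilon> a -` U)" unfolding open_split_circle_iff by simp
  then show "open (P_map \<epsilon> a -` U \<inter> UNIV)" by simp
qed

lemma continuous_on_comp_left:
  fixes f :: "'a::topological_space \<Rightarrow> 'a"
  assumes "continuous_on UNIV f"
  shows "continuous_on UNIV ((\<circ>) f :: ('b \<Rightarrow> 'a) \<Rightarrow> 'b \<Rightarrow> 'a)"
proof (rule continuous_on_coordinatewise_then_product)
  fix i
  show "continuous_on UNIV (\<lambda>p :: 'b \<Rightarrow> 'a. (f \<circ> p) i)"
    using continuous_on_compose2[OF assms continuous_on_product_coordinates[of i]] by (simp add: o_def)
qed

section \<open>The acting group\<close>

lemma generate_P_map:
  "generate (BijGroup UNIV) {P_map 1 \<alpha>, P_map (-1) 0}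
    = {P_map \<epsilon> (int_mult n \<alpha>) | \<epsilon> n. \<epsilon> \<in> {1, -1}}" (is "generate ?B ?H = ?G")
proof (intro equalityI subsetI)
  interpret B: group ?B by (rule group_BijGroup)
  have inv: "P_map \<epsilon> (- int_mult \<epsilon> a) \<circ> P_map \<epsilon> a = id" "P_map \<epsilon> a \<circ> P_map \<epsilon> (- int_mult \<epsilon> a) = id"
    if "\<epsilon> \<in> {1, -1}" for \<epsilon> a
    using that by (auto simp: P_map_comp P_map_id)
  have Bij: "P_map \<epsilon> a \<in> Bij UNIV" if "\<epsilon> \<in> {1, -1}" for \<epsilon> a
    using o_bij[OF inv[OF that]] by (simp add: Bij_def)
  have mult: "P_map \<epsilon> a \<otimes>\<^bsub>?B\<^esub> P_map \<epsilon>' b = P_map (\<epsilon> * \<epsilon>') (int_mult \<epsilon> b + a)"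
    if "\<epsilon> \<in> {1, -1}" "\<epsilon>' \<in> {1, -1}" for \<epsilon> \<epsilon>' a b
  proof -
    have "P_map \<epsilon> a \<otimes>\<^bsub>?B\<^esub> P_map \<epsilon>' b = P_map \<epsilon> a \<circ> P_map \<epsilon>' b"
      using Bij[OF that(1)] Bij[OF that(2)] by (simp add: BijGroup_def compose_def o_def restrict_def)
    then show ?thesis using P_map_comp[OF that] by simp
  qed
  have one_eq: "\<one>\<^bsub>?B\<^esub> = P_map 1 0" by (simp add: BijGroup_def P_map_id id_def restrict_def)
  have carrier: "P_map \<epsilon> a \<in> carrier ?B" if "\<epsilon> \<in> {1, -1}" for \<epsilon> a
    using Bij[OF that] by (simp add: BijGroup_def)
  have inverse: "inv\<^bsub>?B\<^esub> P_map \<epsilon> a = P_map \<epsilon> (- int_mult \<epsilon> a)" if "\<epsilon> \<in> {1, -1}" for \<epsilon> a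
  proof (rule B.inv_equality)
    show "P_map \<epsilon> (- int_mult \<epsilon> a) \<otimes>\<^bsub>?B\<^esub> P_map \<epsilon> a = \<one>\<^bsub>?B\<^esub>"
      using that by (auto simp: mult one_eq)
  qed (use that carrier in simp_all)
  have int_mult_add: "int_mult (m + n) \<alpha> = int_mult m \<alpha> + int_mult n \<alpha>" for m n
    by transfer (simp add: algebra_simps)
  have int_mult_uminus: "int_mult (- n) \<alpha> = - int_mult n \<alpha>" for n
    by transfer simp
  have int_mult_0: "int_mult 0 \<alpha> = 0" by transfer simp
  {
    fix g assume "g \<in> generate ?B ?H"
    then show "g \<in> ?G"
    proof induction
      case one
      show ?case unfolding one_eq int_mult_0[symmetric] by blast
    next
      case (incl h)
      then consider "h = P_map 1 (int_mult 1 \<alpha>)" | "h = P_map (-1) (int_mult 0 \<alpha>)"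
        by (auto simp: int_mult_0)
      then show ?case by cases blast+
    next
      case (inv h)
      then consider "inv\<^bsub>?B\<^esub> h = P_map 1 (int_mult (-1) \<alpha>)" | "inv\<^bsub>?B\<^esub> h = P_map (-1) (int_mult 0 \<alpha>)"
        by (auto simp: inverse int_mult_0)
      then show ?case by cases blast+
    next
      case (eng g h)
      then obtain \<epsilon> m \<epsilon>' n where gh: "\<epsilon> \<in> {1, -1}" "\<epsilon>' \<in> {1, -1}"
          "g = P_map \<epsilon> (int_mult m \<alpha>)" "h = P_map \<epsilon>' (int_mult n \<alpha>)" by auto
      have "int_mult \<epsilon> (int_mult n \<alpha>) + int_mult m \<alpha> = int_mult (\<epsilon> * n + m) \<alpha>"
        using gh(1) by (auto simp: int_mult_add int_mult_uminus)
      then have "g \<otimes>\<^bsub>?B\<^esub> h = P_map (\<epsilon> * \<epsilon>') (int_mult (\<epsilon> * n + m) \<alpha>)"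
        using mult[OF gh(1,2)] gh(3,4) by simp
      moreover have "\<epsilon> * \<epsilon>' \<in> {1, -1}" using gh(1,2) by auto
      ultimately show ?case by blast
    qed
  }
  have R: "P_map 1 \<alpha> \<in> generate ?B ?H" and J: "P_map (-1) 0 \<in> generate ?B ?H"
    and R': "P_map 1 (- \<alpha>) \<in> generate ?B ?H"
    using generate.inv[of "P_map 1 \<alpha>" ?H ?B] by (auto simp: inverse intro: generate.incl)
  have pow: "P_map 1 (int_mult (int n) \<alpha>) \<in> generate ?B ?H" "P_map 1 (int_mult (- int n) \<alpha>) \<in> generate ?B ?H" for n
  proof (induction n)
    case 0
    show "P_map 1 (int_mult (int 0) \<alpha>) \<in> generate ?B ?H" "P_map 1 (int_mult (- int 0) \<alpha>) \<in> generate ?B ?H"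
      using generate.one[of ?B ?H] by (simp_all add: one_eq int_mult_0)
  next
    case (Suc n)
    have "P_map 1 (int_mult (int (Suc n)) \<alpha>) = P_map 1 \<alpha> \<otimes>\<^bsub>?B\<^esub> P_map 1 (int_mult (int n) \<alpha>)"
      "P_map 1 (int_mult (- int (Suc n)) \<alpha>) = P_map 1 (- \<alpha>) \<otimes>\<^bsub>?B\<^esub> P_map 1 (int_mult (- int n) \<alpha>)"
      using int_mult_add[of "int n" 1] int_mult_add[of "- int n" "-1"]
      by (simp_all add: mult add.commute[of 1] add.commute[of "- 1"] uminus_add_conv_diff)
    then show "P_map 1 (int_mult (int (Suc n)) \<alpha>) \<in> generate ?B ?H"
        "P_map 1 (int_mult (- int (Suc n)) \<alpha>) \<in> generate ?B ?H"
      using generate.eng[OF R Suc(1)] generate.eng[OF R' Suc(2)] by simp_all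
  qed
  have rot: "P_map 1 (int_mult n \<alpha>) \<in> generate ?B ?H" for n
    using pow[of "nat n"] pow[of "nat (- n)"] by (cases "n \<ge> 0") simp_all
  fix g assume "g \<in> ?G"
  then obtain n where "g = P_map 1 (int_mult n \<alpha>) \<or> g = P_map (-1) (int_mult n \<alpha>)" by auto
  moreover have "P_map (-1) (int_mult n \<alpha>) = P_map 1 (int_mult n \<alpha>) \<otimes>\<^bsub>?B\<^esub> P_map (-1) 0"
    by (simp add: mult)
  ultimately show "g \<in> generate ?B ?H"
    using rot[of n] generate.eng[OF rot[of n] J] by auto
qed

lemma dense_irrational_multiples:
  assumes "irrational \<alpha>" "0 < e"
  shows "\<exists>s. \<bar>s - r\<bar> < e \<and> abs_circle s \<in> range (\<lambda>n. int_mult n \<alpha>)"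
proof -
  obtain \<theta> where \<theta>: "\<alpha> = abs_circle \<theta>" by (rule abs_circle_cases)
  have "\<theta> \<notin> \<rat>" using assms(1) by (simp add: \<theta> irrational.abs_eq)
  then obtain h k where hk: "\<bar>of_int k * \<theta> - of_int h - r\<bar> < e"
    using sequence_of_fractional_parts_is_dense[of \<theta> e r] assms(2) by metis
  have "abs_circle (of_int k * \<theta> - of_int h) = int_mult k \<alpha>"
    by (simp add: \<theta> int_mult.abs_eq abs_circle_eq_iff)
  then show ?thesis using hk by (intro exI[of _ "of_int k * \<theta> - of_int h"]) auto
qed

section \<open>The enveloping semigroup\<close>

text \<open>For the theorem, \<open>D\<close> is the subgroup generated by \<open>\<alpha>\<close>.\<close>

locale dense_flow =
  fixes D :: "circle set" and G :: "(split_circle \<Rightarrow> split_circle) set"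
  assumes dense: "\<And>r e. 0 < e \<Longrightarrow> \<exists>s. \<bar>s - r\<bar> < e \<and> abs_circle s \<in> D"
    and countable_D: "countable D"
    and add_D: "\<And>d d'. d \<in> D \<Longrightarrow> d' \<in> D \<Longrightarrow> d + d' \<in> D"
    and uminus_D: "\<And>d. d \<in> D \<Longrightarrow> - d \<in> D"
    and G_eq: "G = {P_map \<epsilon> d | \<epsilon> d. \<epsilon> \<in> {1, -1} \<and> d \<in> D}"
begin

lemma dense_side:
  assumes "eventually P (side \<delta> a)" shows "\<exists>d\<in>D. P d"
proof (cases \<delta>)
  case Plus
  then have "eventually P (side Plus a)" using assms by simp
  then obtain h where h: "h > 0" "\<forall>u. 0 < u \<and> u < h \<longrightarrow> P (a + abs_circle u)"
    unfolding eventually_side_Plus by auto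
  obtain r where r: "a = abs_circle r" by (rule abs_circle_cases)
  obtain s where s: "\<bar>s - (r + h / 2)\<bar> < h / 2" "abs_circle s \<in> D"
    using dense[of "h / 2" "r + h / 2"] h(1) by auto
  have "0 < s - r" "s - r < h" using s(1) by linarith+
  then have "P (a + abs_circle (s - r))" using h(2) by blast
  then show ?thesis using s(2) by (auto simp: r abs_circle_diff)
next
  case Minus
  then have "eventually P (side Minus a)" using assms by simp
  then obtain h where h: "h > 0" "\<forall>u. 0 < u \<and> u < h \<longrightarrow> P (a - abs_circle u)"
    unfolding eventually_side_Minus by auto
  obtain r where r: "a = abs_circle r" by (rule abs_circle_cases)
  obtain s where s: "\<bar>s - (r - h / 2)\<bar> < h / 2" "abs_circle s \<in> D"
    using dense[of "h / 2" "r - h / 2"] h(1) by auto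
  have "0 < r - s" "r - s < h" using s(1) by linarith+
  then have "P (a - abs_circle (r - s))" using h(2) by blast
  then show ?thesis using s(2) by (auto simp: r abs_circle_diff)
qed

lemma P_side_in_closure:
  assumes "\<epsilon> \<in> {1, -1}" shows "P_side \<delta> \<epsilon> a \<in> closure G"
  unfolding closure_iff_nhds_not_empty
proof (intro allI impI)
  fix A U assume "U \<subseteq> A" "open U" "P_side \<delta> \<epsilon> a \<in> U"
  have "eventually (\<lambda>t. P_map \<epsilon> t \<in> U) (side \<delta> a)"
    by (rule topological_tendstoD[OF tendsto_P_map \<open>open U\<close> \<open>P_side \<delta> \<epsilon> a \<in> U\<close>])
  from dense_side[OF this] obtain d where "d \<in> D" "P_map \<epsilon> d \<in> U" by auto
  then have "P_map \<epsilon> d \<in> G \<inter> A" using \<open>U \<subseteq> A\<close> assms by (auto simp: G_eq)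
  then show "G \<inter> A \<noteq> {}" by auto
qed

lemma continuous_on_pt_eval: "continuous_on UNIV (\<lambda>p :: split_circle \<Rightarrow> split_circle. pt (p x))"
  by (rule continuous_on_compose2[OF continuous_on_pt continuous_on_product_coordinates]) simp

text \<open>A limit of the maps \<open>P_map \<epsilon> d\<close> moves base points by an isometry \<open>t \<mapsto> \<epsilon> t + a\<close>, so only its signs
  are open. If it takes the value \<open>+\<close> at one point and \<open>-\<close> at another, then approximants have \<open>d\<close> weakly to the
  right and weakly to the left of \<open>a\<close>; hence \<open>d = a\<close>, and the signs are those of \<open>P_map \<epsilon> a\<close>.\<close>

lemma closure_one_orientation:
  assumes \<epsilon>: "\<epsilon> \<in> {1, -1}" and p: "p \<in> closure (P_map \<epsilon> ` D)"
  shows "p \<in> P_map \<epsilon> ` D \<or> (\<exists>\<delta> a. p = P_side \<delta> \<epsilon> a)"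
proof -
  define a where "a = pt (p (Split 0 Plus))"
  have pt_p: "pt (p x) = int_mult \<epsilon> (pt x) + a" for x
  proof -
    let ?C = "{p. pt (p x) = int_mult \<epsilon> (pt x) + pt (p (Split 0 Plus))}"
    have "closed ?C"
      by (intro closed_Collect_eq continuous_intros continuous_on_pt_eval)
    moreover have "P_map \<epsilon> ` D \<subseteq> ?C"
    proof
      fix q assume "q \<in> P_map \<epsilon> ` D"
      then show "q \<in> ?C" by (cases x) auto
    qed
    ultimately have "closure (P_map \<epsilon> ` D) \<subseteq> ?C" by (rule closure_minimal[rotated])
    then show ?thesis using p by (auto simp: a_def)
  qed
  define \<sigma> where "\<sigma> x = (case p x of Split t \<rho> \<Rightarrow> \<rho>)" for x
  have p_eq: "p (Split t \<rho>) = Split (int_mult \<epsilon> t + a) (\<sigma> (Split t \<rho>))" for t \<rho>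
    using pt_p[of "Split t \<rho>"] by (cases "p (Split t \<rho>)") (simp add: \<sigma>_def)
  have neq: "b \<noteq> b + abs_circle (1/4)" for b
    using abs_circle_eq_iff[of 0 "1/4"] by (auto simp: abs_circle_zero[symmetric] elim!: Ints_cases)
  have mixed: "a \<in> D \<and> sign_power \<rho> \<epsilon> = Plus \<and> sign_power \<rho>' \<epsilon> = Minus"
    if plus: "\<sigma> (Split s \<rho>) = Plus" and minus: "\<sigma> (Split t \<rho>') = Minus" for s t \<rho> \<rho>'
  proof -
    let ?b = "int_mult \<epsilon> s + a" and ?c = "int_mult \<epsilon> t + a - abs_circle (1/4)"
    let ?V = "split_arc ?b (?b + abs_circle (1/4))"
    let ?W = "split_arc ?c (?c + abs_circle (1/4))"
    let ?U = "{q. q (Split s \<rho>) \<in> ?V} \<inter> {q. q (Split t \<rho>') \<in> ?W}"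
    have "open {q :: split_circle \<Rightarrow> split_circle. q x \<in> split_arc b c}" for x b c
      using open_vimage[OF open_arc[of b c] continuous_on_product_coordinates[of x]]
      by (simp add: vimage_def)
    then have "open ?U" by (intro open_Int)
    moreover have "p \<in> ?U"
      using arc_endpoints(1)[OF neq[of ?b]] arc_endpoints(2)[OF neq[of ?c]] plus minus by (simp add: p_eq)
    ultimately have "?U \<inter> P_map \<epsilon> ` D \<noteq> {}"
      using open_Int_closure_eq_empty[of ?U "P_map \<epsilon> ` D"] p by blast
    then obtain d where d: "d \<in> D" "P_map \<epsilon> d (Split s \<rho>) \<in> ?V" "P_map \<epsilon> d (Split t \<rho>') \<in> ?W" by auto
    have "\<exists>u. 0 \<le> u \<and> u \<le> 1/4 \<and> d = a + abs_circle u \<and> (u = 0 \<longrightarrow> sign_power \<rho> \<epsilon> = Plus)"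
    proof -
      from arc_cases[OF d(2)]
      consider "d = a" "sign_power \<rho> \<epsilon> = Plus" | "d = a + abs_circle (1/4)"
        | w where "0 < w" "w < 1/4" "d = a + abs_circle w"
        by (auto simp: add.assoc)
      then show ?thesis
      proof cases
        case 1 then show ?thesis by (intro exI[of _ 0]) (simp add: abs_circle_zero)
      next
        case 2 then show ?thesis by (intro exI[of _ "1/4"]) simp
      next
        case (3 w) then show ?thesis by (intro exI[of _ w]) simp
      qed
    qed
    then obtain u where u: "0 \<le> u" "u \<le> 1/4" "d = a + abs_circle u" "u = 0 \<longrightarrow> sign_power \<rho> \<epsilon> = Plus"
      by auto
    have "\<exists>v. 0 \<le> v \<and> v \<le> 1/4 \<and> d = a - abs_circle v \<and> (v = 0 \<longrightarrow> sign_power \<rho>' \<epsilon> = Minus)"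
    proof -
      from arc_cases[OF d(3)] 
      consider "d = a - abs_circle (1/4)" | "d = a" "sign_power \<rho>' \<epsilon> = Minus"
        | w where "0 < w" "w < 1/4" "d = a - abs_circle (1/4 - w)"
        by (auto simp: abs_circle_diff algebra_simps)
      then show ?thesis
      proof cases
        case 1 then show ?thesis by (intro exI[of _ "1/4"]) simp
      next
        case 2 then show ?thesis by (intro exI[of _ 0]) (simp add: abs_circle_zero)
      next
        case (3 w) then show ?thesis by (intro exI[of _ "1/4 - w"]) simp
      qed
    qed
    then obtain v where v: "0 \<le> v" "v \<le> 1/4" "d = a - abs_circle v" "v = 0 \<longrightarrow> sign_power \<rho>' \<epsilon> = Minus"
      by auto
    have "abs_circle u = abs_circle (- v)" using u(3) v(3) by (simp add: abs_circle_uminus)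
    then obtain n :: int where "u + v = of_int n"
      unfolding abs_circle_eq_iff by (auto elim: Ints_cases)
    moreover from this have "n = 0" using u(1,2) v(1,2) by linarith
    ultimately have "u = 0" "v = 0" using u(1) v(1) by auto
    then show ?thesis using u v d(1) by (simp add: abs_circle_zero)
  qed
  show ?thesis
  proof (cases "\<exists>\<delta>. \<forall>x. \<sigma> x = \<delta>")
    case True
    then obtain \<delta> where "\<And>x. \<sigma> x = \<delta>" by auto
    then have "p x = P_side \<delta> \<epsilon> a x" for x by (cases x) (simp add: p_eq)
    then show ?thesis by blast
  next
    case False
    then obtain x y where xy: "\<sigma> x = Plus" "\<sigma> y = Minus" by (metis sign.exhaust)
    obtain s \<rho> t \<rho>' where xy': "x = Split s \<rho>" "y = Split t \<rho>'" by (metis split_circle.exhaust)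
    have "\<sigma> (Split r \<tau>) = sign_power \<tau> \<epsilon>" for r \<tau>
      using mixed[of r \<tau> t \<rho>'] mixed[of s \<rho> r \<tau>] xy unfolding xy'
      by (cases "\<sigma> (Split r \<tau>)") simp_all
    then have "p z = P_map \<epsilon> a z" for z by (cases z) (simp add: p_eq)
    then have "p = P_map \<epsilon> a" by auto
    moreover have "a \<in> D" using mixed[of s \<rho> t \<rho>'] xy unfolding xy' by simp
    ultimately show ?thesis by blast
  qed
qed

lemma enveloping_semigroup_eq: "enveloping_semigroup G = G \<union> K_side Plus \<union> K_side Minus"
proof (intro equalityI subsetI)
  have G: "G = P_map 1 ` D \<union> P_map (-1) ` D" by (auto simp: G_eq)
  fix p assume "p \<in> enveloping_semigroup G"
  then have "p \<in> closure (P_map 1 ` D) \<or> p \<in> closure (P_map (-1) ` D)"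
    unfolding enveloping_semigroup_def G closure_Un by simp
  then obtain \<epsilon> :: int where \<epsilon>: "\<epsilon> \<in> {1, -1}" and "p \<in> closure (P_map \<epsilon> ` D)" by auto
  from closure_one_orientation[OF this] consider "p \<in> P_map \<epsilon> ` D" | \<delta> a where "p = P_side \<delta> \<epsilon> a"
    by auto
  then show "p \<in> G \<union> K_side Plus \<union> K_side Minus"
  proof cases
    case 1
    then show ?thesis using \<epsilon> by (auto simp: G)
  next
    case 2
    then have "p \<in> K_side \<delta>" using \<epsilon> by (auto simp: K_side_def)
    then show ?thesis by (cases \<delta>) auto
  qed
next
  fix p assume "p \<in> G \<union> K_side Plus \<union> K_side Minus"
  then show "p \<in> enveloping_semigroup G"
    using closure_subset[of G] P_side_in_closure by (auto simp: enveloping_semigroup_def K_side_def)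
qed

lemma P_side_in_E: "\<epsilon> \<in> {1, -1} \<Longrightarrow> P_side \<delta> \<epsilon> a \<in> enveloping_semigroup G"
  using P_side_in_closure by (simp add: enveloping_semigroup_def)

text \<open>Elements of the ideal are carried to each other by left composition, as in a group; the sign of the
  left factor prevails, so the idempotent of sign \<open>\<delta>\<close> projects the ideal onto the maps of sign \<open>\<delta>\<close>.\<close>

theorem is_ellis_group_K_side:
  "is_ellis_group G (K_side Plus \<union> K_side Minus) (P_side \<delta> 1 0) (K_side \<delta>)"
proof -
  let ?E = "enveloping_semigroup G" and ?M = "K_side Plus \<union> K_side Minus"
  have M: "p \<in> ?M \<longleftrightarrow> (\<exists>\<delta> \<epsilon> a. \<epsilon> \<in> {1, -1} \<and> p = P_side \<delta> \<epsilon> a)" for p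
  proof
    assume "\<exists>\<delta> \<epsilon> a. \<epsilon> \<in> {1, -1} \<and> p = P_side \<delta> \<epsilon> a"
    then obtain \<delta> \<epsilon> a where "\<epsilon> \<in> {1, -1}" "p = P_side \<delta> \<epsilon> a" by auto
    then have "p \<in> K_side \<delta>" by (auto simp: K_side_def)
    then show "p \<in> ?M" by (cases \<delta>) auto
  qed (auto simp: K_side_def)
  have comp: "p \<circ> q \<in> ?M" if pq: "p \<in> ?E" "q \<in> ?M" for p q
  proof -
    obtain \<delta> \<epsilon> a where q: "\<epsilon> \<in> {1, -1}" "q = P_side \<delta> \<epsilon> a" using pq(2) M by auto
    from pq(1) have "p \<in> G \<or> p \<in> ?M" by (simp add: enveloping_semigroup_eq)
    then show ?thesis
    proof
      assume "p \<in> G"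
      then obtain \<epsilon>' d where p: "\<epsilon>' \<in> {1, -1}" "p = P_map \<epsilon>' d" by (auto simp: G_eq)
      have "\<epsilon>' * \<epsilon> \<in> {1, -1}" using p(1) q(1) by auto
      then show ?thesis unfolding M p(2) q(2) P_map_P_side[OF p(1) q(1)] by blast
    next
      assume "p \<in> ?M"
      then obtain \<delta>' \<epsilon>' a' where p: "\<epsilon>' \<in> {1, -1}" "p = P_side \<delta>' \<epsilon>' a'" using M by auto
      have "\<epsilon>' * \<epsilon> \<in> {1, -1}" using p(1) q(1) by auto
      then show ?thesis unfolding M p(2) q(2) P_side_comp[OF p(1) q(1)] by blast
    qed
  qed
  have "?M \<noteq> {}" using M[of "P_side Plus 1 0"] by blast
  then have "left_ideal ?E ?M"
    unfolding left_ideal_def using comp by (auto simp only: enveloping_semigroup_eq)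
  moreover have "I = ?M" if I: "left_ideal ?E I" "I \<subseteq> ?M" for I
  proof (intro equalityI subsetI)
    fix p assume "p \<in> ?M"
    then obtain \<delta>' \<epsilon>' a' where p: "\<epsilon>' \<in> {1, -1}" "p = P_side \<delta>' \<epsilon>' a'" using M by auto
    obtain q where q: "q \<in> I" using I(1) by (auto simp: left_ideal_def)
    then obtain \<delta> \<epsilon> a where q': "\<epsilon> \<in> {1, -1}" "q = P_side \<delta> \<epsilon> a" using I(2) M by blast
    let ?r = "P_side \<delta>' (\<epsilon>' * \<epsilon>) (a' - int_mult (\<epsilon>' * \<epsilon>) a)"
    have e: "\<epsilon>' * \<epsilon> \<in> {1, -1}" using p(1) q'(1) by auto
    have "?r \<circ> q \<in> I" using I(1) q P_side_in_E[OF e] unfolding left_ideal_def by blast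
    moreover have "?r \<circ> q = p"
      unfolding q'(2) p(2) P_side_comp[OF e q'(1)] using q'(1) by auto
    ultimately show "p \<in> I" by simp
  qed (use I(2) in blast)
  ultimately have "minimal_left_ideal ?E ?M" by (simp add: minimal_left_ideal_def)
  moreover have "P_side \<delta> 1 0 \<in> ?M" using M by blast
  moreover have u: "P_side \<delta> 1 0 \<circ> P_side \<delta>' \<epsilon> a = P_side \<delta> \<epsilon> a" if "\<epsilon> \<in> {1, -1}" for \<delta>' \<epsilon> a
    using P_side_comp[OF _ that, of 1] by simp
  moreover have "K_side \<delta> = (\<lambda>p. P_side \<delta> 1 0 \<circ> p) ` ?M"
  proof (intro equalityI subsetI)
    fix p assume "p \<in> (\<lambda>p. P_side \<delta> 1 0 \<circ> p) ` ?M"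
    then obtain q where q: "q \<in> ?M" "p = P_side \<delta> 1 0 \<circ> q" by (rule imageE)
    obtain \<delta>' \<epsilon> a where "\<epsilon> \<in> {1, -1}" "q = P_side \<delta>' \<epsilon> a" using q(1) unfolding M by auto
    then show "p \<in> K_side \<delta>" using q(2) u by (auto simp: K_side_def)
  next
    fix p assume "p \<in> K_side \<delta>"
    then obtain \<epsilon> a where p: "\<epsilon> \<in> {1, -1}" "p = P_side \<delta> \<epsilon> a" by (auto simp: K_side_def)
    then have "p \<in> ?M" unfolding M by blast
    then show "p \<in> (\<lambda>p. P_side \<delta> 1 0 \<circ> p) ` ?M"
      using u[OF p(1), of \<delta> a] p(2) by (intro image_eqI[of _ _ p]) simp_all
  qed
  ultimately show ?thesis by (simp add: is_ellis_group_def)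
qed

end

section \<open>Haar measure of the group of isometries of the circle\<close>

text \<open>The pair \<open>(\<epsilon>, a)\<close> stands for the isometry \<open>t \<mapsto> \<epsilon> t + a\<close>.\<close>

definition isometry_measure :: "(int \<times> circle) measure" where
  "isometry_measure = uniform_count_measure {1, -1} \<Otimes>\<^sub>M arc_length"

fun isometry_mult :: "int \<times> circle \<Rightarrow> int \<times> circle \<Rightarrow> int \<times> circle" where
  "isometry_mult (\<epsilon>, a) (\<epsilon>', b) = (\<epsilon> * \<epsilon>', int_mult \<epsilon> b + a)"

lemma sets_isometry_measure [measurable_cong]:
  "sets isometry_measure = sets (count_space {1, -1} \<Otimes>\<^sub>M borel)"
  unfolding isometry_measure_def
  by (intro sets_pair_measure_cong sets_uniform_count_measure_count_space sets_arc_length)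

lemma space_isometry_measure [simp]: "space isometry_measure = {1, -1} \<times> UNIV"
  by (simp add: isometry_measure_def space_pair_measure space_uniform_count_measure)

interpretation signs: prob_space "uniform_count_measure {1, -1 :: int}"
  by (rule prob_space_uniform_count_measure) simp_all

interpretation isometry: pair_prob_space "uniform_count_measure {1, -1 :: int}" arc_length ..

lemma prob_space_isometry_measure: "prob_space isometry_measure"
  unfolding isometry_measure_def by (rule isometry.prob_space_axioms)

lemma measurable_isometryI:
  assumes "\<And>\<epsilon>. \<epsilon> \<in> {1, -1} \<Longrightarrow> (\<lambda>a. f (\<epsilon>, a)) \<in> measurable borel N"
  shows "f \<in> measurable isometry_measure N"
  unfolding measurable_cong_sets[OF sets_isometry_measure refl]
  by (rule measurable_pair_measure_countable1) (use assms in auto)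

lemma section_isometry_measure:
  assumes "B \<in> sets isometry_measure" shows "Pair \<epsilon> -` B \<in> sets borel"
  using sets_Pair1[OF assms[unfolded isometry_measure_def]] by simp

lemma emeasure_isometry_measure:
  assumes "B \<in> sets isometry_measure"
  shows "emeasure isometry_measure B
    = ennreal (1/2) * (emeasure arc_length (Pair 1 -` B) + emeasure arc_length (Pair (-1) -` B))"
  using arc_length.emeasure_pair_measure_alt[OF assms[unfolded isometry_measure_def]]
  by (simp add: isometry_measure_def uniform_count_measure_def nn_integral_point_measure_finite distrib_left)

lemma integral_isometry_measure:
  fixes f :: "int \<times> circle \<Rightarrow> 'b :: {banach, second_countable_topology}"
  assumes "integrable isometry_measure f"
  shows "integral\<^sup>L isometry_measure f
    = (1/2) *\<^sub>R ((\<integral>a. f (1, a) \<partial>arc_length) + (\<integral>a. f (-1, a) \<partial>arc_length))"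
proof -
  have half: "integral\<^sup>L (uniform_count_measure {1, -1 :: int}) g = (1/2) *\<^sub>R (g 1 + g (-1))" for g :: "int \<Rightarrow> 'b"
    unfolding uniform_count_measure_def
    by (subst lebesgue_integral_point_measure_finite) (simp_all add: scaleR_add_right)
  show ?thesis
    using isometry.integral_fst'[OF assms[unfolded isometry_measure_def]]
    by (simp only: isometry_measure_def half)
qed

lemma emeasure_arc_length_translate:
  assumes "A \<in> sets borel" shows "emeasure arc_length ((\<lambda>a. a + b) -` A) = emeasure arc_length A"
proof -
  have "emeasure arc_length A = emeasure (distr arc_length borel ((+) b)) A"
    by (simp add: distr_arc_length_translate)
  also have "\<dots> = emeasure arc_length ((+) b -` A)" using assms by (simp add: emeasure_distr)
  also have "(+) b = (\<lambda>a. a + b)" by (auto simp: add.commute)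
  finally show ?thesis by simp
qed

lemma emeasure_arc_length_uminus:
  assumes "A \<in> sets borel" shows "emeasure arc_length (uminus -` A) = emeasure arc_length A"
proof -
  have "emeasure arc_length A = emeasure (distr arc_length borel uminus) A"
    by (simp add: distr_arc_length_uminus)
  also have "\<dots> = emeasure arc_length (uminus -` A)" using assms by (simp add: emeasure_distr)
  finally show ?thesis by simp
qed

lemma emeasure_arc_length_isometry:
  assumes "\<epsilon> \<in> {1, -1}" "A \<in> sets borel"
  shows "emeasure arc_length ((\<lambda>a. int_mult \<epsilon> a + b) -` A) = emeasure arc_length A"
proof -
  have "(\<lambda>a. a + b) -` A \<in> sets borel"
    using measurable_sets[of "\<lambda>a. a + b" borel borel A] assms(2) by simp
  from emeasure_arc_length_uminus[OF this] emeasure_arc_length_translate[OF assms(2)]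
  show ?thesis using assms(1) by (auto simp: vimage_def)
qed

lemma measurable_isometry_mult [measurable]:
  "(\<lambda>(x, y). isometry_mult x y) \<in> measurable (isometry_measure \<Otimes>\<^sub>M isometry_measure) isometry_measure"
proof -
  let ?S = "count_space {1, -1 :: int} \<Otimes>\<^sub>M (borel :: circle measure)"
  let ?f = "\<lambda>z :: (int \<times> circle) \<times> (int \<times> circle). (if fst (fst z) = 1 then fst (snd z) else - fst (snd z),
    (if fst (fst z) = 1 then snd (snd z) else - snd (snd z)) + snd (fst z))"
  have sgn: "(\<lambda>z. fst (fst z)) \<in> measurable (?S \<Otimes>\<^sub>M ?S) (count_space {1, -1})"
    by (rule measurable_compose[OF measurable_fst measurable_fst])
  have [measurable]: "Measurable.pred (?S \<Otimes>\<^sub>M ?S) (\<lambda>z. fst (fst z) = 1)"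
    by (rule measurable_compose[OF sgn]) simp
  have "?f \<in> measurable (?S \<Otimes>\<^sub>M ?S) ?S"
  proof (rule measurable_Pair)
    have sgn': "(\<lambda>z. fst (snd z)) \<in> measurable (?S \<Otimes>\<^sub>M ?S) (count_space {1, -1})"
      by (rule measurable_compose[OF measurable_snd measurable_fst])
    moreover have "(\<lambda>z. - fst (snd z)) \<in> measurable (?S \<Otimes>\<^sub>M ?S) (count_space {1, -1})"
      by (rule measurable_compose[OF sgn']) auto
    ultimately show "(\<lambda>z. if fst (fst z) = 1 then fst (snd z) else - fst (snd z))
        \<in> measurable (?S \<Otimes>\<^sub>M ?S) (count_space {1, -1})"
      by measurable
    show "(\<lambda>z. (if fst (fst z) = 1 then snd (snd z) else - snd (snd z)) + snd (fst z)) \<in> borel_measurable (?S \<Otimes>\<^sub>M ?S)"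
      by measurable
  qed
  also have "?this \<longleftrightarrow> (\<lambda>(x, y). isometry_mult x y) \<in> measurable (?S \<Otimes>\<^sub>M ?S) ?S"
    by (rule measurable_cong) (auto simp: space_pair_measure)
  finally show ?thesis
    by (simp add: measurable_cong_sets[OF sets_pair_measure_cong[OF sets_isometry_measure sets_isometry_measure] sets_isometry_measure])
qed

lemma isometry_mult_in_space:
  "x \<in> space isometry_measure \<Longrightarrow> y \<in> space isometry_measure \<Longrightarrow> isometry_mult x y \<in> space isometry_measure"
  by auto

lemma measurable_isometry_mult_left:
  "x \<in> space isometry_measure \<Longrightarrow> isometry_mult x \<in> measurable isometry_measure isometry_measure"
  using measurable_Pair2[OF measurable_isometry_mult] by simp

lemma measurable_isometry_mult_right:
  "y \<in> space isometry_measure \<Longrightarrow> (\<lambda>x. isometry_mult x y) \<in> measurable isometry_measure isometry_measure"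
  using measurable_Pair1[OF measurable_isometry_mult] by simp

lemma isometry_measure_left:
  assumes x: "x \<in> space isometry_measure"
  shows "distr isometry_measure isometry_measure (isometry_mult x) = isometry_measure"
proof (rule measure_eqI)
  fix B assume "B \<in> sets (distr isometry_measure isometry_measure (isometry_mult x))"
  then have B: "B \<in> sets isometry_measure" by simp
  obtain \<epsilon> c where xe: "x = (\<epsilon>, c)" "\<epsilon> \<in> {1, -1}" using x by (cases x) auto
  have m: "isometry_mult x -` B \<inter> space isometry_measure \<in> sets isometry_measure"
    by (rule measurable_sets[OF measurable_isometry_mult_left[OF x] B])
  have sec: "Pair \<epsilon>' -` (isometry_mult x -` B \<inter> space isometry_measure)
      = (\<lambda>a. int_mult \<epsilon> a + c) -` (Pair (\<epsilon> * \<epsilon>') -` B)" if "\<epsilon>' \<in> {1, -1}" for \<epsilon>'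
    using that by (auto simp: xe(1))
  have eq: "emeasure arc_length (Pair \<epsilon>' -` (isometry_mult x -` B \<inter> space isometry_measure))
      = emeasure arc_length (Pair (\<epsilon> * \<epsilon>') -` B)" if "\<epsilon>' \<in> {1, -1}" for \<epsilon>'
    unfolding sec[OF that] by (rule emeasure_arc_length_isometry[OF xe(2) section_isometry_measure[OF B]])
  have "emeasure (distr isometry_measure isometry_measure (isometry_mult x)) B
      = ennreal (1/2) * (emeasure arc_length (Pair (\<epsilon> * 1) -` B) + emeasure arc_length (Pair (\<epsilon> * (-1)) -` B))"
    using eq[of 1] eq[of "-1"]
    by (simp only: emeasure_distr[OF measurable_isometry_mult_left[OF x] B] emeasure_isometry_measure[OF m]) simp
  also have "\<dots> = emeasure isometry_measure B"
    using xe(2) by (auto simp: emeasure_isometry_measure[OF B] add.commute)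
  finally show "emeasure (distr isometry_measure isometry_measure (isometry_mult x)) B = emeasure isometry_measure B" .
qed simp

lemma isometry_measure_right:
  assumes y: "y \<in> space isometry_measure"
  shows "distr isometry_measure isometry_measure (\<lambda>x. isometry_mult x y) = isometry_measure"
proof (rule measure_eqI)
  fix B assume "B \<in> sets (distr isometry_measure isometry_measure (\<lambda>x. isometry_mult x y))"
  then have B: "B \<in> sets isometry_measure" by simp
  obtain \<epsilon> c where ye: "y = (\<epsilon>, c)" "\<epsilon> \<in> {1, -1}" using y by (cases y) auto
  let ?A = "(\<lambda>x. isometry_mult x y) -` B \<inter> space isometry_measure"
  have m: "?A \<in> sets isometry_measure"
    by (rule measurable_sets[OF measurable_isometry_mult_right[OF y] B])
  have sec: "Pair \<epsilon>' -` ?A = (\<lambda>a. a + int_mult \<epsilon>' c) -` (Pair (\<epsilon>' * \<epsilon>) -` B)" if "\<epsilon>' \<in> {1, -1}" for \<epsilon>'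
    using that by (auto simp: ye(1) add.commute)
  have eq: "emeasure arc_length (Pair \<epsilon>' -` ?A) = emeasure arc_length (Pair (\<epsilon>' * \<epsilon>) -` B)"
    if "\<epsilon>' \<in> {1, -1}" for \<epsilon>'
    unfolding sec[OF that] by (rule emeasure_arc_length_translate[OF section_isometry_measure[OF B]])
  have "emeasure (distr isometry_measure isometry_measure (\<lambda>x. isometry_mult x y)) B
      = ennreal (1/2) * (emeasure arc_length (Pair (1 * \<epsilon>) -` B) + emeasure arc_length (Pair ((-1) * \<epsilon>) -` B))"
    using eq[of 1] eq[of "-1"]
    by (simp only: emeasure_distr[OF measurable_isometry_mult_right[OF y] B] emeasure_isometry_measure[OF m]) simp
  also have "\<dots> = emeasure isometry_measure B"
    using ye(2) by (auto simp: emeasure_isometry_measure[OF B] add.commute)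
  finally show "emeasure (distr isometry_measure isometry_measure (\<lambda>x. isometry_mult x y)) B = emeasure isometry_measure B" .
qed simp

lemma left_invariant_eq_isometry_measure:
  assumes "prob_space N" "sets N = sets isometry_measure"
    and "\<And>x. x \<in> space isometry_measure \<Longrightarrow> distr N N (isometry_mult x) = N"
  shows "N = isometry_measure"
  by (rule invariant_measures_coincide[OF prob_space_isometry_measure assms(1,2) measurable_isometry_mult])
    (simp_all add: assms(3) isometry_measure_right del: space_isometry_measure)

section \<open>Haar measure of the Ellis groups\<close>

definition enc :: "sign \<Rightarrow> int \<times> circle \<Rightarrow> split_circle \<Rightarrow> split_circle" where
  "enc \<delta> = (\<lambda>(\<epsilon>, a). P_side \<delta> \<epsilon> a)"

lemma enc_simp [simp]: "enc \<delta> (\<epsilon>, a) = P_side \<delta> \<epsilon> a"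
  by (simp add: enc_def)

definition dec :: "sign \<Rightarrow> (split_circle \<Rightarrow> split_circle) \<Rightarrow> int \<times> circle" where
  "dec \<delta> = the_inv_into (space isometry_measure) (enc \<delta>)"

lemma inj_on_enc: "inj_on (enc \<delta>) (space isometry_measure)"
  by (rule inj_onI) (auto simp: P_side_inject)

lemma enc_image: "enc \<delta> ` space isometry_measure = K_side \<delta>"
  by (auto simp: K_side_def image_iff) blast+

lemma dec_enc: "x \<in> space isometry_measure \<Longrightarrow> dec \<delta> (enc \<delta> x) = x"
  unfolding dec_def by (rule the_inv_into_f_f[OF inj_on_enc])

lemma enc_dec: "p \<in> K_side \<delta> \<Longrightarrow> enc \<delta> (dec \<delta> p) = p"
  unfolding dec_def by (rule f_the_inv_into_f[OF inj_on_enc]) (simp add: enc_image del: space_isometry_measure)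

lemma dec_in_space: "p \<in> K_side \<delta> \<Longrightarrow> dec \<delta> p \<in> space isometry_measure"
  unfolding dec_def by (rule the_inv_into_into[OF inj_on_enc]) (simp_all add: enc_image del: space_isometry_measure)

lemma enc_in_K_side: "x \<in> space isometry_measure \<Longrightarrow> enc \<delta> x \<in> K_side \<delta>"
  using enc_image by blast

lemma enc_comp:
  "x \<in> space isometry_measure \<Longrightarrow> y \<in> space isometry_measure \<Longrightarrow> enc \<delta> x \<circ> enc \<rho> y = enc \<delta> (isometry_mult x y)"
  by (cases x; cases y) (simp add: P_side_comp)

text \<open>The topology of two disjoint circles.\<close>

definition K_topology :: "sign \<Rightarrow> (split_circle \<Rightarrow> split_circle) topology" where
  "K_topology \<delta> = topology (\<lambda>U. U \<subseteq> K_side \<delta> \<and> (\<forall>\<epsilon>\<in>{1, -1}. open (P_side \<delta> \<epsilon> -` U)))"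

lemma openin_K_topology:
  "openin (K_topology \<delta>) U \<longleftrightarrow> U \<subseteq> K_side \<delta> \<and> (\<forall>\<epsilon>\<in>{1, -1}. open (P_side \<delta> \<epsilon> -` U))"
proof -
  have "istopology (\<lambda>U. U \<subseteq> K_side \<delta> \<and> (\<forall>\<epsilon>\<in>{1, -1}. open (P_side \<delta> \<epsilon> -` U)))"
    unfolding istopology_def
  proof (intro conjI allI impI)
    fix \<K> assume K: "\<forall>U\<in>\<K>. U \<subseteq> K_side \<delta> \<and> (\<forall>\<epsilon>\<in>{1, -1}. open (P_side \<delta> \<epsilon> -` U))"
    show "\<Union>\<K> \<subseteq> K_side \<delta>" using K by (intro Union_least) simp
    show "\<forall>\<epsilon>\<in>{1, -1}. open (P_side \<delta> \<epsilon> -` \<Union>\<K>)"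
      using K by (auto simp: vimage_Union intro!: open_UN)
  qed (auto simp: open_Int)
  then show ?thesis unfolding K_topology_def by (simp add: topology_inverse')
qed

lemma P_side_in_K_side: "\<epsilon> \<in> {1, -1} \<Longrightarrow> P_side \<delta> \<epsilon> a \<in> K_side \<delta>"
  by (auto simp: K_side_def)

lemma topspace_K_topology [simp]: "topspace (K_topology \<delta>) = K_side \<delta>"
proof (rule antisym)
  show "topspace (K_topology \<delta>) \<subseteq> K_side \<delta>"
    using openin_topspace[of "K_topology \<delta>"] unfolding openin_K_topology by (rule conjunct1)
  have "P_side \<delta> \<epsilon> -` K_side \<delta> = UNIV" if "\<epsilon> \<in> {1, -1}" for \<epsilon>
    using P_side_in_K_side[OF that] by auto
  then have "openin (K_topology \<delta>) (K_side \<delta>)" by (simp add: openin_K_topology)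
  then show "K_side \<delta> \<subseteq> topspace (K_topology \<delta>)" by (rule openin_subset)
qed

lemma vimage_P_side_image:
  assumes "\<epsilon> \<in> {1, -1}" "\<epsilon>' \<in> {1, -1}"
  shows "P_side \<delta> \<epsilon> -` (P_side \<delta> \<epsilon>' ` A) = (if \<epsilon> = \<epsilon>' then A else {})"
  using P_side_inject[OF assms] by auto

lemma openin_K_topology_image:
  assumes "\<epsilon> \<in> {1, -1}" "open A" shows "openin (K_topology \<delta>) (P_side \<delta> \<epsilon> ` A)"
  unfolding openin_K_topology
  using assms P_side_in_K_side by (intro conjI ballI) (auto simp: vimage_P_side_image)

lemma closedin_K_topology_image:
  assumes "\<epsilon> \<in> {1, -1}" "closed A" shows "closedin (K_topology \<delta>) (P_side \<delta> \<epsilon> ` A)"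
proof -
  have "K_side \<delta> - P_side \<delta> \<epsilon> ` A = P_side \<delta> \<epsilon> ` (- A) \<union> P_side \<delta> (- \<epsilon>) ` UNIV"
    using assms(1) by (auto simp: K_side_def P_side_inject)
  moreover have "openin (K_topology \<delta>) (P_side \<delta> \<epsilon> ` (- A) \<union> P_side \<delta> (- \<epsilon>) ` UNIV)"
    using assms by (intro openin_Un openin_K_topology_image) auto
  moreover have "P_side \<delta> \<epsilon> ` A \<subseteq> K_side \<delta>" using assms(1) P_side_in_K_side by blast
  ultimately show ?thesis by (simp add: closedin_def)
qed

lemma continuous_map_P_side:
  assumes "\<epsilon> \<in> {1, -1}" shows "continuous_map euclidean (K_topology \<delta>) (P_side \<delta> \<epsilon>)"
  unfolding continuous_map_def
  using assms P_side_in_K_side by (auto simp: openin_K_topology vimage_def)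

lemma measurable_enc_K: "enc \<delta> \<in> measurable isometry_measure (borel_of (K_topology \<delta>))"
  using continuous_map_measurable[OF continuous_map_P_side[of _ \<delta>]]
  by (intro measurable_isometryI) (simp add: borel_of_euclidean)

lemma measurable_dec_K: "dec \<delta> \<in> measurable (borel_of (K_topology \<delta>)) isometry_measure"
proof -
  let ?T = "borel_of (K_topology \<delta>)"
  have dec: "dec \<delta> (P_side \<delta> \<epsilon> a) = (\<epsilon>, a)" if "\<epsilon> \<in> {1, -1}" for \<epsilon> a
    using dec_enc[of "(\<epsilon>, a)" \<delta>] that by simp
  have "(\<lambda>p. fst (dec \<delta> p)) \<in> measurable ?T (count_space {1, -1})"
    unfolding measurable_count_space_eq2[OF finite.insertI[OF finite.insertI[OF finite.emptyI]]]
  proof (intro conjI ballI)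
    show "(\<lambda>p. fst (dec \<delta> p)) \<in> space ?T \<rightarrow> {1, -1}"
      using dec_in_space by fastforce
    fix \<epsilon> :: int assume e: "\<epsilon> \<in> {1, -1}"
    have "(\<lambda>p. fst (dec \<delta> p)) -` {\<epsilon>} \<inter> space ?T = P_side \<delta> \<epsilon> ` UNIV"
      using e by (auto simp: K_side_def dec)
    then show "(\<lambda>p. fst (dec \<delta> p)) -` {\<epsilon>} \<inter> space ?T \<in> sets ?T"
      using openin_borel_of[OF openin_K_topology_image[OF e open_UNIV]] by simp
  qed
  moreover have "(\<lambda>p. snd (dec \<delta> p)) \<in> borel_measurable ?T"
  proof (rule borel_measurableI)
    fix U :: "circle set" assume U: "open U"
    have "(\<lambda>p. snd (dec \<delta> p)) -` U \<inter> space ?T = P_side \<delta> 1 ` U \<union> P_side \<delta> (-1) ` U"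
      by (auto simp: K_side_def dec)
    then show "(\<lambda>p. snd (dec \<delta> p)) -` U \<inter> space ?T \<in> sets ?T"
      using U by (simp add: openin_borel_of openin_Un openin_K_topology_image)
  qed
  ultimately have "(\<lambda>p. (fst (dec \<delta> p), snd (dec \<delta> p))) \<in> measurable ?T (count_space {1, -1} \<Otimes>\<^sub>M borel)"
    by (rule measurable_Pair)
  then show ?thesis by (simp add: measurable_cong_sets[OF refl sets_isometry_measure])
qed

definition K_haar :: "sign \<Rightarrow> (split_circle \<Rightarrow> split_circle) measure" where
  "K_haar \<delta> = distr isometry_measure (borel_of (K_topology \<delta>)) (enc \<delta>)"

lemma emeasure_distr_enc:
  assumes "enc \<delta> \<in> measurable isometry_measure N" "B \<in> sets N"
  shows "emeasure (distr isometry_measure N (enc \<delta>)) B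
    = ennreal (1/2) * (emeasure arc_length (P_side \<delta> 1 -` B) + emeasure arc_length (P_side \<delta> (-1) -` B))"
proof -
  have "Pair \<epsilon> -` (enc \<delta> -` B \<inter> space isometry_measure) = P_side \<delta> \<epsilon> -` B" if "\<epsilon> \<in> {1, -1}" for \<epsilon>
    using that by auto
  then show ?thesis
    using emeasure_isometry_measure[OF measurable_sets[OF assms]] by (simp add: emeasure_distr[OF assms])
qed

text \<open>Compact subsets of the two circles approximate each half of a Borel set separately.\<close>

lemma regular_distr_enc:
  assumes sets: "enc \<delta> \<in> measurable isometry_measure (borel_of T)"
    and approx: "\<And>B e. B \<in> sets (borel_of T) \<Longrightarrow> 0 < e \<Longrightarrow>
      \<exists>C. closedin T C \<and> compactin T C \<and> C \<subseteq> B \<and>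
        (\<forall>\<epsilon>\<in>{1, -1}. measure arc_length (P_side \<delta> \<epsilon> -` B) \<le> measure arc_length (P_side \<delta> \<epsilon> -` C) + e)"
  shows "regular_borel_prob T (distr isometry_measure (borel_of T) (enc \<delta>))" (is "regular_borel_prob T ?\<mu>")
proof (rule regular_borel_probI)
  interpret iso: prob_space isometry_measure by (rule prob_space_isometry_measure)
  show p: "prob_space ?\<mu>" by (rule iso.prob_space_distr[OF sets])
  then interpret \<mu>: prob_space ?\<mu> .
  have meas: "measure ?\<mu> B = 1/2 * (measure arc_length (P_side \<delta> 1 -` B) + measure arc_length (P_side \<delta> (-1) -` B))"
    if "B \<in> sets (borel_of T)" for B
  proof -
    have "ennreal (measure ?\<mu> B) = ennreal (1/2) *
        (ennreal (measure arc_length (P_side \<delta> 1 -` B)) + ennreal (measure arc_length (P_side \<delta> (-1) -` B)))"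
      using emeasure_distr_enc[OF sets that] by (simp only: \<mu>.emeasure_eq_measure arc_length.emeasure_eq_measure)
    also have "\<dots> = ennreal (1/2 * (measure arc_length (P_side \<delta> 1 -` B) + measure arc_length (P_side \<delta> (-1) -` B)))"
      by (subst ennreal_mult) (simp_all add: ennreal_plus)
    finally show ?thesis by (subst (asm) ennreal_inj) (simp_all add: add_nonneg_nonneg)
  qed
  fix B and e :: real assume B: "B \<in> sets ?\<mu>" and e: "0 < e"
  from B have B': "B \<in> sets (borel_of T)" by simp
  obtain C where C: "closedin T C" "compactin T C" "C \<subseteq> B"
      "\<forall>\<epsilon>\<in>{1, -1}. measure arc_length (P_side \<delta> \<epsilon> -` B) \<le> measure arc_length (P_side \<delta> \<epsilon> -` C) + e"
    using approx[OF B' e] by auto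
  have "measure arc_length (P_side \<delta> \<epsilon> -` B) \<le> measure arc_length (P_side \<delta> \<epsilon> -` C) + e" if "\<epsilon> \<in> {1, -1}" for \<epsilon>
    using C(4) that by (rule bspec)
  then have "measure arc_length (P_side \<delta> 1 -` B) \<le> measure arc_length (P_side \<delta> 1 -` C) + e"
    "measure arc_length (P_side \<delta> (-1) -` B) \<le> measure arc_length (P_side \<delta> (-1) -` C) + e" by blast+
  moreover have "1/2 * (x + y) \<le> 1/2 * (x' + y') + e" if "x \<le> x' + e" "y \<le> y' + e" for x y x' y' :: real
    using that by (simp add: field_simps)
  ultimately have "measure ?\<mu> B \<le> measure ?\<mu> C + e"
    unfolding meas[OF B'] meas[OF closedin_borel_of[OF C(1)]] by blast
  then show "\<exists>C. closedin T C \<and> compactin T C \<and> C \<subseteq> B \<and> measure ?\<mu> B \<le> measure ?\<mu> C + e"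
    using C(1-3) by auto
qed simp

lemma arc_length_inner:
  assumes "A \<in> sets borel" "0 < e"
  obtains C where "closed C" "compact C" "C \<subseteq> A" "measure arc_length A \<le> measure arc_length C + e"
proof -
  have "A \<in> sets arc_length" using assms(1) by simp
  then obtain C where "closedin euclidean C" "compactin euclidean C" "C \<subseteq> A"
      "measure arc_length A \<le> measure arc_length C + e"
    by (rule regular_borel_prob_inner[OF regular_arc_length _ assms(2)])
  then show thesis by (intro that[of C]) simp_all
qed

lemma regular_K_haar: "regular_borel_prob (K_topology \<delta>) (K_haar \<delta>)"
  unfolding K_haar_def
proof (rule regular_distr_enc[OF measurable_enc_K])
  fix B and e :: real assume B: "B \<in> sets (borel_of (K_topology \<delta>))" and e: "0 < e"
  have m: "P_side \<delta> \<epsilon> -` B \<in> sets borel" if "\<epsilon> \<in> {1, -1}" for \<epsilon>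
    using measurable_sets[OF continuous_map_measurable[OF continuous_map_P_side[OF that]] B]
    by (simp add: borel_of_euclidean)
  have "\<forall>\<epsilon>\<in>{1, -1}. \<exists>C. closed C \<and> compact C \<and> C \<subseteq> P_side \<delta> \<epsilon> -` B
      \<and> measure arc_length (P_side \<delta> \<epsilon> -` B) \<le> measure arc_length C + e"
  proof
    fix \<epsilon> :: int assume "\<epsilon> \<in> {1, -1}"
    obtain C where "closed C" "compact C" "C \<subseteq> P_side \<delta> \<epsilon> -` B"
        "measure arc_length (P_side \<delta> \<epsilon> -` B) \<le> measure arc_length C + e"
      by (rule arc_length_inner[OF m[OF \<open>\<epsilon> \<in> {1, -1}\<close>] e])
    then show "\<exists>C. closed C \<and> compact C \<and> C \<subseteq> P_side \<delta> \<epsilon> -` B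
      \<and> measure arc_length (P_side \<delta> \<epsilon> -` B) \<le> measure arc_length C + e" by blast
  qed
  from bchoice[OF this] obtain C where C: "\<And>\<epsilon>. \<epsilon> \<in> {1, -1} \<Longrightarrow> closed (C \<epsilon>) \<and> compact (C \<epsilon>)
      \<and> C \<epsilon> \<subseteq> P_side \<delta> \<epsilon> -` B \<and> measure arc_length (P_side \<delta> \<epsilon> -` B) \<le> measure arc_length (C \<epsilon>) + e"
    by auto
  define K where "K = P_side \<delta> 1 ` C 1 \<union> P_side \<delta> (-1) ` C (-1)"
  have vK: "P_side \<delta> \<epsilon> -` K = C \<epsilon>" if "\<epsilon> \<in> {1, -1}" for \<epsilon>
    using that by (auto simp: K_def vimage_Un vimage_P_side_image)
  have "closedin (K_topology \<delta>) K"
    unfolding K_def using C by (intro closedin_Un closedin_K_topology_image) auto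
  moreover have "compactin (K_topology \<delta>) K"
    unfolding K_def using C
    by (intro compactin_Un image_compactin[OF _ continuous_map_P_side]) auto
  moreover have "K \<subseteq> B" unfolding K_def using C[of 1] C[of "-1"] by auto
  moreover have "\<forall>\<epsilon>\<in>{1, -1}. measure arc_length (P_side \<delta> \<epsilon> -` B) \<le> measure arc_length (P_side \<delta> \<epsilon> -` K) + e"
    using C vK by auto
  ultimately show "\<exists>C. closedin (K_topology \<delta>) C \<and> compactin (K_topology \<delta>) C \<and> C \<subseteq> B \<and>
      (\<forall>\<epsilon>\<in>{1, -1}. measure arc_length (P_side \<delta> \<epsilon> -` B) \<le> measure arc_length (P_side \<delta> \<epsilon> -` C) + e)"
    by blast
qed

text \<open>Composition is multiplication of isometries in the coordinates \<open>enc \<delta>\<close>, so uniqueness can be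
  transported from the isometry group.\<close>

theorem haar_measure_K_topology: "haar_measure (K_topology \<delta>) (\<circ>) = K_haar \<delta>"
  unfolding haar_measure_def topspace_K_topology
proof (rule the_equality)
  let ?S = isometry_measure and ?T = "borel_of (K_topology \<delta>)"
  have mult: "k \<circ> p = enc \<delta> (isometry_mult (dec \<delta> k) (dec \<delta> p))" if "k \<in> K_side \<delta>" "p \<in> K_side \<delta>" for k p
    using enc_comp[OF dec_in_space[OF that(1)] dec_in_space[OF that(2)], of \<delta> \<delta>] that by (simp add: enc_dec)
  have meas: "(\<circ>) k \<in> measurable ?T ?T" if k: "k \<in> K_side \<delta>" for k
  proof -
    have "(\<lambda>p. enc \<delta> (isometry_mult (dec \<delta> k) (dec \<delta> p))) \<in> measurable ?T ?T"
      by (intro measurable_compose[OF measurable_dec_K] measurable_compose[OF measurable_isometry_mult_left]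
          measurable_enc_K dec_in_space k)
    also have "?this \<longleftrightarrow> (\<circ>) k \<in> measurable ?T ?T"
      by (rule measurable_cong) (simp add: mult[OF k])
    finally show ?thesis .
  qed
  have inv: "distr (K_haar \<delta>) ?T ((\<circ>) k) = K_haar \<delta>" if k: "k \<in> K_side \<delta>" for k
  proof -
    have "distr (K_haar \<delta>) ?T ((\<circ>) k) = distr ?S ?T ((\<circ>) k \<circ> enc \<delta>)"
      unfolding K_haar_def by (rule distr_distr[OF meas[OF k] measurable_enc_K])
    also have "\<dots> = distr ?S ?T (enc \<delta> \<circ> isometry_mult (dec \<delta> k))"
      using mult[OF k enc_in_K_side] by (intro distr_cong refl) (simp add: dec_enc del: space_isometry_measure)
    also have "\<dots> = distr (distr ?S ?S (isometry_mult (dec \<delta> k))) ?T (enc \<delta>)"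
      by (rule distr_distr[OF measurable_enc_K measurable_isometry_mult_left[OF dec_in_space[OF k]], symmetric])
    also have "\<dots> = K_haar \<delta>"
      by (simp only: isometry_measure_left[OF dec_in_space[OF k]] K_haar_def)
    finally show ?thesis .
  qed
  have sets_K: "sets (K_haar \<delta>) = sets ?T" by (simp add: K_haar_def)
  have "invariant_measure ((\<circ>) ` K_side \<delta>) (K_haar \<delta>)"
    unfolding invariant_measure_def
  proof
    fix f :: "(split_circle \<Rightarrow> split_circle) \<Rightarrow> split_circle \<Rightarrow> split_circle"
    assume "f \<in> (\<circ>) ` K_side \<delta>"
    then obtain k where k: "k \<in> K_side \<delta>" "f = (\<circ>) k" by (rule imageE)
    show "f \<in> measurable (K_haar \<delta>) (K_haar \<delta>) \<and> distr (K_haar \<delta>) (K_haar \<delta>) f = K_haar \<delta>"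
      using meas[OF k(1)] inv[OF k(1)] distr_cong[OF refl sets_K refl, of "K_haar \<delta>"]
      by (simp add: k(2) measurable_cong_sets[OF sets_K sets_K])
  qed
  then show "regular_borel_prob (K_topology \<delta>) (K_haar \<delta>) \<and> invariant_measure ((\<circ>) ` K_side \<delta>) (K_haar \<delta>)"
    using regular_K_haar by simp
  fix \<mu> assume \<mu>: "regular_borel_prob (K_topology \<delta>) \<mu> \<and> invariant_measure ((\<circ>) ` K_side \<delta>) \<mu>"
  then have sets: "sets \<mu> = sets ?T" and space: "space \<mu> = K_side \<delta>" and "prob_space \<mu>"
    using regular_borel_probD[OF conjunct1[OF \<mu>]] by simp_all
  interpret prob_space \<mu> by fact
  have dec: "dec \<delta> \<in> measurable \<mu> ?S"
    using measurable_dec_K by (simp add: measurable_cong_sets[OF sets refl])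
  define N where "N = distr \<mu> ?S (dec \<delta>)"
  have "N = ?S"
  proof (rule left_invariant_eq_isometry_measure)
    show "prob_space N" unfolding N_def by (rule prob_space_distr[OF dec])
    show sets_N: "sets N = sets ?S" by (simp add: N_def)
    fix x assume x: "x \<in> space ?S"
    define k where "k = enc \<delta> x"
    have k: "k \<in> K_side \<delta>" "dec \<delta> k = x" using x by (simp_all add: k_def enc_in_K_side dec_enc del: space_isometry_measure)
    have k_meas: "(\<circ>) k \<in> measurable \<mu> \<mu>" and k_inv: "distr \<mu> \<mu> ((\<circ>) k) = \<mu>"
      using \<mu> k(1) by (auto simp: invariant_measure_def)
    have "distr N N (isometry_mult x) = distr N ?S (isometry_mult x)"
      by (rule distr_cong[OF refl sets_N refl])
    also have "\<dots> = distr \<mu> ?S (isometry_mult x \<circ> dec \<delta>)"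
      unfolding N_def by (rule distr_distr[OF measurable_isometry_mult_left[OF x] dec])
    also have "\<dots> = distr \<mu> ?S (dec \<delta> \<circ> (\<circ>) k)"
    proof (intro distr_cong refl)
      fix p assume "p \<in> space \<mu>"
      then have p: "p \<in> K_side \<delta>" by (simp add: space)
      then show "(isometry_mult x \<circ> dec \<delta>) p = (dec \<delta> \<circ> (\<circ>) k) p"
        using mult[OF k(1) p] isometry_mult_in_space[OF x dec_in_space[OF p]]
        by (simp add: k(2) dec_enc del: space_isometry_measure)
    qed
    also have "\<dots> = distr (distr \<mu> \<mu> ((\<circ>) k)) ?S (dec \<delta>)"
      by (rule distr_distr[OF dec k_meas, symmetric])
    also have "\<dots> = N" by (simp add: k_inv N_def)
    finally show "distr N N (isometry_mult x) = N" .
  qed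
  have "K_haar \<delta> = distr N ?T (enc \<delta>)" by (simp add: K_haar_def \<open>N = ?S\<close>)
  also have "\<dots> = distr \<mu> ?T (enc \<delta> \<circ> dec \<delta>)"
    unfolding N_def by (rule distr_distr[OF measurable_enc_K dec])
  also have "\<dots> = distr \<mu> \<mu> (\<lambda>p. p)"
    by (rule distr_cong) (simp_all add: sets space enc_dec)
  also have "\<dots> = \<mu>" by (rule distr_id)
  finally show "\<mu> = K_haar \<delta>" by simp
qed

section \<open>The \<open>\<tau>\<close>-topology\<close>

text \<open>Each of the two circles is open, so closures are formed in each of them separately.\<close>

lemma closure_of_K_topology:
  assumes "\<epsilon> \<in> {1, -1}"
  shows "P_side \<delta> \<epsilon> a \<in> K_topology \<delta> closure_of A \<longleftrightarrow> a \<in> closure (P_side \<delta> \<epsilon> -` A)"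
proof
  assume cl: "P_side \<delta> \<epsilon> a \<in> K_topology \<delta> closure_of A"
  show "a \<in> closure (P_side \<delta> \<epsilon> -` A)"
    unfolding closure_iff_nhds_not_empty
  proof (intro allI impI)
    fix B V assume V: "V \<subseteq> B" "open V" "a \<in> V"
    have "\<exists>q. q \<in> A \<and> q \<in> P_side \<delta> \<epsilon> ` V"
      using cl openin_K_topology_image[OF assms V(2), of \<delta>] V(3) unfolding in_closure_of by blast
    then show "P_side \<delta> \<epsilon> -` A \<inter> B \<noteq> {}" using V(1) by auto
  qed
next
  assume cl: "a \<in> closure (P_side \<delta> \<epsilon> -` A)"
  show "P_side \<delta> \<epsilon> a \<in> K_topology \<delta> closure_of A"
    unfolding in_closure_of topspace_K_topology
  proof (intro conjI allI impI P_side_in_K_side assms)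
    fix U assume U: "P_side \<delta> \<epsilon> a \<in> U \<and> openin (K_topology \<delta>) U"
    then have "open (P_side \<delta> \<epsilon> -` U)" "a \<in> P_side \<delta> \<epsilon> -` U" using assms by (auto simp: openin_K_topology)
    then have "P_side \<delta> \<epsilon> -` U \<inter> P_side \<delta> \<epsilon> -` A \<noteq> {}"
      using cl open_Int_closure_eq_empty[of "P_side \<delta> \<epsilon> -` U" "P_side \<delta> \<epsilon> -` A"] by blast
    then show "\<exists>q. q \<in> A \<and> q \<in> U" by auto
  qed
qed

lemma topology_eq_closure:
  assumes "topspace S = topspace T" "\<And>A. A \<subseteq> topspace T \<Longrightarrow> S closure_of A = T closure_of A"
  shows "S = T"
proof -
  have "closedin S A \<longleftrightarrow> closedin T A" for A
  proof (cases "A \<subseteq> topspace T")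
    case True
    then show ?thesis
      using assms(2)[OF True] closure_of_eq[of S A] closure_of_eq[of T A] by simp
  next
    case False
    then show ?thesis using closedin_subset[of S A] closedin_subset[of T A] assms(1) by auto
  qed
  then have "openin S U \<longleftrightarrow> openin T U" for U
    by (simp add: openin_closedin_eq assms(1))
  then show ?thesis by (simp add: topology_eq)
qed

lemma tendsto_pt_eval:
  fixes f :: "'i \<Rightarrow> split_circle \<Rightarrow> split_circle"
  assumes "(f \<longlongrightarrow> p) F" shows "((\<lambda>i. pt (f i x)) \<longlongrightarrow> pt (p x)) F"
proof -
  have "((\<lambda>i. f i x) \<longlongrightarrow> p x) F" using assms by (simp add: tendsto_fun_iff)
  moreover have "isCont pt (p x)" using continuous_on_pt by (simp add: continuous_on_eq_continuous_at)
  ultimately show ?thesis using isCont_tendsto_compose by blast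
qed

context dense_flow
begin

text \<open>If \<open>g \<rightarrow> u\<close> and \<open>g \<circ> k \<rightarrow> P_side \<delta> \<epsilon> a\<close>, then the orientations of \<open>g\<close> and \<open>k\<close> are eventually \<open>1\<close> and
  \<open>\<epsilon>\<close>, and the translation part of \<open>k\<close>, a difference of base points, tends to \<open>a\<close>.\<close>

lemma circle_op_imp_closure:
  assumes A: "A \<subseteq> K_side \<delta>" and \<epsilon>: "\<epsilon> \<in> {1, -1}" and q: "P_side \<delta> \<epsilon> a \<in> circle_op G (P_side \<delta> 1 0) A"
  shows "a \<in> closure (P_side \<delta> \<epsilon> -` A)"
  unfolding closure_iff_nhds_not_empty
proof (intro allI impI)
  fix B V assume V: "V \<subseteq> B" "open V" "a \<in> V"
  obtain F where F: "F \<noteq> bot" "eventually (\<lambda>(g, k). g \<in> G \<and> k \<in> A) F"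
      "((\<lambda>(g, k). g) \<longlongrightarrow> P_side \<delta> 1 0) F" "((\<lambda>(g, k). g \<circ> k) \<longlongrightarrow> P_side \<delta> \<epsilon> a) F"
    using q unfolding circle_op_def by blast
  let ?o = "Split 0 Plus" and ?q = "Split quarter Plus"
  have g: "((\<lambda>z. pt (fst z x)) \<longlongrightarrow> pt (P_side \<delta> 1 0 x)) F" for x
    using tendsto_pt_eval[OF F(3), of x] by (simp add: case_prod_unfold)
  have gk: "((\<lambda>z. pt (fst z (snd z x))) \<longlongrightarrow> pt (P_side \<delta> \<epsilon> a x)) F" for x
    using tendsto_pt_eval[OF F(4), of x] by (simp add: case_prod_unfold)
  have "((\<lambda>z. pt (fst z ?q) - pt (fst z ?o)) \<longlongrightarrow> quarter) F"
    using tendsto_diff[OF g[of ?q] g[of ?o]] by simp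
  moreover have "((\<lambda>z. pt (fst z (snd z ?q)) - pt (fst z (snd z ?o))) \<longlongrightarrow> int_mult \<epsilon> quarter) F"
    using tendsto_diff[OF gk[of ?q] gk[of ?o]] by simp
  moreover have "((\<lambda>z. pt (fst z (snd z ?o)) - pt (fst z ?o)) \<longlongrightarrow> a) F"
    using tendsto_diff[OF gk[of ?o] g[of ?o]] by simp
  moreover have "open (- {- quarter})" "open (- {- int_mult \<epsilon> quarter})" by auto
  moreover have nq: "quarter \<noteq> - quarter" using int_mult_quarter_inj[of 1 "-1"] by auto
  then have "quarter \<in> - {- quarter}" "int_mult \<epsilon> quarter \<in> - {- int_mult \<epsilon> quarter}" using \<epsilon> by auto
  ultimately have "eventually (\<lambda>z. pt (fst z ?q) - pt (fst z ?o) \<in> - {- quarter}) F"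
    "eventually (\<lambda>z. pt (fst z (snd z ?q)) - pt (fst z (snd z ?o)) \<in> - {- int_mult \<epsilon> quarter}) F"
    "eventually (\<lambda>z. pt (fst z (snd z ?o)) - pt (fst z ?o) \<in> V) F"
    using V(2,3) by (auto dest: topological_tendstoD)
  with F(2) have "eventually (\<lambda>z. fst z \<in> G \<and> snd z \<in> A \<and> pt (fst z ?q) - pt (fst z ?o) \<noteq> - quarter \<and>
      pt (fst z (snd z ?q)) - pt (fst z (snd z ?o)) \<noteq> - int_mult \<epsilon> quarter \<and>
      pt (fst z (snd z ?o)) - pt (fst z ?o) \<in> V) F"
    by eventually_elim auto
  then obtain z where z: "fst z \<in> G" "snd z \<in> A" "pt (fst z ?q) - pt (fst z ?o) \<noteq> - quarter"
      "pt (fst z (snd z ?q)) - pt (fst z (snd z ?o)) \<noteq> - int_mult \<epsilon> quarter"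
      "pt (fst z (snd z ?o)) - pt (fst z ?o) \<in> V"
    using eventually_happens'[OF F(1)] by blast
  obtain \<epsilon>' d where g': "\<epsilon>' \<in> {1, -1}" "fst z = P_map \<epsilon>' d" using z(1) by (auto simp: G_eq)
  have "snd z \<in> K_side \<delta>" using z(2) A by blast
  then obtain \<epsilon>'' b where k': "\<epsilon>'' \<in> {1, -1}" "snd z = P_side \<delta> \<epsilon>'' b" by (auto simp: K_side_def)
  have "\<epsilon>' = 1" using z(3) g' by auto
  have "\<epsilon>'' = \<epsilon>" using z(4) g' k' \<epsilon> \<open>\<epsilon>' = 1\<close> by auto
  have "b \<in> V" using z(5) g' k' \<open>\<epsilon>' = 1\<close> by simp
  then show "P_side \<delta> \<epsilon> -` A \<inter> B \<noteq> {}"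
    using V(1) z(2) k'(2) \<open>\<epsilon>'' = \<epsilon>\<close> by auto
qed

text \<open>Conversely, a shift by \<open>u \<rightarrow> 0\<close> from the side \<open>\<delta>\<close> overrides perturbations \<open>r u\<close> of \<open>a\<close> by less than
  \<open>\<bar>u\<bar>\<close>; so the one-sided topology of the maps \<open>P_side\<close> becomes the two-sided one of the circle.\<close>

lemma closure_imp_circle_op:
  assumes \<epsilon>: "\<epsilon> \<in> {1, -1}" and a: "a \<in> closure (P_side \<delta> \<epsilon> -` A)"
  shows "P_side \<delta> \<epsilon> a \<in> circle_op G (P_side \<delta> 1 0) A"
proof -
  obtain r0 where r0: "a = abs_circle r0" by (rule abs_circle_cases)
  have "\<exists>r. \<bar>r - r0\<bar> < \<bar>u\<bar> \<and> P_side \<delta> \<epsilon> (abs_circle r) \<in> A" if "u \<noteq> 0" for u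
  proof -
    let ?V = "abs_circle ` ball r0 \<bar>u\<bar>"
    have "open ?V" by (intro open_abs_circle_image) simp
    moreover have "a \<in> ?V" using that by (simp add: r0)
    ultimately have "?V \<inter> P_side \<delta> \<epsilon> -` A \<noteq> {}"
      using a open_Int_closure_eq_empty[of ?V "P_side \<delta> \<epsilon> -` A"] by blast
    then obtain r where "r \<in> ball r0 \<bar>u\<bar>" "P_side \<delta> \<epsilon> (abs_circle r) \<in> A" by auto
    then show ?thesis by (intro exI[of _ r]) (simp add: dist_real_def abs_minus_commute)
  qed
  then obtain r where r: "\<And>u. u \<noteq> 0 \<Longrightarrow> \<bar>r u - r0\<bar> < \<bar>u\<bar>"
      "\<And>u. u \<noteq> 0 \<Longrightarrow> P_side \<delta> \<epsilon> (abs_circle (r u)) \<in> A"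
    by metis
  define L where "L = (case \<delta> of Plus \<Rightarrow> at_right 0 | Minus \<Rightarrow> at_left (0 :: real))"
  define L' where "L' = inf L (principal {u. abs_circle u \<in> D})"
  \<comment> \<open>the net of pairs, indexed by shifts \<open>u\<close> that belong to the group\<close>
  define F where "F = filtermap (\<lambda>u. (P_map 1 (abs_circle u), P_side \<delta> \<epsilon> (abs_circle (r u)))) L'"
  have "L' \<le> L" by (simp add: L'_def)
  have side0: "side \<delta> 0 = filtermap abs_circle L" by (simp add: side_def L_def)
  have "L' \<noteq> bot"
  proof
    assume "L' = bot"
    then have "eventually (\<lambda>u. abs_circle u \<notin> D) L"
      unfolding L'_def trivial_limit_def eventually_inf_principal by simp
    then have "eventually (\<lambda>t. t \<notin> D) (side \<delta> 0)" by (simp add: side0 eventually_filtermap)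
    from dense_side[OF this] show False by simp
  qed
  have nz: "eventually (\<lambda>u. u \<noteq> 0) L"
    by (cases \<delta>) (auto simp: L_def eventually_at_filter)
  have D: "eventually (\<lambda>u. abs_circle u \<in> D \<and> u \<noteq> 0) L'"
    using nz unfolding L'_def eventually_inf_principal by (auto elim: eventually_mono)
  have lim0: "filterlim abs_circle (side \<delta> 0) L'"
    unfolding filterlim_def side0 using \<open>L' \<le> L\<close> by (rule filtermap_mono)
  have "filterlim (\<lambda>u. abs_circle (r u) + abs_circle u) (side \<delta> a) L"
    unfolding filterlim_iff
  proof (intro allI impI)
    fix P assume P: "eventually P (side \<delta> a)"
    show "eventually (\<lambda>u. P (abs_circle (r u) + abs_circle u)) L"
    proof (cases \<delta>)
      case Plus
      obtain h where h: "h > 0" "\<forall>u. 0 < u \<and> u < h \<longrightarrow> P (a + abs_circle u)"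
        using P unfolding Plus eventually_side_Plus by blast
      have "P (abs_circle (r u) + abs_circle u)" if "0 < u" "u < h / 2" for u
      proof -
        have "0 < r u - r0 + u" "r u - r0 + u < h" using r(1)[of u] that by linarith+
        then have "P (a + abs_circle (r u - r0 + u))" using h(2) by blast
        then show ?thesis by (simp add: r0 flip: abs_circle_add)
      qed
      then show ?thesis
        using h(1) unfolding L_def Plus by (auto simp: eventually_at_right_field intro: exI[of _ "h / 2"])
    next
      case Minus
      obtain h where h: "h > 0" "\<forall>u. 0 < u \<and> u < h \<longrightarrow> P (a - abs_circle u)"
        using P unfolding Minus eventually_side_Minus by blast
      have "P (abs_circle (r u) + abs_circle u)" if "u < 0" "- (h / 2) < u" for u
      proof -
        have "0 < r0 - r u - u" "r0 - r u - u < h" using r(1)[of u] that by linarith+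
        then have "P (a - abs_circle (r0 - r u - u))" using h(2) by blast
        then show ?thesis by (simp add: r0 flip: abs_circle_add abs_circle_diff) 
      qed
      then show ?thesis
        using h(1) unfolding L_def Minus by (auto simp: eventually_at_left_field intro: exI[of _ "- (h / 2)"])
    qed
  qed
  then have lim: "filterlim (\<lambda>u. abs_circle (r u) + abs_circle u) (side \<delta> a) L'"
    using \<open>L' \<le> L\<close> by (rule filterlim_mono[OF _ order_refl])
  have "F \<noteq> bot" using \<open>L' \<noteq> bot\<close> by (simp add: F_def filtermap_bot_iff)
  moreover have "eventually (\<lambda>(g, k). g \<in> G \<and> k \<in> A) F"
    unfolding F_def eventually_filtermap using D
  proof eventually_elim
    case (elim u)
    then show ?case using r(2)[of u] by (auto simp: G_eq)
  qed
  moreover have "((\<lambda>(g, k). g) \<longlongrightarrow> P_side \<delta> 1 0) F"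
    unfolding F_def filterlim_filtermap
    using filterlim_compose[OF tendsto_P_map lim0] by simp
  moreover have "((\<lambda>(g, k). g \<circ> k) \<longlongrightarrow> P_side \<delta> \<epsilon> a) F"
    unfolding F_def filterlim_filtermap
    using filterlim_compose[OF tendsto_P_side lim] \<epsilon> by (simp add: P_map_P_side)
  ultimately show ?thesis
    using P_side_in_E[OF \<epsilon>] unfolding circle_op_def by blast
qed

theorem tau_topology_eq: "tau_topology G (P_side \<delta> 1 0) (K_side \<delta>) = K_topology \<delta>"
proof -
  have cl: "K_topology \<delta> closure_of A = K_side \<delta> \<inter> circle_op G (P_side \<delta> 1 0) A" if A: "A \<subseteq> K_side \<delta>" for A
  proof -
    have "p \<in> K_topology \<delta> closure_of A \<longleftrightarrow> p \<in> circle_op G (P_side \<delta> 1 0) A" if p: "p \<in> K_side \<delta>" for p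
    proof -
      obtain \<epsilon> a where pe: "\<epsilon> \<in> {1, -1}" "p = P_side \<delta> \<epsilon> a" using p by (auto simp: K_side_def)
      show ?thesis
        unfolding pe(2) closure_of_K_topology[OF pe(1)]
        using circle_op_imp_closure[OF A pe(1)] closure_imp_circle_op[OF pe(1)] by blast
    qed
    moreover have "K_topology \<delta> closure_of A \<subseteq> K_side \<delta>"
      using closure_of_subset_topspace[of "K_topology \<delta>" A] by simp
    ultimately show ?thesis by blast
  qed
  show ?thesis
    unfolding tau_topology_def
  proof (rule the_equality)
    show "topspace (K_topology \<delta>) = K_side \<delta> \<and>
        (\<forall>A. A \<subseteq> K_side \<delta> \<longrightarrow> K_topology \<delta> closure_of A = K_side \<delta> \<inter> circle_op G (P_side \<delta> 1 0) A)"
      using cl by simp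
    fix T assume T: "topspace T = K_side \<delta> \<and>
        (\<forall>A. A \<subseteq> K_side \<delta> \<longrightarrow> T closure_of A = K_side \<delta> \<inter> circle_op G (P_side \<delta> 1 0) A)"
    show "T = K_topology \<delta>"
      by (rule topology_eq_closure) (use T cl in simp_all)
  qed
qed

theorem ellis_haar_eq: "ellis_haar G (P_side \<delta> 1 0) (K_side \<delta>) = K_haar \<delta>"
  by (simp add: ellis_haar_def tau_topology_eq haar_measure_K_topology)

section \<open>The decompression\<close>

abbreviation E :: "(split_circle \<Rightarrow> split_circle) set" where
  "E \<equiv> enveloping_semigroup G"

lemma compact_E: "compact E"
proof -
  have "compact_space (euclidean :: split_circle topology)"
    by (simp add: compact_space_def compact_split_circle)
  then have "compact_space (product_topology (\<lambda>_ :: split_circle. euclidean :: split_circle topology) UNIV)"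
    by (simp only: compact_space_product_topology) simp
  then have "compact (UNIV :: (split_circle \<Rightarrow> split_circle) set)"
    by (simp add: euclidean_product_topology compact_space_def)
  then show ?thesis
    unfolding enveloping_semigroup_def by (metis closed_closure compact_Int_closed inf_top_left)
qed

lemma closed_E: "closed E"
  by (simp add: enveloping_semigroup_def)

lemma two_sided_E: "\<epsilon> \<in> {1, -1} \<Longrightarrow> two_sided (top_of_set E) (\<lambda>\<rho>. P_side \<rho> \<epsilon>)"
  by (rule two_sided_P_side) (rule P_side_in_E)

lemma measurable_enc_E: "enc \<delta> \<in> measurable isometry_measure (borel_of (top_of_set E))"
  using two_sided_measurable[OF two_sided_E] by (intro measurable_isometryI) simp

definition \<mu>_E :: "sign \<Rightarrow> (split_circle \<Rightarrow> split_circle) measure" where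
  "\<mu>_E \<delta> = distr isometry_measure (borel_of (top_of_set E)) (enc \<delta>)"

lemma sets_\<mu>_E [simp]: "sets (\<mu>_E \<delta>) = sets (borel_of (top_of_set E))"
  by (simp add: \<mu>_E_def)

lemma space_\<mu>_E [simp]: "space (\<mu>_E \<delta>) = E"
  by (simp add: \<mu>_E_def)

lemma prob_space_\<mu>_E: "prob_space (\<mu>_E \<delta>)"
  unfolding \<mu>_E_def by (rule prob_space.prob_space_distr[OF prob_space_isometry_measure measurable_enc_E])

text \<open>The two sides differ on countably many angles in every Borel set.\<close>

lemma \<mu>_E_independent: "\<mu>_E \<delta> = \<mu>_E \<rho>"
proof (rule measure_eqI)
  fix B assume "B \<in> sets (\<mu>_E \<delta>)"
  then have B: "B \<in> sets (borel_of (top_of_set E))" by simp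
  show "emeasure (\<mu>_E \<delta>) B = emeasure (\<mu>_E \<rho>) B"
    unfolding \<mu>_E_def emeasure_distr_enc[OF measurable_enc_E B]
    using two_sided_emeasure[OF two_sided_E B, of _ \<delta> \<rho>] by simp
qed simp

text \<open>A compact set of angles at which \<open>B\<close> contains the limit maps of both signs, and which avoids
  the countable set \<open>D\<close>, has a closed preimage in \<open>E\<close> that lies in \<open>B\<close>.\<close>

lemma regular_\<mu>_E: "regular_borel_prob (top_of_set E) (\<mu>_E \<delta>)"
  unfolding \<mu>_E_def
proof (rule regular_distr_enc[OF measurable_enc_E])
  fix B and e :: real assume B: "B \<in> sets (borel_of (top_of_set E))" and e: "0 < e"
  let ?o = "Split 0 Plus" and ?q = "Split quarter Plus"
  have "\<forall>\<epsilon>\<in>{1, -1}. \<exists>C. closed C \<and> (\<forall>a\<in>C. a \<notin> D \<and> (\<forall>\<rho>. P_side \<rho> \<epsilon> a \<in> B))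
      \<and> measure arc_length (P_side \<delta> \<epsilon> -` B) \<le> measure arc_length C + e"
  proof
    fix \<epsilon> :: int assume \<epsilon>: "\<epsilon> \<in> {1, -1}"
    note ts = two_sided_borel[OF two_sided_E[OF \<epsilon>] B]
    define N where "N = {a. (P_side Plus \<epsilon> a \<in> B) \<noteq> (P_side Minus \<epsilon> a \<in> B)} \<union> D"
    have "countable N" using ts countable_D by (simp add: N_def)
    then have N: "N \<in> null_sets arc_length"
      by (intro null_setsI emeasure_arc_length_countable) (simp_all add: sets.countable)
    have m: "P_side \<delta> \<epsilon> -` B \<in> sets borel" using ts by blast
    then have "P_side \<delta> \<epsilon> -` B - N \<in> sets borel" using N by (auto simp: null_sets_def)
    then obtain C where C: "closed C" "compact C" "C \<subseteq> P_side \<delta> \<epsilon> -` B - N"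
        "measure arc_length (P_side \<delta> \<epsilon> -` B - N) \<le> measure arc_length C + e"
      by (rule arc_length_inner[OF _ e])
    have "measure arc_length (P_side \<delta> \<epsilon> -` B - N) = measure arc_length (P_side \<delta> \<epsilon> -` B)"
      using m N by (simp add: measure_Diff_null_set)
    moreover have "a \<notin> D \<and> (\<forall>\<rho>. P_side \<rho> \<epsilon> a \<in> B)" if "a \<in> C" for a
    proof -
      have "a \<notin> N" "P_side \<delta> \<epsilon> a \<in> B" using C(3) that by auto
      then have "a \<notin> D" "P_side Plus \<epsilon> a \<in> B" "P_side Minus \<epsilon> a \<in> B"
        by (cases \<delta>; simp add: N_def)+
      then show ?thesis by (metis sign.exhaust)
    qed
    ultimately show "\<exists>C. closed C \<and> (\<forall>a\<in>C. a \<notin> D \<and> (\<forall>\<rho>. P_side \<rho> \<epsilon> a \<in> B))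
      \<and> measure arc_length (P_side \<delta> \<epsilon> -` B) \<le> measure arc_length C + e"
      using C(1,4) by (intro exI[of _ C]) simp
  qed
  from bchoice[OF this] obtain C where "\<forall>\<epsilon>\<in>{1, -1}. closed (C \<epsilon>) \<and>
      (\<forall>a\<in>C \<epsilon>. a \<notin> D \<and> (\<forall>\<rho>. P_side \<rho> \<epsilon> a \<in> B)) \<and>
      measure arc_length (P_side \<delta> \<epsilon> -` B) \<le> measure arc_length (C \<epsilon>) + e" ..
  note C = bspec[OF this]
  define H where "H \<epsilon> = {p. pt (p ?o) \<in> C \<epsilon>} \<inter> {p. pt (p ?q) - pt (p ?o) = int_mult \<epsilon> quarter}" for \<epsilon>
  define K where "K = E \<inter> (H 1 \<union> H (-1))"
  have "closed (H \<epsilon>)" if "\<epsilon> \<in> {1, -1}" for \<epsilon>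
  proof -
    have "closed {p :: split_circle \<Rightarrow> split_circle. pt (p ?o) \<in> C \<epsilon>}"
      using closed_vimage[OF _ continuous_on_pt_eval[of ?o]] C[OF that] by (simp add: vimage_def)
    moreover have "closed {p :: split_circle \<Rightarrow> split_circle. pt (p ?q) - pt (p ?o) = int_mult \<epsilon> quarter}"
      unfolding diff_conv_add_uminus by (intro closed_Collect_eq continuous_intros continuous_on_pt_eval)
    ultimately show ?thesis unfolding H_def by (rule closed_Int)
  qed
  then have "closed (H 1 \<union> H (-1))" by (intro closed_Un) auto
  then have Kcl: "closedin (top_of_set E) K" unfolding K_def by (rule closedin_closed_Int)
  have "compact K"
    unfolding K_def using compact_E \<open>closed (H 1 \<union> H (-1))\<close> by (rule compact_Int_closed)
  then have Kco: "compactin (top_of_set E) K" by (simp add: compactin_subtopology K_def)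
  have KB: "K \<subseteq> B"
  proof
    fix p assume "p \<in> K"
    then obtain \<epsilon> where p: "p \<in> E" "\<epsilon> \<in> {1, -1}" "p \<in> H \<epsilon>" by (auto simp: K_def)
    from p(1) have "p \<in> G \<or> (\<exists>\<rho>. p \<in> K_side \<rho>)" by (auto simp: enveloping_semigroup_eq)
    then show "p \<in> B"
    proof (elim disjE exE)
      assume "p \<in> G"
      then obtain \<epsilon>' d where "d \<in> D" "p = P_map \<epsilon>' d" by (auto simp: G_eq)
      then show ?thesis using p(3) C[OF p(2)] by (auto simp: H_def)
    next
      fix \<rho> assume "p \<in> K_side \<rho>"
      then obtain \<epsilon>' a where pe: "\<epsilon>' \<in> {1, -1}" "p = P_side \<rho> \<epsilon>' a" by (auto simp: K_side_def)
      have "int_mult \<epsilon>' quarter = int_mult \<epsilon> quarter" "a \<in> C \<epsilon>" using p(3) by (simp_all add: pe(2) H_def)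
      then show ?thesis using int_mult_quarter_inj[OF pe(1) p(2)] C[OF p(2)] pe(2) by simp
    qed
  qed
  have "measure arc_length (P_side \<delta> \<epsilon> -` B) \<le> measure arc_length (P_side \<delta> \<epsilon> -` K) + e"
    if \<epsilon>: "\<epsilon> \<in> {1, -1}" for \<epsilon>
  proof -
    have "C \<epsilon> \<subseteq> P_side \<delta> \<epsilon> -` K"
      using \<epsilon> P_side_in_E[OF \<epsilon>] by (auto simp: K_def H_def)
    moreover have "P_side \<delta> \<epsilon> -` K \<in> sets borel"
      using two_sided_borel[OF two_sided_E[OF \<epsilon>] closedin_borel_of[OF Kcl]] by blast
    ultimately have "measure arc_length (C \<epsilon>) \<le> measure arc_length (P_side \<delta> \<epsilon> -` K)"
      by (intro arc_length.finite_measure_mono) simp_all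
    then show ?thesis using C[OF \<epsilon>] by linarith
  qed
  then show "\<exists>C. closedin (top_of_set E) C \<and> compactin (top_of_set E) C \<and> C \<subseteq> B \<and>
      (\<forall>\<epsilon>\<in>{1, -1}. measure arc_length (P_side \<delta> \<epsilon> -` B) \<le> measure arc_length (P_side \<delta> \<epsilon> -` C) + e)"
    using Kcl Kco KB by blast
qed

lemma P_map_comp_E:
  assumes "\<epsilon> \<in> {1, -1}" "d \<in> D" "p \<in> E" shows "P_map \<epsilon> d \<circ> p \<in> E"
proof -
  have "(\<circ>) (P_map \<epsilon> d) ` closure G \<subseteq> closure G"
  proof (rule image_closure_subset)
    show "continuous_on (closure G) ((\<circ>) (P_map \<epsilon> d) :: (split_circle \<Rightarrow> split_circle) \<Rightarrow> _)"
      using continuous_on_comp_left[OF continuous_on_P_map[OF assms(1)]] by (rule continuous_on_subset) simp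
    show "(\<circ>) (P_map \<epsilon> d) ` G \<subseteq> closure G"
    proof (intro image_subsetI subsetD[OF closure_subset])
      fix g assume "g \<in> G"
      then obtain \<epsilon>' d' where g: "\<epsilon>' \<in> {1, -1}" "g = P_map \<epsilon>' d'" "d' \<in> D" by (auto simp: G_eq)
      have "int_mult \<epsilon> d' + d \<in> D" 
        using assms(1) add_D[OF g(3) assms(2)] add_D[OF uminus_D[OF g(3)] assms(2)] by auto
      moreover have "\<epsilon> * \<epsilon>' \<in> {1, -1}" using assms(1) g(1) by auto
      ultimately show "P_map \<epsilon> d \<circ> g \<in> G"
        unfolding g(2) P_map_comp[OF assms(1) g(1)] G_eq by blast
    qed
  qed simp
  then show ?thesis using assms(3) by (auto simp: enveloping_semigroup_def)
qed

text \<open>Pointwise convergence: restrict finitely many values to clopen arcs.\<close>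

lemma clopen_base_E:
  assumes "openin (top_of_set E) U" "p \<in> U"
  shows "\<exists>V. openin (top_of_set E) V \<and> closedin (top_of_set E) V \<and> p \<in> V \<and> V \<subseteq> U"
proof -
  obtain W where W: "open W" "U = E \<inter> W" using assms(1) by (auto simp: openin_open)
  have "openin (product_topology (\<lambda>_ :: split_circle. euclidean) UNIV) W"
    using W(1) by (simp add: euclidean_product_topology)
  from product_topology_open_contains_basis[OF this, of p]
  obtain X where X: "\<And>i. p i \<in> X i" "\<And>i. open (X i)" "finite {i. X i \<noteq> UNIV}" "Pi\<^sub>E UNIV X \<subseteq> W"
    using assms(2) W(2) by (auto simp: PiE_iff)
  have "\<exists>V. open V \<and> closed V \<and> p i \<in> V \<and> V \<subseteq> X i" for i
    by (rule clopen_base_split_circle[OF X(2,1)])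
  then obtain V where V: "\<And>i. open (V i)" "\<And>i. closed (V i)" "\<And>i. p i \<in> V i" "\<And>i. V i \<subseteq> X i" by metis
  define C where "C = (\<Inter>i\<in>{i. X i \<noteq> UNIV}. {q :: split_circle \<Rightarrow> split_circle. q i \<in> V i})"
  have "open {q :: split_circle \<Rightarrow> split_circle. q i \<in> V i}" "closed {q :: split_circle \<Rightarrow> split_circle. q i \<in> V i}" for i
    using open_vimage[OF V(1)[of i] continuous_on_product_coordinates[of i]]
      closed_vimage[OF V(2)[of i] continuous_on_product_coordinates[of i]] by (simp_all add: vimage_def)
  then have "open C" "closed C" unfolding C_def using X(3) by (auto intro: open_INT closed_INT)
  moreover have "C \<subseteq> W"
  proof
    fix q assume "q \<in> C"
    then have "q i \<in> X i" for i using V(4)[of i] by (cases "X i = UNIV") (auto simp: C_def)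
    then show "q \<in> W" using X(4) by (auto simp: PiE_iff)
  qed
  moreover have "p \<in> C" using V(3) by (simp add: C_def)
  ultimately show ?thesis
    using assms(2) W(2) by (intro exI[of _ "E \<inter> C"]) (auto intro: openin_open_Int closedin_closed_Int)
qed

context
  fixes F :: "(split_circle \<Rightarrow> split_circle) \<Rightarrow> complex"
  assumes F: "continuous_on E F"
begin

lemma measurable_F: "F \<in> borel_measurable (borel_of (top_of_set E))"
  using continuous_map_measurable[of "top_of_set E" euclidean F] F by (simp add: borel_of_euclidean)

lemma bounded_F: "\<exists>c. \<forall>p\<in>E. norm (F p) \<le> c"
  using compact_imp_bounded[OF compact_continuous_image[OF F compact_E]] by (simp add: bounded_iff)

lemma measurable_F_enc: "(\<lambda>x. F (enc \<delta> x)) \<in> borel_measurable isometry_measure"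
  by (rule measurable_compose[OF measurable_enc_E measurable_F])

lemma enc_in_E: "x \<in> space isometry_measure \<Longrightarrow> enc \<delta> x \<in> E"
  using measurable_space[OF measurable_enc_E] by simp

lemma integrable_F_enc: "integrable isometry_measure (\<lambda>x. F (enc \<delta> x))"
proof -
  interpret prob_space isometry_measure by (rule prob_space_isometry_measure)
  obtain c where c: "\<forall>p\<in>E. norm (F p) \<le> c" using bounded_F by blast
  show ?thesis
    by (rule integrable_const_bound[of _ c]) (use c enc_in_E measurable_F_enc in auto)
qed

lemma integrable_F_\<mu>_E: "integrable (\<mu>_E \<delta>) F"
  unfolding \<mu>_E_def integrable_distr_eq[OF measurable_enc_E measurable_F] by (rule integrable_F_enc)

lemma integral_F_\<mu>_E: "(\<integral>p. F p \<partial>\<mu>_E \<delta>) = (\<integral>x. F (enc \<delta> x) \<partial>isometry_measure)"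
  unfolding \<mu>_E_def by (rule integral_distr[OF measurable_enc_E measurable_F])

lemma integrable_F_P_side:
  assumes "\<epsilon> \<in> {1, -1}" shows "integrable arc_length (\<lambda>a. F (P_side \<delta> \<epsilon> a))"
proof -
  obtain c where c: "\<forall>p\<in>E. norm (F p) \<le> c" using bounded_F by blast
  have "(\<lambda>a. F (P_side \<delta> \<epsilon> a)) \<in> borel_measurable borel"
    by (rule measurable_compose[OF two_sided_measurable[OF two_sided_E[OF assms]] measurable_F])
  then show ?thesis
    by (intro arc_length.integrable_const_bound[of _ c])
      (use c P_side_in_E[OF assms] in \<open>simp_all add: measurable_cong_sets[OF sets_arc_length refl]\<close>)
qed

lemma integral_F_formula:
  "(\<integral>p. F p \<partial>\<mu>_E \<delta>) = 1 / 2 * (\<Sum>\<epsilon>\<in>{1, -1}. \<integral>a. F (P_side \<delta> \<epsilon> a) \<partial>arc_length)"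
  unfolding integral_F_\<mu>_E integral_isometry_measure[OF integrable_F_enc]
  by (simp add: scaleR_conv_of_real)

lemma measurable_F_K: "F \<in> borel_measurable (K_haar \<delta>)"
proof -
  have "(\<lambda>p. F (enc \<delta> (dec \<delta> p))) \<in> borel_measurable (borel_of (K_topology \<delta>))"
    by (rule measurable_compose[OF measurable_dec_K measurable_F_enc])
  also have "?this \<longleftrightarrow> F \<in> borel_measurable (borel_of (K_topology \<delta>))"
    by (rule measurable_cong) (simp add: enc_dec)
  finally show ?thesis by (simp add: K_haar_def)
qed

lemma F_completion:
  "integrable (completion (K_haar \<delta>)) F"
  "(\<integral>p. F p \<partial>completion (K_haar \<delta>)) = (\<integral>p. F p \<partial>\<mu>_E \<delta>)"
proof -
  have m: "F \<in> borel_measurable (borel_of (K_topology \<delta>))"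
    using measurable_F_K by (simp add: K_haar_def)
  show "integrable (completion (K_haar \<delta>)) F"
    unfolding integrable_completion[OF measurable_F_K]
    unfolding K_haar_def integrable_distr_eq[OF measurable_enc_K m] by (rule integrable_F_enc)
  show "(\<integral>p. F p \<partial>completion (K_haar \<delta>)) = (\<integral>p. F p \<partial>\<mu>_E \<delta>)"
    unfolding integral_completion[OF measurable_F_K] integral_F_\<mu>_E
    unfolding K_haar_def by (rule integral_distr[OF measurable_enc_K m])
qed

end

text \<open>Indicator functions of clopen sets are continuous, so the integrals determine the values on clopen
  sets and, by regularity, the measure.\<close>

theorem haar_decompression_eq: "haar_decompression G (P_side \<delta> 1 0) (K_side \<delta>) = \<mu>_E \<delta>"
  unfolding haar_decompression_def ellis_haar_eq
proof (rule the_equality)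
  show "regular_borel_prob (top_of_set E) (\<mu>_E \<delta>) \<and>
      (\<forall>F :: _ \<Rightarrow> complex. continuous_on E F \<longrightarrow> integrable (completion (K_haar \<delta>)) F \<and>
        (\<integral>p. F p \<partial>\<mu>_E \<delta>) = (\<integral>k. F k \<partial>completion (K_haar \<delta>)))"
    using regular_\<mu>_E F_completion by simp
  fix \<mu> assume \<mu>: "regular_borel_prob (top_of_set E) \<mu> \<and>
      (\<forall>F :: _ \<Rightarrow> complex. continuous_on E F \<longrightarrow> integrable (completion (K_haar \<delta>)) F \<and>
        (\<integral>p. F p \<partial>\<mu>) = (\<integral>k. F k \<partial>completion (K_haar \<delta>)))"
  show "\<mu> = \<mu>_E \<delta>"
  proof (rule regular_borel_prob_eqI[OF conjunct1[OF \<mu>] regular_\<mu>_E clopen_base_E])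
    fix V assume V: "openin (top_of_set E) V" "closedin (top_of_set E) V"
    interpret \<mu>: prob_space \<mu> using regular_borel_probD(1)[OF conjunct1[OF \<mu>]] .
    interpret \<mu>_E: prob_space "\<mu>_E \<delta>" by (rule prob_space_\<mu>_E)
    define F where "F p = complex_of_real (indicator V p)" for p
    have "closed V" using V(2) closed_E by (simp add: closedin_closed_eq)
    moreover have "closed (E - V)"
      using closedin_diff[OF closedin_topspace V(1)] closed_E by (simp add: closedin_closed_eq)
    ultimately have "continuous_on (V \<union> (E - V)) (\<lambda>p. if p \<in> V then 1 else 0 :: complex)"
      by (intro continuous_on_cases) auto
    moreover have "V \<union> (E - V) = E" using openin_subset[OF V(1)] by auto
    moreover have "F = (\<lambda>p. if p \<in> V then 1 else 0)" by (auto simp: F_def indicator_def)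
    ultimately have cont: "continuous_on E F" by simp
    have "(\<integral>p. F p \<partial>\<mu>) = (\<integral>p. F p \<partial>\<mu>_E \<delta>)"
      using \<mu> cont F_completion(2)[OF cont] by simp
    moreover have "V \<inter> E = V" using openin_subset[OF V(1)] by auto
    moreover have "V \<in> sets \<mu>" "V \<in> sets (\<mu>_E \<delta>)"
      using openin_borel_of[OF V(1)] regular_borel_probD(2)[OF conjunct1[OF \<mu>]] by simp_all
    ultimately have "measure \<mu> V = measure (\<mu>_E \<delta>) V"
      by (simp add: F_def)
    then show "emeasure \<mu> V = emeasure (\<mu>_E \<delta>) V"
      by (simp add: \<mu>.emeasure_eq_measure \<mu>_E.emeasure_eq_measure)
  qed
qed

end

section \<open>Invariance and unique ergodicity\<close>

context dense_flow
begin

text \<open>A reflection in \<open>G\<close> exchanges the maps of sign \<open>+\<close> and \<open>-\<close>; the measure is invariant nevertheless since it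
  is the same for both signs.\<close>

theorem invariant_\<mu>_E: "invariant_measure ((\<circ>) ` G) (\<mu>_E \<delta>)"
  unfolding invariant_measure_def
proof
  fix f :: "(split_circle \<Rightarrow> split_circle) \<Rightarrow> split_circle \<Rightarrow> split_circle"
  let ?E = "borel_of (top_of_set E)"
  assume "f \<in> (\<circ>) ` G"
  then obtain \<epsilon> d where f: "\<epsilon> \<in> {1, -1}" "d \<in> D" "f = (\<circ>) (P_map \<epsilon> d)" by (auto simp: G_eq)
  have "continuous_map (top_of_set E) (top_of_set E) f"
    using P_map_comp_E[OF f(1,2)] continuous_on_subset[OF continuous_on_comp_left[OF continuous_on_P_map[OF f(1)]]]
    by (auto simp: f(3) continuous_map_in_subtopology)
  then have meas: "f \<in> measurable ?E ?E" by (rule continuous_map_measurable)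
  have x: "(\<epsilon>, d) \<in> space isometry_measure" using f(1) by simp
  have "distr (\<mu>_E \<delta>) ?E f = distr isometry_measure ?E (f \<circ> enc \<delta>)"
    unfolding \<mu>_E_def by (rule distr_distr[OF meas measurable_enc_E])
  also have "\<dots> = distr isometry_measure ?E (enc (sign_power \<delta> \<epsilon>) \<circ> isometry_mult (\<epsilon>, d))"
  proof (intro distr_cong refl)
    fix y assume "y \<in> space isometry_measure"
    then obtain \<epsilon>' a where "\<epsilon>' \<in> {1, -1}" "y = (\<epsilon>', a)" by (cases y) auto
    then show "(f \<circ> enc \<delta>) y = (enc (sign_power \<delta> \<epsilon>) \<circ> isometry_mult (\<epsilon>, d)) y"
      using P_map_P_side[OF f(1)] by (simp add: f(3))
  qed
  also have "\<dots> = distr (distr isometry_measure isometry_measure (isometry_mult (\<epsilon>, d))) ?E (enc (sign_power \<delta> \<epsilon>))"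
    by (rule distr_distr[OF measurable_enc_E measurable_isometry_mult_left[OF x], symmetric])
  also have "\<dots> = \<mu>_E (sign_power \<delta> \<epsilon>)"
    unfolding isometry_measure_left[OF x] \<mu>_E_def ..
  also have "\<dots> = \<mu>_E \<delta>" by (rule \<mu>_E_independent)
  finally have "distr (\<mu>_E \<delta>) ?E f = \<mu>_E \<delta>" .
  then show "f \<in> measurable (\<mu>_E \<delta>) (\<mu>_E \<delta>) \<and> distr (\<mu>_E \<delta>) (\<mu>_E \<delta>) f = \<mu>_E \<delta>"
    using meas distr_cong[OF refl sets_\<mu>_E refl, of "\<mu>_E \<delta>" \<delta> f]
    by (simp add: measurable_cong_sets[OF sets_\<mu>_E sets_\<mu>_E])
qed

lemma measurable_pt: "pt \<in> borel_measurable borel"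
  by (rule borel_measurable_continuous_onI[OF continuous_on_pt])

text \<open>An invariant measure projects to a measure on the circle that is invariant under a dense group of
  rotations, that is, to arc length. Up to a countable union of fibres, hence up to a null set, every Borel set is
  a union of fibres.\<close>

lemma invariant_measure_split_circle:
  assumes "prob_space \<nu>" and sets: "sets \<nu> = sets borel"
    and inv: "\<And>d. d \<in> D \<Longrightarrow> P_map 1 d \<in> measurable \<nu> \<nu> \<and> distr \<nu> \<nu> (P_map 1 d) = \<nu>"
  shows "\<nu> = distr arc_length borel (\<lambda>a. Split a \<rho>)"
proof -
  interpret prob_space \<nu> by fact
  have space: "space \<nu> = UNIV" using sets_eq_imp_space_eq[OF sets] by simp
  have pt: "pt \<in> measurable \<nu> borel" using measurable_pt by (simp add: measurable_cong_sets[OF sets refl])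
  have "distr \<nu> borel pt = arc_length"
  proof (rule dense_invariant_eq_arc_length[OF _ _ dense])
    show "prob_space (distr \<nu> borel pt)" by (rule prob_space_distr[OF pt])
    fix d assume d: "d \<in> D"
    note inv = inv[OF d]
    have "distr (distr \<nu> borel pt) borel ((+) d) = distr \<nu> borel ((+) d \<circ> pt)"
      using pt by (intro distr_distr) simp
    also have "(+) d \<circ> pt = pt \<circ> P_map 1 d"
    proof
      fix x show "((+) d \<circ> pt) x = (pt \<circ> P_map 1 d) x" by (cases x) simp
    qed
    also have "distr \<nu> borel \<dots> = distr (distr \<nu> \<nu> (P_map 1 d)) borel pt"
      using pt inv by (intro distr_distr[symmetric]) auto
    finally show "distr (distr \<nu> borel pt) (distr \<nu> borel pt) ((+) d) = distr \<nu> borel pt"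
      using inv by (simp add: distr_cong[OF refl sets_distr refl])
  qed simp_all
  then have proj: "emeasure \<nu> (pt -` A) = emeasure arc_length A" if "A \<in> sets borel" for A
    using emeasure_distr[OF pt that] by (simp add: space)
  have Split: "(\<lambda>a. Split a \<rho>) \<in> measurable borel borel"
    using two_sided_measurable[OF two_sided_Split] by (simp add: borel_of_euclidean)
  show ?thesis
  proof (rule measure_eqI)
    show "sets \<nu> = sets (distr arc_length borel (\<lambda>a. Split a \<rho>))" by (simp add: sets)
    fix B assume B\<nu>: "B \<in> sets \<nu>"
    then have B: "B \<in> sets borel" by (simp add: sets)
    let ?S = "(\<lambda>a. Split a \<rho>) -` B"
    have S: "?S \<in> sets borel" using measurable_sets[OF Split B] by simp
    define N where "N = {a. (Split a Plus \<in> B) \<noteq> (Split a Minus \<in> B)}"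
    have "countable N"
      using two_sided_borel[OF two_sided_Split, of B] B unfolding N_def by (simp add: borel_of_euclidean)
    then have N: "N \<in> null_sets arc_length"
      by (intro null_setsI emeasure_arc_length_countable) (simp_all add: sets.countable)
    then have Nb: "N \<in> sets borel" by (auto simp: null_sets_def)
    have ptN: "pt -` N \<in> null_sets \<nu>"
      using measurable_sets[OF pt Nb] N proj[OF Nb] by (intro null_setsI) (auto simp: space null_sets_def)
    have eq: "B - pt -` N = pt -` (?S - N)"
    proof (rule Set.set_eqI)
      fix x show "x \<in> B - pt -` N \<longleftrightarrow> x \<in> pt -` (?S - N)"
      proof (cases x)
        case (Split t \<sigma>)
        then show ?thesis by (cases \<sigma>; cases \<rho>) (auto simp: N_def)
      qed
    qed
    have "emeasure \<nu> B = emeasure \<nu> (B - pt -` N)" by (rule emeasure_Diff_null_set[OF ptN B\<nu>, symmetric])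
    also have "\<dots> = emeasure arc_length (?S - N)" unfolding eq using S Nb by (intro proj) auto
    also have "\<dots> = emeasure arc_length ?S" using S by (intro emeasure_Diff_null_set[OF N]) simp
    also have "\<dots> = emeasure (distr arc_length borel (\<lambda>a. Split a \<rho>)) B"
      using emeasure_distr[of "\<lambda>a. Split a \<rho>" arc_length borel B] Split B
      by (simp add: measurable_cong_sets[OF sets_arc_length refl])
    finally show "emeasure \<nu> B = emeasure (distr arc_length borel (\<lambda>a. Split a \<rho>)) B" .
  qed
qed

lemma invariant_prob_eq:
  assumes "invariant_prob G \<nu>" shows "\<nu> = distr arc_length borel (\<lambda>a. Split a \<rho>)"
proof (rule invariant_measure_split_circle)
  have reg: "regular_borel_prob euclidean \<nu>" and inv: "invariant_measure G \<nu>"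
    using assms by (auto simp: invariant_prob_def)
  show "prob_space \<nu>" "sets \<nu> = sets borel"
    using regular_borel_probD[OF reg] by (simp_all add: borel_of_euclidean)
  fix d assume "d \<in> D"
  then have "P_map 1 d \<in> G" by (auto simp: G_eq)
  then show "P_map 1 d \<in> measurable \<nu> \<nu> \<and> distr \<nu> \<nu> (P_map 1 d) = \<nu>"
    using inv by (simp add: invariant_measure_def)
qed

text \<open>Evaluation at \<open>x\<close> is continuous and commutes with the action.\<close>

lemma invariant_prob_eval: "invariant_prob G (distr (\<mu>_E \<delta>) borel (\<lambda>p. p x))"
  unfolding invariant_prob_def invariant_measure_def
proof (intro conjI ballI)
  let ?E = "borel_of (top_of_set E)" and ?\<nu> = "distr (\<mu>_E \<delta>) borel (\<lambda>p. p x)"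
  have cont: "continuous_map (top_of_set E) euclidean (\<lambda>p. p x)"
    by (simp add: continuous_on_subset[OF continuous_on_product_coordinates])
  show "regular_borel_prob euclidean ?\<nu>"
    using regular_borel_prob_distr[OF regular_\<mu>_E cont Hausdorff_space_euclidean_t2] by (simp add: borel_of_euclidean)
  have ev: "(\<lambda>p. p x) \<in> measurable (\<mu>_E \<delta>) borel"
    using continuous_map_measurable[OF cont] by (simp add: borel_of_euclidean measurable_cong_sets[OF sets_\<mu>_E refl])
  fix g assume g: "g \<in> G"
  then obtain \<epsilon> d where "\<epsilon> \<in> {1, -1}" "g = P_map \<epsilon> d" by (auto simp: G_eq)
  then have g_meas: "g \<in> borel_measurable borel"
    by (simp only: borel_measurable_continuous_onI[OF continuous_on_P_map])
  then show "g \<in> measurable ?\<nu> ?\<nu>" by (simp add: measurable_cong_sets[OF sets_distr sets_distr])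
  have "(\<circ>) g \<in> (\<circ>) ` G" using g by (rule imageI)
  then have inv: "(\<circ>) g \<in> measurable (\<mu>_E \<delta>) (\<mu>_E \<delta>)" "distr (\<mu>_E \<delta>) (\<mu>_E \<delta>) ((\<circ>) g) = \<mu>_E \<delta>"
    using bspec[OF invariant_\<mu>_E[of \<delta>, unfolded invariant_measure_def]] by blast+
  have "distr ?\<nu> ?\<nu> g = distr ?\<nu> borel g" by (rule distr_cong[OF refl sets_distr refl])
  also have "\<dots> = distr (\<mu>_E \<delta>) borel (g \<circ> (\<lambda>p. p x))" by (rule distr_distr[OF g_meas ev])
  also have "g \<circ> (\<lambda>p. p x) = (\<lambda>p. p x) \<circ> (\<circ>) g" by auto
  also have "distr (\<mu>_E \<delta>) borel \<dots> = distr (distr (\<mu>_E \<delta>) (\<mu>_E \<delta>) ((\<circ>) g)) borel (\<lambda>p. p x)"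
    by (rule distr_distr[OF ev inv(1), symmetric])
  also have "\<dots> = ?\<nu>" by (simp only: inv(2))
  finally show "distr ?\<nu> ?\<nu> g = ?\<nu>" .
qed

theorem uniquely_ergodic_G: "uniquely_ergodic G"
  unfolding uniquely_ergodic_def
  using invariant_prob_eval[of Plus "Split 0 Plus"] invariant_prob_eq[of _ Plus] by metis

lemma invariant_prob_integral:
  fixes \<phi> :: "split_circle \<Rightarrow> complex"
  assumes \<nu>: "invariant_prob G \<nu>" and \<phi>: "continuous_on UNIV \<phi>"
  shows "integrable \<nu> \<phi>" "integrable arc_length (\<lambda>a. \<phi> (Split a Plus) + \<phi> (Split a Minus))"
    "(\<integral>x. \<phi> x \<partial>\<nu>) = 1 / 2 * (\<integral>a. \<phi> (Split a Plus) + \<phi> (Split a Minus) \<partial>arc_length)"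
proof -
  have meas: "\<phi> \<in> borel_measurable borel" by (rule borel_measurable_continuous_onI[OF \<phi>])
  have "bounded (range \<phi>)"
    by (rule compact_imp_bounded[OF compact_continuous_image[OF \<phi> compact_split_circle]])
  then obtain c where c: "\<And>x. norm (\<phi> x) \<le> c" by (auto simp: bounded_iff)
  have Split: "(\<lambda>a. Split a \<rho>) \<in> measurable arc_length borel" for \<rho>
    using two_sided_measurable[OF two_sided_Split, of \<rho>]
    by (simp add: borel_of_euclidean measurable_cong_sets[OF sets_arc_length refl])
  have int: "integrable arc_length (\<lambda>a. \<phi> (Split a \<rho>))" for \<rho>
    by (rule arc_length.integrable_const_bound[of _ c]) (simp_all add: c measurable_compose[OF Split meas])
  show "integrable \<nu> \<phi>"
    using int[of Plus] unfolding invariant_prob_eq[OF \<nu>, of Plus] integrable_distr_eq[OF Split meas] .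
  show "integrable arc_length (\<lambda>a. \<phi> (Split a Plus) + \<phi> (Split a Minus))"
    by (intro Bochner_Integration.integrable_add int)
  have "(\<integral>x. \<phi> x \<partial>\<nu>) = (\<integral>a. \<phi> (Split a \<rho>) \<partial>arc_length)" for \<rho>
    unfolding invariant_prob_eq[OF \<nu>, of \<rho>] by (rule integral_distr[OF Split meas])
  from this[of Plus] this[of Minus]
  show "(\<integral>x. \<phi> x \<partial>\<nu>) = 1 / 2 * (\<integral>a. \<phi> (Split a Plus) + \<phi> (Split a Minus) \<partial>arc_length)"
    by (simp add: Bochner_Integration.integral_add[OF int int])
qed

end

theorem propositionA3:
  fixes \<alpha> :: circle
    and G :: "(split_circle \<Rightarrow> split_circle) set"
    and x0 :: split_circle
    and \<mu> :: "sign \<Rightarrow> (split_circle \<Rightarrow> split_circle) measure"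
  assumes "irrational \<alpha>"
    and "G = generate (BijGroup UNIV) {P_map 1 \<alpha>, P_map (-1) 0}"
    and "x0 = Split 0 Plus"
    and "\<And>\<delta>. \<mu> \<delta> = haar_decompression G (P_side \<delta> 1 0) (K_side \<delta>)"
  shows "(\<forall>\<delta>. is_ellis_group G (K_side Plus \<union> K_side Minus) (P_side \<delta> 1 0) (K_side \<delta>)) \<and>
    (\<forall>\<delta>. \<forall>F :: (split_circle \<Rightarrow> split_circle) \<Rightarrow> complex.
       continuous_on (enveloping_semigroup G) F \<longrightarrow>
         integrable (\<mu> \<delta>) F \<and>
         (\<forall>\<epsilon>\<in>{1, -1}. integrable circle_haar (\<lambda>a. F (P_side \<delta> \<epsilon> a))) \<and>
         (\<integral>p. F p \<partial>\<mu> \<delta>) =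
           1 / 2 * (\<Sum>\<epsilon>\<in>{1, -1}. \<integral>a. F (P_side \<delta> \<epsilon> a) \<partial>circle_haar)) \<and>
    \<mu> Plus = \<mu> Minus \<and>
    invariant_measure ((\<circ>) ` G) (\<mu> Plus) \<and>
    uniquely_ergodic G \<and>
    (\<forall>\<nu>. invariant_prob G \<nu> \<longrightarrow>
       (\<forall>\<phi> :: split_circle \<Rightarrow> complex. continuous_on UNIV \<phi> \<longrightarrow>
          integrable \<nu> \<phi> \<and>
          integrable circle_haar (\<lambda>a. \<phi> (Split a Plus) + \<phi> (Split a Minus)) \<and>
          (\<integral>x. \<phi> x \<partial>\<nu>) =
            1 / 2 * (\<integral>a. \<phi> (Split a Plus) + \<phi> (Split a Minus) \<partial>circle_haar)) \<and>
       (\<forall>\<delta>. distr (\<mu> \<delta>) borel (\<lambda>p. p x0) = \<nu>))"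
proof -
  define D where "D = range (\<lambda>n. int_mult n \<alpha>)"
  interpret dense_flow D G
  proof
    show "\<exists>s. \<bar>s - r\<bar> < e \<and> abs_circle s \<in> D" if "0 < e" for r e
      unfolding D_def by (rule dense_irrational_multiples[OF assms(1) that])
    show "countable D" by (simp add: D_def)
    have "int_mult m \<alpha> + int_mult n \<alpha> = int_mult (m + n) \<alpha>" for m n
      by transfer (simp add: algebra_simps)
    then show "d + d' \<in> D" if "d \<in> D" "d' \<in> D" for d d' using that by (auto simp: D_def)
    have "- int_mult n \<alpha> = int_mult (- n) \<alpha>" for n by transfer simp
    then show "- d \<in> D" if "d \<in> D" for d using that by (auto simp: D_def)
    show "G = {P_map \<epsilon> d |\<epsilon> d. \<epsilon> \<in> {1, -1} \<and> d \<in> D}"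
      unfolding assms(2) generate_P_map D_def by auto
  qed
  have \<mu>: "\<mu> \<delta> = \<mu>_E \<delta>" for \<delta> by (simp add: assms(4) haar_decompression_eq)
  have "distr (\<mu>_E \<delta>) borel (\<lambda>p. p x0) = \<nu>" if "invariant_prob G \<nu>" for \<delta> \<nu>
    using invariant_prob_eq[OF that, of Plus] invariant_prob_eq[OF invariant_prob_eval[of \<delta> x0], of Plus] by simp
  then show ?thesis
    unfolding \<mu> circle_haar_eq
    using is_ellis_group_K_side integrable_F_\<mu>_E integrable_F_P_side integral_F_formula
      \<mu>_E_independent[of Plus Minus] invariant_\<mu>_E uniquely_ergodic_G invariant_prob_integral
    by (intro conjI allI impI ballI) simp_all
qed

end
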